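(* Let $f:(\mathbb C^d,0)\to(\mathbb C^d,0)$ be a contracting rigid holomorphic germ, let $q$ be the number of irreducible components of $\mathrm{Crit}^\infty(f)$, $r$ the number of periodic ones and $p=q-r$. Then there exist holomorphic local coordinates $(u,y,t)\in\mathbb C^r\times\mathbb C^p\times\mathbb C^{d-q}$ centered at $0$ in which $$f(u,y,t)=\Big(\alpha\,u^{B},\ \beta\,u^{C}y^{D}\big(\mathbf 1+g(u,y,t)\big),\ k(u,y,t)\Big),$$ where $\alpha\in(\mathbb C^* )^r$, $\beta\in(\mathbb C^* )^p$, $B\in M_{r\times r}(\mathbb N)$ is a permutation matrix, $C\in M_{r\times p}(\mathbb N)$, $D\in M_{p\times p}(\mathbb N)$, $g:(\mathbb C^d,0)\to(\mathbb C^p,0)$ and $k:(\mathbb C^d,0)\to(\mathbb C^{d-q},0)$ are holomorphic, and $\mathrm{Crit}^\infty(f)=\{u^{\mathbf 1}y^{\mathbf 1}=0\}$ (the components $\{u^i=0\}$ being the periodic ones and $\{y^j=0\}$ the non-periodic ones).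
   Context: A holomorphic germ $f:(\mathbb C^d,0)\to(\mathbb C^d,0)$ is contracting if every eigenvalue of $df_0$ has modulus $<1$. $\mathrm{Crit}(f)=\{\det df=0\}$, $\mathrm{Crit}^\infty(f)=\bigcup_{n\ge0}f^{-n}(\mathrm{Crit}(f))$ (germ at $0$). $f$ is rigid if $\mathrm{Crit}^\infty(f)$ is a union of finitely many smooth irreducible hypersurface germs $W^1,\dots,W^q$ through $0$ meeting transversally. Writing $f^*W^k=\sum_la^k_lW^l$, a component $W^k$ is periodic if $(f^* )^\eta W^k=W^k$ for some $\eta\ge1$. Notation: for $x\in\mathbb C^s$ and $E=(e^k_l)\in M_{s\times p}(\mathbb N)$ ($l$ row, $k$ column), $x^E\in\mathbb C^p$ has $k$-th coordinate $\prod_l(x^l)^{e^k_l}$; products of vectors are coordinatewise; $\mathbf 1=(1,\dots,1)$ and $x^{\mathbf 1}=\prod_ix^i$. *)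

theory Defs
  imports "HOL-Analysis.Analysis"
begin

definition holo_on :: "(complex^'n::finite) set \<Rightarrow> (complex^'n \<Rightarrow> complex) \<Rightarrow> bool" where
  "holo_on U h \<longleftrightarrow> (\<forall>x\<in>U. \<exists>L. (h has_derivative L) (at x) \<and>
                      (\<forall>c v. L (c *s v) = c * L v))"

definition holo_map_on :: "(complex^'n::finite) set \<Rightarrow> (complex^'n \<Rightarrow> complex^'m::finite) \<Rightarrow> bool" where
  "holo_map_on U F \<longleftrightarrow> (\<forall>i. holo_on U (\<lambda>x. F x $ i))"

definition holo_germ :: "(complex^'n::finite \<Rightarrow> complex) \<Rightarrow> bool" where
  "holo_germ h \<longleftrightarrow> (\<exists>V. open V \<and> 0 \<in> V \<and> holo_on V h)"

definition holo_map_germ :: "(complex^'n::finite \<Rightarrow> complex^'m::finite) \<Rightarrow> bool" where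
  "holo_map_germ F \<longleftrightarrow> (\<exists>V. open V \<and> 0 \<in> V \<and> holo_map_on V F)"

definition jac :: "(complex^'n::finite \<Rightarrow> complex^'m::finite) \<Rightarrow> complex^'n \<Rightarrow> complex^'n^'m" where
  "jac F x = (\<chi> i j. frechet_derivative (\<lambda>y. F y $ i) (at x) (axis j 1))"

definition germ_eq :: "(complex^'n::finite) set \<Rightarrow> (complex^'n) set \<Rightarrow> bool" where
  "germ_eq A B \<longleftrightarrow> (\<exists>e>0. A \<inter> ball 0 e = B \<inter> ball 0 e)"

definition contracting :: "(complex^'n::finite \<Rightarrow> complex^'n) \<Rightarrow> bool" where
  "contracting f \<longleftrightarrow>
     (\<forall>c v. v \<noteq> 0 \<and> jac f 0 *v v = c *s v \<longrightarrow> cmod c < 1)"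

definition crit :: "(complex^'n::finite) set \<Rightarrow> (complex^'n \<Rightarrow> complex^'n) \<Rightarrow> (complex^'n) set" where
  "crit U f = {x \<in> U. det (jac f x) = 0}"

text \<open>Crit^infinity(f) = union of f^{-n}(Crit f), n \<ge> 0 (orbits taken inside U);
  only its germ at 0 is used.\<close>
definition crit_inf :: "(complex^'n::finite) set \<Rightarrow> (complex^'n \<Rightarrow> complex^'n) \<Rightarrow> (complex^'n) set" where
  "crit_inf U f = {x. \<exists>n. (\<forall>m\<le>n. (f ^^ m) x \<in> U) \<and> (f ^^ n) x \<in> crit U f}"

text \<open>Rigidity, with explicit components W^k = {h k = 0}, k < q: each h k is a holomorphic
  germ vanishing at 0; the differentials d(h k)_0 are linearly independent over C (so each
  W^k is a smooth, hence irreducible, hypersurface germ, they are pairwise distinct and meet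
  transversally), and the germ of Crit^infinity(f) at 0 is the union of the W^k.\<close>
definition rigid_components ::
  "(complex^'n::finite) set \<Rightarrow> (complex^'n \<Rightarrow> complex^'n) \<Rightarrow> nat \<Rightarrow> (nat \<Rightarrow> complex^'n \<Rightarrow> complex) \<Rightarrow> bool" where
  "rigid_components U f q h \<longleftrightarrow>
     (\<forall>k<q. holo_germ (h k) \<and> h k 0 = 0) \<and>
     (\<forall>c::nat \<Rightarrow> complex. (\<forall>v. (\<Sum>k<q. c k * frechet_derivative (h k) (at 0) v) = 0)
                         \<longrightarrow> (\<forall>k<q. c k = 0)) \<and>
     germ_eq (crit_inf U f) (\<Union>k<q. {x. h k x = 0})"

definition rigid :: "(complex^'n::finite) set \<Rightarrow> (complex^'n \<Rightarrow> complex^'n) \<Rightarrow> bool" where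
  "rigid U f \<longleftrightarrow> (\<exists>q h. rigid_components U f q h)"

text \<open>The component W = {h = 0} is periodic: (f^*)^eta W = W for some eta \<ge> 1, i.e.
  the pull-back divisor of W by f^eta is W: h \<circ> f^eta = (unit) * h near 0.\<close>
definition periodic_component :: "(complex^'n::finite \<Rightarrow> complex^'n) \<Rightarrow> (complex^'n \<Rightarrow> complex) \<Rightarrow> bool" where
  "periodic_component f h \<longleftrightarrow>
     (\<exists>\<eta>\<ge>1. \<exists>v e. e > 0 \<and> holo_on (ball 0 e) v \<and> v 0 \<noteq> 0 \<and>
        (\<forall>x\<in>ball 0 e. h ((f ^^ \<eta>) x) = v x * h x))"

definition perm_matrix_on :: "'n set \<Rightarrow> ('n \<Rightarrow> 'n \<Rightarrow> nat) \<Rightarrow> bool" where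
  "perm_matrix_on R B \<longleftrightarrow> (\<exists>\<pi>. \<pi> permutes R \<and>
      (\<forall>l\<in>R. \<forall>k\<in>R. B l k = (if l = \<pi> k then 1 else 0)))"

end

(*  Take the equations h k of the components, completed by linear forms, as local coordinates.  Since
    f maps the complement of Crit^infinity(f) into itself, h k o f vanishes only on the hyperplanes
    h l = 0, hence it is a unit u k times a monomial with exponents A k l.  The iterates of f then have
    the powers of A as exponents, and as no row of A vanishes, the row of a periodic component must be
    a unit vector: A permutes the periodic components by some pi.  Their units are normalized by
    replacing h k with h k * xi k, where xi (pi k) = (u k / u k(0)) * (xi k o f) with xi k (0) = 1;
    the solution is an infinite product along the orbits of f, which converges because f contracts.
    The non-periodic components keep their units, which only contribute to 1 + g.  *)

theory Submission
  imports Defs "HOL-Complex_Analysis.Conformal_Mappings" "HOL-Computational_Algebra.Fundamental_Theorem_Algebra"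
begin

section \<open>Holomorphic functions of several variables\<close>

text \<open>The monomial form of \<open>h k o f\<close> is obtained without unique factorization of
  germs: a function whose zeros lie on coordinate hyperplanes is divided by one coordinate after
  another, and its order of vanishing along the diagonal, which avoids the hyperplanes outside 0,
  bounds the number of divisions. Osgood's lemma reduces the holomorphy of quotients and limits to
  one complex variable. Periodic rows are unit vectors because row sums of the powers of
  \<open>A\<close> never decrease, while a power whose row \<open>k\<close> is the unit vector at
  \<open>k\<close> has row sum 1 there. The equation for \<xi> is solved for its values at
  \<open>x\<close> in terms of those at \<open>f x\<close>, since only forward iterates contract.
  This inverts the exponent matrix, which is a permutation on the periodic components but may be
  singular on the others; hence the units that stay in \<open>1 + g\<close>. Since
  \<open>h k\<close> vanishes at 0 and \<xi> is 1 there, multiplying by \<xi> does not alter the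
  differential at 0, so one matrix \<open>M\<close> is the Jacobian at 0 of both the first and the
  final chart.\<close>

definition grad :: "(complex^'n::finite \<Rightarrow> complex) \<Rightarrow> complex^'n \<Rightarrow> complex^'n" where
  "grad h x = (\<chi> j. frechet_derivative h (at x) (axis j 1))"

text \<open>A complex bilinear pairing, without conjugation, so that \<open>clin a\<close> is
  complex linear and \<open>clin (grad h x)\<close> is the complex differential of a holomorphic
  \<open>h\<close>.\<close>

definition clin :: "complex^'n::finite \<Rightarrow> complex^'n \<Rightarrow> complex" where
  "clin a v = (\<Sum>j\<in>UNIV. a $ j * v $ j)"

lemma vec_axis_sum: "(v::complex^'n::finite) = (\<Sum>i\<in>UNIV. v $ i *s axis i 1)"
  by (simp add: vec_eq_iff axis_def if_distrib cong: if_cong)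

lemma bounded_linear_clin: "bounded_linear (clin a)"
  unfolding clin_def
  by (intro bounded_linear_sum bounded_linear_const_mult bounded_linear_vec_nth)

lemma clin_scale: "clin a (c *s v) = c * clin a v"
  by (simp add: clin_def sum_distrib_left algebra_simps)

lemma clin_axis: "clin a (axis i 1) = a $ i"
  by (simp add: clin_def axis_def if_distrib cong: if_cong)

lemma clinear_eq_clin:
  fixes L :: "complex^'n::finite \<Rightarrow> complex"
  assumes "linear L" "\<And>c v. L (c *s v) = c * L v"
  shows "L = clin (\<chi> j. L (axis j 1))"
proof
  fix v :: "complex^'n"
  have "L v = L (\<Sum>i\<in>UNIV. v $ i *s axis i 1)" by (subst vec_axis_sum) simp
  also have "\<dots> = (\<Sum>i\<in>UNIV. L (v $ i *s axis i 1))" by (rule linear_sum[OF assms(1)])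
  also have "\<dots> = clin (\<chi> j. L (axis j 1)) v"
    by (simp add: assms(2) clin_def mult.commute)
  finally show "L v = clin (\<chi> j. L (axis j 1)) v" .
qed

text \<open>A real-linear map that is homogeneous over the complex numbers is fixed by its values on
  the axes. Differentials thus become vectors, and the product and chain rules become computations
  with them.\<close>

lemma holo_on_iff: "holo_on U h \<longleftrightarrow> (\<forall>x\<in>U. \<exists>a. (h has_derivative clin a) (at x))"
proof -
  have "(\<exists>L. (h has_derivative L) (at x) \<and> (\<forall>c v. L (c *s v) = c * L v))
      \<longleftrightarrow> (\<exists>a. (h has_derivative clin a) (at x))" for x
    by (metis has_derivative_linear clinear_eq_clin clin_scale)
  then show ?thesis unfolding holo_on_def by simp
qed

lemma grad_eq: "(h has_derivative clin a) (at x) \<Longrightarrow> grad h x = a"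
  by (simp add: grad_def vec_eq_iff frechet_derivative_at[symmetric] clin_axis)

lemma holo_on_grad: "holo_on U h \<Longrightarrow> x \<in> U \<Longrightarrow> (h has_derivative clin (grad h x)) (at x)"
  by (metis grad_eq holo_on_iff)

lemma holo_onI: "(\<And>x. x \<in> U \<Longrightarrow> \<exists>a. (h has_derivative clin a) (at x)) \<Longrightarrow> holo_on U h"
  by (simp add: holo_on_iff)

lemma holo_on_subset: "holo_on U h \<Longrightarrow> V \<subseteq> U \<Longrightarrow> holo_on V h"
  by (auto simp: holo_on_def)

lemma holo_map_on_subset: "holo_map_on U h \<Longrightarrow> V \<subseteq> U \<Longrightarrow> holo_map_on V h"
  by (auto simp: holo_map_on_def intro: holo_on_subset)

lemma holo_on_isCont: "holo_on U h \<Longrightarrow> x \<in> U \<Longrightarrow> isCont h x"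
  using has_derivative_continuous holo_on_grad by blast

lemma holo_on_continuous_on: "holo_on U h \<Longrightarrow> continuous_on U h"
  by (simp add: holo_on_isCont continuous_at_imp_continuous_on)

lemma holo_map_on_continuous_on:
  fixes F :: "complex^'n::finite \<Rightarrow> complex^'m::finite"
  shows "holo_map_on U F \<Longrightarrow> continuous_on U F"
  unfolding holo_map_on_def
  using continuous_on_vec_lambda[of U "\<lambda>i x. F x $ i"]
  by (simp add: holo_on_continuous_on vec_lambda_eta)

lemma clin_add: "clin (a + b) v = clin a v + clin b v"
  by (simp add: clin_def sum.distrib algebra_simps)

lemma clin_smult: "clin (c *s a) v = c * clin a v"
  by (simp add: clin_def sum_distrib_left algebra_simps)

lemma clin_0 [simp]: "clin 0 v = 0"
  by (simp add: clin_def)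

lemma holo_on_const: "holo_on U (\<lambda>x. c)"
  by (rule holo_onI, rule exI[of _ 0]) (simp add: clin_def[abs_def])

lemma holo_on_nth: "holo_on U (\<lambda>x. x $ i)"
proof (rule holo_onI, rule exI[of _ "axis i 1"])
  have "clin (axis i 1) = (\<lambda>x. x $ i)"
    by (simp add: clin_def axis_def fun_eq_iff if_distrib[of "\<lambda>x. x * _"] cong: if_cong)
  then show "((\<lambda>x. x $ i) has_derivative clin (axis i 1)) (at x)" for x
    by (simp add: bounded_linear_imp_has_derivative bounded_linear_vec_nth)
qed

lemma holo_on_add:
  assumes "holo_on U g" "holo_on U h"
  shows "holo_on U (\<lambda>x. g x + h x)"
proof (rule holo_onI)
  fix x assume x: "x \<in> U"
  have "((\<lambda>x. g x + h x) has_derivative (\<lambda>v. clin (grad g x) v + clin (grad h x) v)) (at x)"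
    by (intro derivative_intros holo_on_grad[OF assms(1)] holo_on_grad[OF assms(2)] x)
  then show "\<exists>a. ((\<lambda>x. g x + h x) has_derivative clin a) (at x)"
    by (intro exI[of _ "grad g x + grad h x"]) (simp add: clin_add[abs_def])
qed

lemma has_derivative_clin_mult:
  assumes "(g has_derivative clin a) (at x)" "(h has_derivative clin b) (at x)"
  shows "((\<lambda>x. g x * h x) has_derivative clin (h x *s a + g x *s b)) (at x)"
proof -
  have "((\<lambda>x. g x * h x) has_derivative (\<lambda>v. g x * clin b v + clin a v * h x)) (at x)"
    by (intro derivative_intros assms)
  moreover have "(\<lambda>v. g x * clin b v + clin a v * h x) = clin (h x *s a + g x *s b)"
    by (auto simp: clin_add clin_smult)
  ultimately show ?thesis by simp
qed

lemma holo_on_mult: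
  assumes "holo_on U g" "holo_on U h"
  shows "holo_on U (\<lambda>x. g x * h x)"
proof (rule holo_onI)
  fix x assume x: "x \<in> U"
  show "\<exists>a. ((\<lambda>x. g x * h x) has_derivative clin a) (at x)"
    using has_derivative_clin_mult[OF holo_on_grad[OF assms(1) x] holo_on_grad[OF assms(2) x]] by blast
qed

lemma has_derivative_clin_field:
  assumes "(g has_derivative clin a) (at x)" "(\<psi> has_field_derivative c) (at (g x))"
  shows "((\<lambda>x. \<psi> (g x)) has_derivative clin (c *s a)) (at x)"
proof -
  have "((\<lambda>x. \<psi> (g x)) has_derivative (\<lambda>v. c * clin a v)) (at x)"
    using has_derivative_compose[OF assms(1) assms(2)[unfolded has_field_derivative_def]]
    by simp
  then show ?thesis by (simp add: clin_smult[abs_def])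
qed

lemma holo_on_inverse:
  assumes "holo_on U g" "\<And>x. x \<in> U \<Longrightarrow> g x \<noteq> 0"
  shows "holo_on U (\<lambda>x. inverse (g x))"
proof (rule holo_onI)
  fix x assume x: "x \<in> U"
  show "\<exists>a. ((\<lambda>x. inverse (g x)) has_derivative clin a) (at x)"
    using has_derivative_clin_field[OF holo_on_grad[OF assms(1) x] DERIV_inverse[OF assms(2)[OF x]]]
    by blast
qed

lemma holo_on_power: "holo_on U g \<Longrightarrow> holo_on U (\<lambda>x. g x ^ n)"
  by (induction n) (auto intro: holo_on_mult holo_on_const)

lemma holo_on_prod:
  "(\<And>i. i \<in> I \<Longrightarrow> holo_on U (g i)) \<Longrightarrow> holo_on U (\<lambda>x. \<Prod>i\<in>I. g i x)"
  by (induction I rule: infinite_finite_induct) (auto intro: holo_on_mult holo_on_const)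

lemma holo_on_cong:
  assumes "open U" "\<And>x. x \<in> U \<Longrightarrow> g x = h x" "holo_on U g"
  shows "holo_on U h"
proof (rule holo_onI)
  fix x assume x: "x \<in> U"
  show "\<exists>a. (h has_derivative clin a) (at x)"
    using has_derivative_transform_within_open[OF holo_on_grad[OF assms(3) x] assms(1) x assms(2)]
    by blast
qed

lemma jac_mult: "(jac F x *v v) $ i = clin (grad (\<lambda>y. F y $ i) x) v"
  by (simp add: jac_def grad_def clin_def matrix_vector_mult_def)

lemma holo_map_on_jac:
  fixes F :: "complex^'n::finite \<Rightarrow> complex^'m::finite"
  assumes "holo_map_on U F" "x \<in> U"
  shows "(F has_derivative (\<lambda>v. jac F x *v v)) (at x)"
proof -
  have "((\<lambda>y. F y $ i) has_derivative (\<lambda>v. (jac F x *v v) $ i)) (at x)" for i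
    unfolding jac_mult using assms holo_on_grad unfolding holo_map_on_def by (metis eta_contract_eq)
  moreover have "bounded_linear (\<lambda>z::complex. axis i z :: complex^'m)" for i
    by (rule linear_conv_bounded_linear[THEN iffD1]) (auto simp: linear_iff vec_eq_iff axis_def)
  ultimately have "((\<lambda>y. \<Sum>i\<in>UNIV. axis i (F y $ i)) has_derivative (\<lambda>v. \<Sum>i\<in>UNIV. axis i ((jac F x *v v) $ i))) (at x)"
    by (intro has_derivative_sum) (rule bounded_linear.has_derivative)
  moreover have "(\<Sum>i\<in>UNIV. axis i (v $ i)) = v" for v :: "complex^'m"
    by (simp add: vec_eq_iff axis_def)
  ultimately show ?thesis by simp
qed

lemma clin_matrix: "clin a (M *v v) = clin (a v* M) v"
  by (simp add: clin_def matrix_vector_mult_def vector_matrix_mult_def sum_distrib_left sum_distrib_right)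
     (subst sum.swap, simp add: mult.assoc mult.left_commute)

lemma holo_on_compose:
  assumes F: "holo_map_on U F" and h: "holo_on V h" and FUV: "F ` U \<subseteq> V"
  shows "holo_on U (\<lambda>x. h (F x))"
proof (rule holo_onI)
  fix x assume x: "x \<in> U"
  have "((\<lambda>x. h (F x)) has_derivative (\<lambda>v. clin (grad h (F x)) (jac F x *v v))) (at x)"
    by (rule has_derivative_compose[OF holo_map_on_jac[OF F x]])
       (use holo_on_grad[OF h] FUV x in auto)
  then show "\<exists>a. ((\<lambda>x. h (F x)) has_derivative clin a) (at x)"
    by (auto simp: clin_matrix)
qed

lemma holo_map_on_compose:
  assumes "holo_map_on U F" "holo_map_on V G" "F ` U \<subseteq> V"
  shows "holo_map_on U (\<lambda>x. G (F x))"
proof -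
  have "holo_on U (\<lambda>x. (\<lambda>y. G y $ i) (F x))" for i
    by (rule holo_on_compose[OF assms(1) _ assms(3)]) (use assms(2) in \<open>simp add: holo_map_on_def\<close>)
  then show ?thesis by (simp add: holo_map_on_def)
qed

subsection \<open>Osgood's lemma\<close>

lemma has_derivative_line:
  fixes v :: "complex^'n::finite"
  shows "((\<lambda>t::complex. x + t *s v) has_derivative (\<lambda>t. t *s v)) (at t)"
proof -
  have "bounded_linear (\<lambda>t::complex. t *s v)"
    by (rule linear_conv_bounded_linear[THEN iffD1]) (auto simp: linear_iff vector_sadd_rdistrib vec_eq_iff)
  then show ?thesis
    by (auto intro!: derivative_eq_intros bounded_linear_imp_has_derivative)
qed

lemma holo_on_line_deriv:
  assumes "holo_on U h" "x + t *s v \<in> U"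
  shows "((\<lambda>t. h (x + t *s v)) has_field_derivative clin (grad h (x + t *s v)) v) (at t)"
proof -
  have "((\<lambda>t. h (x + t *s v)) has_derivative (\<lambda>s. clin (grad h (x + t *s v)) (s *s v))) (at t)"
    by (rule has_derivative_compose[OF has_derivative_line]) (use holo_on_grad[OF assms] in auto)
  moreover have "(\<lambda>s. clin (grad h (x + t *s v)) (s *s v)) = (*) (clin (grad h (x + t *s v)) v)"
    by (auto simp: clin_scale)
  ultimately show ?thesis
    by (simp add: has_field_derivative_def)
qed

lemma continuous_on_line: "continuous_on A (\<lambda>t::complex. x + t *s (v::complex^'n::finite))"
  by (rule continuous_at_imp_continuous_on) (use has_derivative_line has_derivative_continuous in blast)

lemma open_line: "open U \<Longrightarrow> open {t::complex. x + t *s (v::complex^'n::finite) \<in> U}"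
  using open_vimage[OF _ continuous_on_line[of UNIV x v]] by (simp add: vimage_def)

lemma holo_on_line:
  assumes "holo_on U h" "\<And>t. t \<in> A \<Longrightarrow> x + t *s v \<in> U"
  shows "(\<lambda>t. h (x + t *s v)) holomorphic_on A"
  using holo_on_line_deriv[OF assms(1) assms(2)]
  by (meson field_differentiable_at_within field_differentiable_def holomorphic_onI)

lemma norm_smult_vec: "norm (c *s (v::complex^'n::finite)) = cmod c * norm v"
  by (simp add: norm_vec_def norm_mult L2_set_def power_mult_distrib sum_distrib_left[symmetric] real_sqrt_mult)

lemma norm_axis_complex_1 [simp]: "norm (axis i (1::complex)) = 1"
  by (simp add: norm_vec_def L2_set_def axis_def if_distrib[of norm] if_distrib[of "\<lambda>x. x\<^sup>2"] cong: if_cong)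

text \<open>Hypotheses on partial derivatives are given at parameter 0 of a line through every
  point; sliding the base point along the line turns them into differentiability at every
  parameter.\<close>

lemma has_field_derivative_line_shift:
  assumes "((\<lambda>s. F ((y + t *s v) + s *s v)) has_field_derivative c) (at 0)"
  shows "((\<lambda>s::complex. F (y + s *s (v::complex^'n::finite))) has_field_derivative c) (at t)"
proof -
  have "((\<lambda>s. F ((y + t *s v) + s *s v)) has_field_derivative c) (at (t - t))"
    using assms by simp
  moreover have "((\<lambda>s. s - t) has_field_derivative 1) (at t)"
    by (auto intro!: derivative_eq_intros)
  ultimately have "((\<lambda>s. F ((y + t *s v) + (s - t) *s v)) has_field_derivative (c * 1)) (at t)"
    by (rule DERIV_chain2)
  then show ?thesis
    by (simp add: vector_sub_rdistrib algebra_simps)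
qed

text \<open>Cauchy's estimate for the difference of two restrictions of \<open>F\<close> to parallel
  discs: uniform continuity makes them close on the whole disc, hence also their derivatives at the
  centre.\<close>

lemma partial_deriv_continuous:
  fixes F :: "complex^'n::finite \<Rightarrow> complex"
  assumes V: "open V" and cont: "continuous_on V F"
    and fd: "\<And>x i. x \<in> V \<Longrightarrow> (\<lambda>t. F (x + t *s axis i 1)) field_differentiable (at 0)"
  shows "continuous_on V (\<lambda>x. deriv (\<lambda>t. F (x + t *s axis i 1)) 0)"
proof (rule continuous_at_imp_continuous_on, rule ballI)
  fix x0 assume x0: "x0 \<in> V"
  then obtain r0 where r0: "r0 > 0" "cball x0 r0 \<subseteq> V" using V open_contains_cball by blast
  \<comment> \<open>Half of \<open>r0\<close>: a disc of radius \<open>r\<close> around a point at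
    distance at most \<open>r\<close> from \<open>x0\<close> stays in the larger ball.\<close>
  define r where "r = r0/2"
  have r: "r > 0" "cball x0 (2*r) \<subseteq> V" using r0 by (auto simp: r_def)
  have "uniformly_continuous_on (cball x0 (2*r)) F"
    by (rule compact_uniformly_continuous[OF continuous_on_subset[OF cont r(2)] compact_cball])
  note uc = this[unfolded uniformly_continuous_on_def, rule_format]
  have inV: "y + t *s axis i 1 \<in> cball x0 (2*r)" if "dist x0 y \<le> r" "cmod t \<le> r" for y t
  proof -
    have "norm (x0 - (y + t *s axis i 1)) \<le> norm (x0 - y) + norm (t *s (axis i 1::complex^'n))"
      by (metis diff_diff_eq norm_triangle_ineq4)
    also have "\<dots> \<le> 2 * r" using that by (simp add: norm_smult_vec dist_norm)
    finally show ?thesis by (simp add: dist_norm)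
  qed
  have fd': "(\<lambda>t. F (y + t *s axis i 1)) field_differentiable (at t)" if "y + t *s axis i 1 \<in> V" for y t
    using fd[OF that] has_field_derivative_line_shift unfolding field_differentiable_def by blast
  have holo: "(\<lambda>t. F (y + t *s axis i 1)) holomorphic_on cball 0 r" if "dist x0 y \<le> r" for y
    by (rule holomorphic_onI, rule field_differentiable_at_within, rule fd')
       (use inV that r in auto)
  show "isCont (\<lambda>x. deriv (\<lambda>t. F (x + t *s axis i 1)) 0) x0"
    unfolding continuous_at_eps_delta
  proof safe
    fix e :: real assume e: "e > 0"
    \<comment> \<open>After division by the radius \<open>r\<close> in Cauchy's estimate this
      tolerance becomes \<open>e/2\<close>.\<close>
    then have "e*r/2 > 0" using r by auto
    from uc[OF this] obtain d where d: "d > 0"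
      "\<And>x x'. x \<in> cball x0 (2*r) \<Longrightarrow> x' \<in> cball x0 (2*r) \<Longrightarrow> dist x' x < d \<Longrightarrow> dist (F x') (F x) < e*r/2"
      by blast
    show "\<exists>d>0. \<forall>x'. dist x' x0 < d \<longrightarrow>
      dist (deriv (\<lambda>t. F (x' + t *s axis i 1)) 0) (deriv (\<lambda>t. F (x0 + t *s axis i 1)) 0) < e"
    proof (intro exI[of _ "min d r"] conjI allI impI)
      fix y assume y: "dist y x0 < min d r"
      let ?G = "\<lambda>t. F (y + t *s axis i 1) - F (x0 + t *s axis i 1)"
      have y': "dist x0 y \<le> r" using y by (simp add: dist_commute)
      have h1: "?G holomorphic_on cball 0 r"
        using holo[OF y'] holo[of x0] r by (auto intro!: holomorphic_intros)
      have "norm ((deriv ^^ 1) ?G 0) \<le> fact 1 * (e*r/2) / r^1"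
      proof (rule Cauchy_inequality)
        show "?G holomorphic_on ball 0 r" using h1 holomorphic_on_subset ball_subset_cball by blast
        show "continuous_on (cball 0 r) ?G" using h1 holomorphic_on_imp_continuous_on by blast
        fix t assume "cmod (0 - t) = r"
        then have t: "cmod t \<le> r" by auto
        have "dist (F (y + t *s axis i 1)) (F (x0 + t *s axis i 1)) < e*r/2"
          by (rule d(2)) (use inV[OF _ t] y y' r in auto)
        then show "cmod (?G t) \<le> e*r/2" by (simp add: dist_norm)
      qed (use r in auto)
      moreover have "deriv ?G 0 = deriv (\<lambda>t. F (y + t *s axis i 1)) 0 - deriv (\<lambda>t. F (x0 + t *s axis i 1)) 0"
        by (rule deriv_diff; rule fd') (use inV[of y 0] inV[of x0 0] y' r in auto)
      ultimately have "cmod (deriv (\<lambda>t. F (y + t *s axis i 1)) 0 - deriv (\<lambda>t. F (x0 + t *s axis i 1)) 0) \<le> e/2"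
        using r by simp
      then show "dist (deriv (\<lambda>t. F (y + t *s axis i 1)) 0) (deriv (\<lambda>t. F (x0 + t *s axis i 1)) 0) < e"
        using e by (simp add: dist_norm)
    qed (use d r in auto)
  qed
qed

lemma norm_partial_vec_le:
  "norm (\<Sum>i\<in>S. (v::complex^'n::finite) $ i *s axis i 1) \<le> real CARD('n) * norm v"
proof -
  have "norm (\<Sum>i\<in>S. v $ i *s axis i 1) \<le> (\<Sum>i\<in>S. norm (v $ i *s axis i (1::complex)))"
    by (rule norm_sum)
  also have "\<dots> \<le> (\<Sum>i\<in>S. norm v)"
    by (rule sum_mono) (simp add: norm_smult_vec Finite_Cartesian_Product.norm_nth_le)
  also have "\<dots> = real (card S) * norm v" by simp
  also have "\<dots> \<le> real CARD('n) * norm v"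
    by (intro mult_right_mono) (auto intro: card_mono)
  finally show ?thesis .
qed

text \<open>The path from \<open>x\<close> to \<open>x + v\<close> moves one coordinate at a time,
  \<open>S\<close> being those already moved. Each leg is a one-variable increment, estimated by the
  mean value inequality and the continuity of the partial derivative at \<open>x\<close>.\<close>

lemma osgood_partial:
  fixes F :: "complex^'n::finite \<Rightarrow> complex"
  assumes V: "open V" and fd: "\<And>x i. x \<in> V \<Longrightarrow> (\<lambda>t. F (x + t *s axis i 1)) field_differentiable (at 0)"
    and contD: "\<And>i. continuous_on V (\<lambda>x. deriv (\<lambda>t. F (x + t *s axis i 1)) 0)"
    and x: "x \<in> V" and e: "e > 0"
  shows "\<exists>d>0. \<forall>v. norm v < d \<longrightarrow> norm (F (x + (\<Sum>i\<in>S. v $ i *s axis i 1)) - F x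
            - (\<Sum>i\<in>S. deriv (\<lambda>t. F (x + t *s axis i 1)) 0 * v $ i)) \<le> e * norm v"
  using finite[of S] e
proof (induction S arbitrary: e rule: finite_induct)
  case empty
  then show ?case by (auto intro!: exI[of _ 1])
next
  case (insert j S)
  let ?D = "\<lambda>i x. deriv (\<lambda>t. F (x + t *s axis i 1)) 0"
  let ?p = "\<lambda>S v. \<Sum>i\<in>S. v $ i *s axis i (1::complex)"
  let ?N = "real CARD('n)"
  have fd': "((\<lambda>t. F (y + t *s axis i 1)) has_field_derivative ?D i (y + t *s axis i 1)) (at t)"
    if "y + t *s axis i 1 \<in> V" for y t i
    by (rule has_field_derivative_line_shift) (use fd[OF that] in \<open>simp add: DERIV_deriv_iff_field_differentiable\<close>)
  have N: "?N \<ge> 1" by (simp add: Suc_leI)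
  from insert.prems insert.IH[of "e/2"] obtain d1 where d1: "d1 > 0"
    "\<And>v. norm v < d1 \<Longrightarrow> norm (F (x + ?p S v) - F x - (\<Sum>i\<in>S. ?D i x * v $ i)) \<le> e/2 * norm v"
    by auto
  have "isCont (?D j) x" using contD[of j] V x continuous_on_eq_continuous_at by blast
  then obtain d2 where d2: "d2 > 0" "\<And>y. dist y x < d2 \<Longrightarrow> dist (?D j y) (?D j x) < e/2"
    unfolding continuous_at_eps_delta using insert.prems by (meson half_gt_zero)
  obtain d3 where d3: "d3 > 0" "ball x d3 \<subseteq> V" using V x open_contains_ball by blast
  \<comment> \<open>A partial sum of \<open>v\<close> has norm at most \<open>?N * norm v\<close>
    and the last leg adds at most \<open>norm v\<close>, so every point met lies within
    \<open>2 * ?N * d\<close> of \<open>x\<close>.\<close>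
  define d where "d = min d1 (min d2 d3 / (2 * ?N))"
  have dle: "d \<le> d1" "2 * ?N * d \<le> d2" "2 * ?N * d \<le> d3"
    using N by (auto simp: d_def min_def field_simps)
  have dpos: "d > 0" using d1 d2 d3 N by (auto simp: d_def)
  show ?case
  proof (intro exI[of _ d] conjI dpos allI impI)
    fix v :: "complex^'n" assume v: "norm v < d"
    define y where "y = x + ?p S v"
    have near: "dist (y + t *s axis j 1) x < 2 * ?N * d" if "cmod t \<le> norm v" for t
    proof -
      have "norm (y + t *s axis j 1 - x) \<le> norm (?p S v) + norm (t *s (axis j 1 :: complex^'n))"
        using norm_triangle_ineq[of "?p S v" "t *s axis j 1"] by (simp add: y_def algebra_simps)
      also have "\<dots> \<le> ?N * norm v + 1 * norm v"
        using norm_partial_vec_le[of v S] that by (simp add: norm_smult_vec)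
      also have "\<dots> \<le> ?N * norm v + ?N * norm v" using N by (intro add_mono mult_right_mono) auto
      also have "\<dots> < 2 * ?N * d" using v N by simp
      finally show ?thesis by (simp add: dist_norm)
    qed
    \<comment> \<open>Subtracting the linear term leaves a function of \<open>t\<close> whose
      derivative is at most \<open>e/2\<close>, so that the mean value bound is already the error
      estimate.\<close>
    have B: "norm ((\<lambda>t. F (y + t *s axis j 1) - ?D j x * t) (v $ j) - (\<lambda>t. F (y + t *s axis j 1) - ?D j x * t) 0)
       \<le> e/2 * norm (v $ j - 0)"
    proof (rule field_differentiable_bound)
      fix t :: complex assume t: "t \<in> cball 0 (norm v)"
      have inV: "y + t *s axis j 1 \<in> V"
        using near[of t] t d3(2) dle by (auto simp: dist_commute subset_eq)
      show "((\<lambda>t. F (y + t *s axis j 1) - ?D j x * t) has_field_derivative (?D j (y + t *s axis j 1) - ?D j x)) (at t within cball 0 (norm v))"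
        by (rule has_field_derivative_at_within)
           (auto intro!: derivative_eq_intros fd'[OF inV])
      have "dist (?D j (y + t *s axis j 1)) (?D j x) < e/2"
        by (rule d2(2)) (use near[of t] t dle in auto)
      then show "norm (?D j (y + t *s axis j 1) - ?D j x) \<le> e/2" by (simp add: dist_norm)
    qed (auto simp: Finite_Cartesian_Product.norm_nth_le)
    have B': "norm (F (y + v $ j *s axis j 1) - F y - ?D j x * v $ j) \<le> e/2 * norm v"
      using B Finite_Cartesian_Product.norm_nth_le[of v j] insert.prems
      by (intro order.trans[OF _ mult_left_mono[of "norm (v $ j)" "norm v" "e/2"]]) (simp_all add: algebra_simps)
    have eq: "x + ?p (insert j S) v = y + v $ j *s axis j 1"
      using insert.hyps by (simp add: y_def)
    have "F (x + ?p (insert j S) v) - F x - (\<Sum>i\<in>insert j S. ?D i x * v $ i)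
      = (F (y + v $ j *s axis j 1) - F y - ?D j x * v $ j) + (F y - F x - (\<Sum>i\<in>S. ?D i x * v $ i))"
      unfolding eq using insert.hyps by simp
    also have "norm \<dots> \<le> e/2 * norm v + e/2 * norm v"
      using B' d1(2)[of v] v dle by (intro norm_triangle_le add_mono) (auto simp: y_def)
    finally show "norm (F (x + ?p (insert j S) v) - F x - (\<Sum>i\<in>insert j S. ?D i x * v $ i)) \<le> e * norm v"
      by simp
  qed
qed

text \<open>The criterion by which quotients and limits are shown to be holomorphic: it asks only
  for continuity and for holomorphy on complex lines, where one-variable theorems apply.\<close>

lemma osgood:
  fixes F :: "complex^'n::finite \<Rightarrow> complex"
  assumes V: "open V" and cont: "continuous_on V F"
    and fd: "\<And>x i. x \<in> V \<Longrightarrow> (\<lambda>t. F (x + t *s axis i 1)) field_differentiable (at 0)"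
  shows "holo_on V F"
proof (rule holo_onI)
  fix x assume x: "x \<in> V"
  define D where "D = (\<chi> i. deriv (\<lambda>t. F (x + t *s axis i 1)) 0)"
  have "(F has_derivative clin D) (at x)"
    unfolding has_derivative_at_alt
  proof (intro conjI allI impI bounded_linear_clin)
    fix e :: real assume "e > 0"
    from osgood_partial[OF V fd partial_deriv_continuous[OF V cont fd] x this, where S=UNIV]
    obtain d where d: "d > 0" "\<And>v. norm v < d \<Longrightarrow> norm (F (x + (\<Sum>i\<in>UNIV. v $ i *s axis i 1)) - F x
            - (\<Sum>i\<in>UNIV. deriv (\<lambda>t. F (x + t *s axis i 1)) 0 * v $ i)) \<le> e * norm v" by auto
    show "\<exists>d>0. \<forall>y. norm (y - x) < d \<longrightarrow> norm (F y - F x - clin D (y - x)) \<le> e * norm (y - x)"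
    proof (intro exI[of _ d] conjI d(1) allI impI)
      fix y assume "norm (y - x) < d"
      from d(2)[OF this] show "norm (F y - F x - clin D (y - x)) \<le> e * norm (y - x)"
        unfolding vec_axis_sum[symmetric] by (simp add: D_def clin_def)
    qed
  qed
  then show "\<exists>a. (F has_derivative clin a) (at x)" by blast
qed

lemma holo_on_field_differentiable:
  assumes "holo_on V F" "x \<in> V"
  shows "(\<lambda>t. F (x + t *s v)) field_differentiable (at 0)"
  using holo_on_line_deriv[of V F x 0 v] assms by (auto simp: field_differentiable_def)

lemma grad_eq_deriv:
  assumes "holo_on V F" "x \<in> V"
  shows "grad F x $ i = deriv (\<lambda>t. F (x + t *s axis i 1)) 0"
  using holo_on_line_deriv[of V F x 0 "axis i 1"] assms by (simp add: DERIV_imp_deriv clin_axis)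

lemma continuous_on_grad:
  assumes "open V" "holo_on V F"
  shows "continuous_on V (\<lambda>x. grad F x $ i)"
proof -
  have "continuous_on V (\<lambda>x. deriv (\<lambda>t. F (x + t *s axis i 1)) 0)"
    using assms by (intro partial_deriv_continuous holo_on_continuous_on holo_on_field_differentiable)
  then show ?thesis using grad_eq_deriv[OF assms(2)] by (simp cong: continuous_on_cong)
qed

lemma holo_on_uniform_limit:
  fixes F :: "nat \<Rightarrow> complex^'n::finite \<Rightarrow> complex"
  assumes V: "open V" and F: "\<And>n. holo_on V (F n)"
    and lim: "uniform_limit V F G sequentially"
  shows "holo_on V G"
proof (rule osgood[OF V])
  show "continuous_on V G"
    by (rule uniform_limit_theorem[OF _ lim]) (simp_all add: F holo_on_continuous_on)
  fix x i assume x: "x \<in> V"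
  let ?A = "{t. x + t *s axis i 1 \<in> V}"
  have "(\<lambda>t. G (x + t *s axis i 1)) holomorphic_on ?A"
  proof (rule holomorphic_uniform_sequence[OF open_line[OF V]])
    show "(\<lambda>t. F n (x + t *s axis i 1)) holomorphic_on ?A" for n
      by (rule holo_on_line[OF F]) auto
    fix t assume "t \<in> ?A"
    then obtain d where d: "d > 0" "cball t d \<subseteq> ?A" using open_line[OF V] open_contains_cball by blast
    have "uniform_limit (cball t d) (\<lambda>n t. F n (x + t *s axis i 1)) (\<lambda>t. G (x + t *s axis i 1)) sequentially"
      by (rule uniform_limit_compose'[OF lim]) (use d in auto)
    then show "\<exists>d>0. cball t d \<subseteq> ?A \<and> uniform_limit (cball t d) (\<lambda>n t. F n (x + t *s axis i 1)) (\<lambda>t. G (x + t *s axis i 1)) sequentially"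
      using d by blast
  qed
  then show "(\<lambda>t. G (x + t *s axis i 1)) field_differentiable (at 0)"
    using x open_line[OF V] by (auto simp: holomorphic_on_open field_differentiable_def)
qed

section \<open>Division by a coordinate and monomial factorization\<close>

text \<open>On the hyperplane the quotient is defined as the partial derivative. Along direction
  \<open>i\<close> the singularity is removable; in the other directions a line inside the
  hyperplane is a uniform limit of lines off it. With continuity, Osgood's lemma concludes.\<close>

lemma holo_on_divide_coord:
  fixes F :: "complex^'n::finite \<Rightarrow> complex"
  assumes V: "open V" and F: "holo_on V F" and F0: "\<And>x. x \<in> V \<Longrightarrow> x $ i = 0 \<Longrightarrow> F x = 0"
  shows "\<exists>G. holo_on V G \<and> (\<forall>x\<in>V. F x = x $ i * G x)"
proof -
  define G where "G x = (if x $ i = 0 then grad F x $ i else F x / x $ i)" for x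
  let ?e = "axis i (1::complex) :: complex^'n"
  \<comment> \<open>Projection to the hyperplane, so that the parameter of the line through
    \<open>x' x\<close> is the value of coordinate \<open>i\<close>.\<close>
  define x' where "x' x = x - (x $ i) *s ?e" for x
  have x'_nth [simp]: "(x' x + t *s ?e) $ i = t" for x t by (simp add: x'_def axis_def)
  have x'_back: "x' x + x $ i *s ?e = x" for x by (simp add: x'_def)
  have line: "(\<lambda>t. G (x' x + t *s ?e)) holomorphic_on {t. x' x + t *s ?e \<in> V}" (is "_ holomorphic_on ?A") for x
  proof -
    let ?f = "\<lambda>t. F (x' x + t *s ?e)"
    have op: "open ?A" by (rule open_line[OF V])
    have hol: "?f holomorphic_on ?A" by (rule holo_on_line[OF F]) auto
    have "(\<lambda>t. if t = 0 then deriv ?f 0 else (?f t - ?f 0) / (t - 0)) holomorphic_on ?A \<or> 0 \<notin> ?A"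
      using pole_lemma_open[OF hol op] by blast
    moreover have "G (x' x + t *s ?e) = (if t = 0 then deriv ?f 0 else (?f t - ?f 0) / (t - 0))"
      if "t \<in> ?A" "0 \<in> ?A" for t
    proof (cases "t = 0")
      case True
      then show ?thesis using that x'_nth[of x 0] grad_eq_deriv[OF F, of "x' x" i] by (simp add: G_def)
    next
      case False
      then show ?thesis using that x'_nth[of x t] x'_nth[of x 0] F0 by (simp add: G_def)
    qed
    \<comment> \<open>\<open>V\<close> need not contain the projection \<open>x' x\<close>; then the
      line misses the hyperplane inside \<open>V\<close> and plain division works.\<close>
    moreover have "(\<lambda>t. G (x' x + t *s ?e)) holomorphic_on ?A" if "0 \<notin> ?A"
    proof -
      have "(\<lambda>t. ?f t / t) holomorphic_on ?A"
        using that by (intro holomorphic_intros hol) auto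
      moreover have "?f t / t = G (x' x + t *s ?e)" if "t \<in> ?A" for t
        using that \<open>0 \<notin> ?A\<close> x'_nth[of x t] by (auto simp: G_def)
      ultimately show ?thesis by (rule holomorphic_transform)
    qed
    ultimately show ?thesis by (smt (verit, ccfv_SIG) holomorphic_transform)
  qed
  have off: "holo_on (V \<inter> {x. x $ i \<noteq> 0}) G" and opoff: "open (V \<inter> {x. x $ i \<noteq> 0})"
  proof -
    show op: "open (V \<inter> {x. x $ i \<noteq> 0})"
      by (intro open_Int V open_Collect_neq continuous_intros)
    have "holo_on (V \<inter> {x. x $ i \<noteq> 0}) (\<lambda>x. F x * inverse (x $ i))"
      by (intro holo_on_mult holo_on_inverse holo_on_nth holo_on_subset[OF F]) auto
    then show "holo_on (V \<inter> {x. x $ i \<noteq> 0}) G"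
      by (rule holo_on_cong[OF op, rotated]) (simp add: G_def divide_inverse)
  qed
  have cont: "isCont G x0" if x0: "x0 \<in> V" for x0
  proof (cases "x0 $ i = 0")
    case False
    then show ?thesis using holo_on_isCont[OF off] x0 by auto
  next
    case True
    have x'0: "x' x0 = x0" using True by (simp add: x'_def)
    obtain r0 where r0: "r0 > 0" "cball x0 r0 \<subseteq> V" using V x0 open_contains_cball by blast
    \<comment> \<open>A third: the projection at most doubles the distance to \<open>x0\<close>, and
      the parameter adds at most \<open>r\<close>.\<close>
    define r where "r = r0/3"
    have r: "r > 0" "cball x0 (3*r) \<subseteq> V" using r0 by (auto simp: r_def)
    have "uniformly_continuous_on (cball x0 (3*r)) F"
      by (rule compact_uniformly_continuous[OF continuous_on_subset[OF holo_on_continuous_on[OF F] r(2)] compact_cball])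
    note uc = this[unfolded uniformly_continuous_on_def, rule_format]
    have d2: "norm (x' y - x0) \<le> 2 * norm (y - x0)" for y
    proof -
      have "x' y - x0 = (y - x0) - ((y - x0) $ i) *s ?e" using True by (simp add: x'_def)
      also have "norm \<dots> \<le> norm (y - x0) + norm (((y - x0) $ i) *s ?e)" by (rule norm_triangle_ineq4)
      also have "\<dots> \<le> norm (y - x0) + norm (y - x0)"
        using Finite_Cartesian_Product.norm_nth_le[of "y - x0" i] unfolding norm_smult_vec by simp
      finally show ?thesis by simp
    qed
    have inb: "x' y + t *s ?e \<in> cball x0 (3*r)" if "norm (y - x0) < r" "cmod t \<le> r" for y t
    proof -
      have "norm (x' y + t *s ?e - x0) \<le> norm (x' y - x0) + norm (t *s ?e)"
        using norm_triangle_ineq[of "x' y - x0" "t *s ?e"] by (simp add: algebra_simps)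
      also have "\<dots> \<le> 3 * r" using d2[of y] that by (simp add: norm_smult_vec)
      finally show ?thesis by (simp add: dist_norm norm_minus_commute)
    qed
    have hol: "(\<lambda>t. G (x' y + t *s ?e)) holomorphic_on cball 0 r" if "norm (y - x0) < r" for y
      by (rule holomorphic_on_subset[OF line]) (use inb that r in auto)
    show ?thesis
      unfolding continuous_at_eps_delta
    proof (intro allI impI)
      fix e :: real assume e: "e > 0"
      then have "e*r/2 > 0" using r by auto
      from uc[OF this] obtain d where d: "d > 0"
        "\<And>x x'. x \<in> cball x0 (3*r) \<Longrightarrow> x' \<in> cball x0 (3*r) \<Longrightarrow> dist x' x < d \<Longrightarrow> dist (F x') (F x) < e*r/2"
        by blast
      have "isCont (\<lambda>t. G (x' x0 + t *s ?e)) 0"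
        using holomorphic_on_imp_continuous_on[OF hol[of x0]] r
        by (metis centre_in_ball continuous_on_interior diff_self interior_cball norm_zero)
      then obtain d' where d': "d' > 0" "\<And>t. dist t 0 < d' \<Longrightarrow> dist (G (x' x0 + t *s ?e)) (G (x' x0 + 0 *s ?e)) < e/2"
        unfolding continuous_at_eps_delta using e by (meson half_gt_zero)
      show "\<exists>d>0. \<forall>x'. dist x' x0 < d \<longrightarrow> dist (G x') (G x0) < e"
      proof (intro exI[of _ "min (d/2) (min d' r)"] conjI allI impI)
        fix y assume "dist y x0 < min (d/2) (min d' r)"
        then have y: "norm (y - x0) < d/2" "norm (y - x0) < d'" "norm (y - x0) < r" by (auto simp: dist_norm)
        define t where "t = y $ i"
        have t: "cmod t \<le> norm (y - x0)" using Finite_Cartesian_Product.norm_nth_le[of "y - x0" i] True by (simp add: t_def)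
        \<comment> \<open>By the maximum principle \<open>?\<psi>\<close> is bounded by its values on the circle of radius \<open>r\<close>, where \<open>G = F / x$i\<close>.\<close>
        let ?\<psi> = "\<lambda>t. G (x' y + t *s ?e) - G (x' x0 + t *s ?e)"
        have h: "?\<psi> holomorphic_on cball 0 r"
          using hol[OF y(3)] hol[of x0] r by (auto intro!: holomorphic_intros)
        have "norm (?\<psi> t) \<le> e/2"
        proof (rule maximum_modulus_frontier[where S="cball 0 r" and f="?\<psi>"])
          show "?\<psi> holomorphic_on interior (cball 0 r)" using h holomorphic_on_subset interior_subset by blast
          show "continuous_on (closure (cball 0 r)) ?\<psi>" using h holomorphic_on_imp_continuous_on by simp
          show "t \<in> cball 0 r" using t y by simp
          fix s :: complex assume "s \<in> frontier (cball 0 r)"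
          then have s: "cmod s = r" using r by (simp add: sphere_def)
          then have s0: "s \<noteq> 0" using r by auto
          have "dist (x' y + s *s ?e) (x' x0 + s *s ?e) < d"
            using d2[of y] y(1) x'0 by (simp add: dist_norm)
          then have "dist (F (x' y + s *s ?e)) (F (x' x0 + s *s ?e)) < e*r/2"
            using d(2)[OF inb[of x0 s] inb[of y s]] y s r by simp
          moreover have "?\<psi> s = (F (x' y + s *s ?e) - F (x' x0 + s *s ?e)) / s"
            using s0 x'_nth[of y s] x'_nth[of x0 s] by (simp add: G_def diff_divide_distrib)
          ultimately show "norm (?\<psi> s) \<le> e/2" using s r
            by (simp add: norm_divide dist_norm field_simps)
        qed (auto)
        moreover have "norm (G (x' x0 + t *s ?e) - G x0) < e/2"
          using d'(2)[of t] t y x'0 by (simp add: dist_norm)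
        moreover have "G y = G (x' y + t *s ?e)" by (simp add: t_def x'_back)
        ultimately show "dist (G y) (G x0) < e"
          using norm_triangle_ineq[of "?\<psi> t" "G (x' x0 + t *s ?e) - G x0"] by (simp add: dist_norm)
      qed (use d d' r in auto)
    qed
  qed
  have contV: "continuous_on V G" using cont continuous_at_imp_continuous_on by blast
  have "holo_on V G"
  proof (rule osgood[OF V contV])
    fix x j assume x: "x \<in> V"
    show "(\<lambda>t. G (x + t *s axis j 1)) field_differentiable at 0"
    proof (cases "x $ i = 0")
      case False
      then show ?thesis using holo_on_field_differentiable[OF off, of x] x by auto
    next
      case True
      show ?thesis
      proof (cases "j = i")
        case True
        have "x' x = x" using \<open>x $ i = 0\<close> by (simp add: x'_def)
        then show ?thesis using line[of x] x True open_line[OF V]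
          by (auto simp: holomorphic_on_open field_differentiable_def)
      next
        case False
        let ?j = "axis j (1::complex) :: complex^'n"
        obtain r0 where r0: "r0 > 0" "cball x r0 \<subseteq> V" using V x open_contains_cball by blast
        define r where "r = r0/2"
        have r: "r > 0" "cball x (2*r) \<subseteq> V" using r0 by (auto simp: r_def)
        \<comment> \<open>Shifted by a small amount in direction \<open>i\<close>; since
          \<open>j\<close> differs from \<open>i\<close>, coordinate \<open>i\<close> stays nonzero
          along the whole shifted line.\<close>
        define p where "p n t = x + complex_of_real (r / real (Suc n)) *s ?e + t *s ?j" for n t
        have pin: "p n t \<in> cball x (2*r)" if "cmod t \<le> r" for n t
        proof -
          have "norm (p n t - x) \<le> norm (complex_of_real (r / real (Suc n)) *s ?e) + norm (t *s ?j)"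
            unfolding p_def by (simp add: norm_triangle_ineq)
          also have "\<dots> \<le> r + r" using that r
            by (intro add_mono) (auto simp: norm_smult_vec norm_divide divide_le_eq simp del: of_nat_Suc)
          finally show ?thesis by (simp add: dist_norm norm_minus_commute)
        qed
        have pnz: "p n t $ i \<noteq> 0" for n t
          using True False r by (simp add: p_def axis_def del: of_nat_Suc)
        have ucG: "uniformly_continuous_on (cball x (2*r)) G"
          by (rule compact_uniformly_continuous[OF continuous_on_subset[OF contV r(2)] compact_cball])
        have "uniform_limit (cball 0 r) p (\<lambda>t. x + t *s ?j) sequentially"
        proof (rule uniform_limitI)
          fix e :: real assume e: "e > 0"
          have "(\<lambda>n. r / real (Suc n)) \<longlonglongrightarrow> 0"
            using LIMSEQ_Suc lim_const_over_n by blast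
          then have "\<forall>\<^sub>F n in sequentially. \<bar>r / real (Suc n)\<bar> < e"
            using e by (auto simp: tendsto_iff simp del: of_nat_Suc)
          then show "\<forall>\<^sub>F n in sequentially. \<forall>t\<in>cball 0 r. dist (p n t) (x + t *s ?j) < e"
            by (rule eventually_mono) (simp add: p_def dist_norm norm_smult_vec norm_divide del: of_nat_Suc)
        qed
        then have ul: "uniform_limit (cball 0 r) (\<lambda>n t. G (p n t)) (\<lambda>t. G (x + t *s ?j)) sequentially"
          by (rule uniform_limit_compose_uniformly_continuous_on[OF _ ucG])
             (auto intro!: always_eventually pin simp del: mem_cball)
        have holn: "(\<lambda>t. G (p n t)) holomorphic_on cball 0 r" for n
        proof -
          have "(\<lambda>t. G ((x + complex_of_real (r / real (Suc n)) *s ?e) + t *s ?j)) holomorphic_on cball 0 r"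
            by (rule holo_on_line[OF off]) (use pin[of _ n] pnz[of n] r(2) in \<open>auto simp: p_def subset_eq simp del: of_nat_Suc\<close>)
          then show ?thesis by (simp add: p_def)
        qed
        obtain "(\<lambda>t. G (x + t *s ?j)) holomorphic_on ball 0 r"
          by (rule holomorphic_uniform_limit[OF _ ul])
             (auto intro!: always_eventually holomorphic_on_imp_continuous_on holn holomorphic_on_subset[OF holn])
        then show ?thesis using r by (auto simp: holomorphic_on_open field_differentiable_def)
      qed
    qed
  qed
  moreover have "\<forall>x\<in>V. F x = x $ i * G x" using F0 by (simp add: G_def)
  ultimately show ?thesis by blast
qed

section \<open>Identity theorems on convex domains\<close>

lemma convex_line:
  "convex A \<Longrightarrow> convex {t::complex. x + t *s (v::complex^'n::finite) \<in> A}"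
proof (rule convexI, unfold mem_Collect_eq)
  fix s t :: complex and a b :: real
  assume *: "convex A" "x + s *s v \<in> A" "x + t *s v \<in> A" "0 \<le> a" "0 \<le> b" "a + b = 1"
  have "a *\<^sub>R (x + s *s v) + b *\<^sub>R (x + t *s v) \<in> A" using * by (simp add: convexD)
  moreover have "a *\<^sub>R (x + s *s v) + b *\<^sub>R (x + t *s v) = (a + b) *\<^sub>R x + (a *\<^sub>R s + b *\<^sub>R t) *s v"
    by (simp add: vec_eq_iff algebra_simps)
  ultimately show "x + (a *\<^sub>R s + b *\<^sub>R t) *s v \<in> A" using * by simp
qed

text \<open>No zero divisors on a convex domain: the complex line through \<open>a\<close> and
  \<open>b\<close> meets \<open>V\<close> in a connected open set, on which \<open>G\<close>
  vanishes near the parameter of \<open>a\<close>, hence at that of \<open>b\<close>.\<close>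

lemma holo_on_mult_eq_0:
  fixes F G :: "complex^'n::finite \<Rightarrow> complex"
  assumes V: "open V" "convex V" and F: "holo_on V F" and G: "holo_on V G"
    and 0: "\<And>x. x \<in> V \<Longrightarrow> F x * G x = 0" and a: "a \<in> V" "F a \<noteq> 0" and b: "b \<in> V"
  shows "G b = 0"
proof -
  define A where "A = {t. a + t *s (b - a) \<in> V}"
  have A: "open A" "connected A" "0 \<in> A" "1 \<in> A"
    using open_line[OF V(1), of a "b - a"] convex_connected[OF convex_line[OF V(2), of a "b - a"]] a b
    by (simp_all add: A_def)
  have "isCont (\<lambda>t. F (a + t *s (b - a))) 0"
    using holo_on_line_deriv[OF F, of a 0 "b - a"] a DERIV_isCont by auto
  then have "\<forall>\<^sub>F t in at 0. F (a + t *s (b - a)) \<noteq> 0"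
    using a(2) by (intro tendsto_imp_eventually_ne[where c="F a"]) (auto simp: isCont_def)
  then obtain d where d: "d > 0" "\<And>t. t \<noteq> 0 \<Longrightarrow> dist t 0 < d \<Longrightarrow> F (a + t *s (b - a)) \<noteq> 0"
    by (auto simp: eventually_at)
  have d': "F (a + t *s (b - a)) \<noteq> 0" if "t \<in> ball 0 d" for t
    using d(2)[of t] that a(2) by (cases "t = 0") auto
  have "(\<lambda>t. G (a + t *s (b - a))) 1 = (\<lambda>t. 0) 1"
  proof (rule analytic_continuation_open[of "A \<inter> ball 0 d" A "\<lambda>t. G (a + t *s (b - a))" "\<lambda>t. 0"])
    show "A \<inter> ball 0 d \<noteq> {}" using A d by force
    show "(\<lambda>t. G (a + t *s (b - a))) holomorphic_on A"
      by (rule holo_on_line[OF G]) (simp add: A_def)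
    fix t assume t: "t \<in> A \<inter> ball 0 d"
    then show "G (a + t *s (b - a)) = 0" using d'[of t] 0[of "a + t *s (b - a)"] by (auto simp: A_def)
  qed (use A in auto)
  then show ?thesis by simp
qed

lemma holo_on_prod_eq_0:
  fixes F :: "'i \<Rightarrow> complex^'n::finite \<Rightarrow> complex"
  assumes "open V" "convex V" "V \<noteq> {}" "finite S" and "\<And>i. i \<in> S \<Longrightarrow> holo_on V (F i)"
    and "\<And>x. x \<in> V \<Longrightarrow> (\<Prod>i\<in>S. F i x) = 0"
  shows "\<exists>i\<in>S. \<forall>x\<in>V. F i x = 0"
  using assms(4-6)
proof (induction S rule: finite_induct)
  case empty
  then show ?case using assms(3) by auto
next
  case (insert i S)
  show ?case
  proof (cases "\<forall>x\<in>V. F i x = 0")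
    case False
    then obtain a where a: "a \<in> V" "F i a \<noteq> 0" by auto
    have "(\<Prod>i\<in>S. F i b) = 0" if "b \<in> V" for b
      using insert by (intro holo_on_mult_eq_0[where V=V and F="F i" and G="\<lambda>x. \<Prod>i\<in>S. F i x" and a=a])
        (simp_all add: holo_on_prod assms(1,2) a that)
    then show ?thesis using insert by blast
  qed auto
qed

text \<open>A real segment accumulates at its end point, which suffices for the identity theorem on
  the complex line. Serves to pass from a small ball to a large one without leaving a
  hyperplane.\<close>

lemma holo_on_eq_0_if_eq_0_near:
  assumes V: "open V" "convex V" and F: "holo_on V F" and r: "r > 0" "a \<in> V"
    and 0: "\<And>t::real. 0 < t \<Longrightarrow> t < r \<Longrightarrow> F (a + complex_of_real t *s (b - a)) = 0" and b: "b \<in> V"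
  shows "F b = 0"
proof -
  define A where "A = {t. a + t *s (b - a) \<in> V}"
  have A: "open A" "connected A" "0 \<in> A" "1 \<in> A"
    using open_line[OF V(1), of a "b - a"] convex_connected[OF convex_line[OF V(2), of a "b - a"]] r b
    by (simp_all add: A_def)
  obtain d where d: "d > 0" "ball 0 d \<subseteq> A" using A open_contains_ball by blast
  define U where "U = complex_of_real ` {0<..<min r d}"
  have "0 islimpt U"
    unfolding islimpt_approachable
  proof (intro allI impI)
    fix e :: real assume "e > 0"
    then have "complex_of_real (min (min r d) e / 2) \<in> U" using r d unfolding U_def
      by (intro imageI) auto
    then show "\<exists>x'\<in>U. x' \<noteq> 0 \<and> dist x' 0 < e"
      using \<open>e > 0\<close> r d by (intro bexI[of _ "complex_of_real (min (min r d) e / 2)"]) (auto simp: norm_divide)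
  qed
  moreover have "U \<subseteq> A" using d by (auto simp: U_def)
  ultimately have "(\<lambda>t. F (a + t *s (b - a))) 1 = 0"
  proof (intro analytic_continuation[of "\<lambda>t. F (a + t *s (b - a))" A U 0 1])
    show "(\<lambda>t. F (a + t *s (b - a))) holomorphic_on A"
      by (rule holo_on_line[OF F]) (simp add: A_def)
    show "F (a + t *s (b - a)) = 0" if "t \<in> U" for t
      using that 0 unfolding U_def by auto
  qed (use A in auto)
  then show ?thesis by simp
qed

text \<open>If \<open>F 0 = 0\<close>, the maximum principle for \<open>1/F\<close> forces every line parallel to the diagonal and
  close to \<open>0\<close> to meet a zero of \<open>F\<close>, that is, a zero lying on one of the hyperplanes. So the product
  over \<open>i \<in> S\<close> of the pull-backs of \<open>F\<close> by the diagonal projections to \<open>x$i = 0\<close> vanishes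
  identically, and so does one of its factors.\<close>
lemma holo_on_vanish_coord:
  fixes F :: "complex^'n::finite \<Rightarrow> complex"
  assumes r: "r > 0" and F: "holo_on (ball 0 r) F" and F0: "F 0 = 0"
    and zeros: "\<And>x. x \<in> ball 0 r \<Longrightarrow> F x = 0 \<Longrightarrow> \<exists>i\<in>S. x $ i = 0"
  shows "\<exists>i\<in>S. \<forall>x\<in>ball 0 r. x $ i = 0 \<longrightarrow> F x = 0"
proof -
  define w :: "complex^'n" where "w = (\<chi> i. 1)"
  have w0: "norm w > 0" by (simp add: w_def vec_eq_iff)
  \<comment> \<open>Makes \<open>norm z = r/2\<close>, so that \<open>a + t *s z\<close> stays in
    the ball for \<open>norm a < r/4\<close> and \<open>cmod t \<le> 1\<close>.\<close>
  define c where "c = r / (2 * norm w)"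
  have c: "c > 0" using r w0 by (simp add: c_def)
  define z where "z = complex_of_real c *s w"
  have zi: "z $ i = complex_of_real c" for i by (simp add: z_def w_def)
  have nz: "norm z = r/2" using c w0 r unfolding z_def norm_smult_vec norm_of_real by (simp add: c_def)
  have inb: "a + t *s z \<in> cball 0 (3*r/4)" if "norm a < r/4" "cmod t \<le> 1" for a t
  proof -
    have "norm (a + t *s z) \<le> norm a + cmod t * norm z"
      using norm_triangle_ineq[of a "t *s z"] by (simp add: norm_smult_vec)
    also have "\<dots> \<le> r/4 + 1 * (r/2)" using that nz r by (intro add_mono mult_mono) auto
    finally show ?thesis by simp
  qed
  have cb: "cball 0 (3*r/4) \<subseteq> ball 0 r" using r by (auto simp: subset_eq)
  have contF: "continuous_on (cball 0 (3*r/4)) F"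
    using holo_on_continuous_on[OF F] cb continuous_on_subset by blast
  have "uniformly_continuous_on (cball 0 (3*r/4)) F"
    by (rule compact_uniformly_continuous[OF contF compact_cball])
  note uc = this[unfolded uniformly_continuous_on_def, rule_format]
  \<comment> \<open>For \<open>cmod t = 1\<close> no coordinate of \<open>t *s z\<close> vanishes,
    so this circle avoids the zeros of \<open>F\<close> and the minimum \<open>m\<close> below is
    positive.\<close>
  have Fz: "F (t *s z) \<noteq> 0" if "cmod t = 1" for t
  proof
    assume "F (t *s z) = 0"
    moreover have "t *s z \<in> ball 0 r" using subsetD[OF cb inb[of 0 t]] that r by simp
    ultimately obtain i where "(t *s z) $ i = 0" using zeros by blast
    then show False using that c by (auto simp: zi)
  qed
  have hl: "(\<lambda>t. F (a + t *s z)) holomorphic_on cball 0 1" if "norm a < r/4" for a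
    by (rule holo_on_line[OF F]) (rule subsetD[OF cb inb[OF that]], simp)
  have "continuous_on (sphere 0 1) (\<lambda>t. cmod (F (0 + t *s z)))"
    using holomorphic_on_imp_continuous_on[OF hl[of 0]] r by (intro continuous_intros) (auto elim: continuous_on_subset)
  from continuous_attains_inf[OF compact_sphere _ this]
  obtain t0 where t0: "cmod t0 = 1" "\<And>t. cmod t = 1 \<Longrightarrow> cmod (F (t0 *s z)) \<le> cmod (F (t *s z))"
    by auto
  define m where "m = cmod (F (t0 *s z))"
  have m: "m > 0" using Fz[OF t0(1)] by (simp add: m_def)
  then have "m/2 > 0" by simp
  from uc[OF this] obtain d where d: "d > 0" "\<And>x x'. x \<in> cball 0 (3*r/4) \<Longrightarrow> x' \<in> cball 0 (3*r/4) \<Longrightarrow> dist x' x < d \<Longrightarrow> dist (F x') (F x) < m/2"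
    by blast
  \<comment> \<open>\<open>d\<close> keeps \<open>F\<close> on a shifted disc within
    \<open>m/2\<close> of its values on the central one, \<open>r/4\<close> keeps the disc in the
    ball, and \<open>c\<close> bounds the parameter \<open>a $ i / c\<close> of the projection by
    1.\<close>
  define p where "p = min (min d c) (r/4)"
  have p: "p > 0" "p \<le> d" "p \<le> c" "p \<le> r/4" using d c r by (auto simp: p_def)
  have ex0: "\<exists>t\<in>cball 0 1. F (a + t *s z) = 0" if a: "norm a < p" for a
  proof (rule ccontr)
    assume n: "\<not> ?thesis"
    have near: "cmod (F (a + t *s z) - F (t *s z)) < m/2" if "cmod t \<le> 1" for t
      using d(2)[of "0 + t *s z" "a + t *s z"] inb[OF _ that, of 0] inb[OF _ that, of a] a p r that
      by (simp add: dist_norm)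
    have h: "(\<lambda>t. inverse (F (a + t *s z))) holomorphic_on cball 0 1"
      using n a p by (intro holomorphic_intros hl) auto
    have "cmod (inverse (F (a + 0 *s z))) \<le> inverse (m/2)"
    proof (rule maximum_modulus_frontier[where S="cball 0 1" and f="\<lambda>t. inverse (F (a + t *s z))"])
      show "(\<lambda>t. inverse (F (a + t *s z))) holomorphic_on interior (cball 0 1)"
        using h holomorphic_on_subset interior_subset by blast
      show "continuous_on (closure (cball 0 1)) (\<lambda>t. inverse (F (a + t *s z)))" using h holomorphic_on_imp_continuous_on by simp
      fix t :: complex assume "t \<in> frontier (cball 0 1)"
      then have t: "cmod t = 1" by (simp add: sphere_def)
      have "m \<le> cmod (F (t *s z))" using t0(2)[OF t] by (simp add: m_def)
      also have "\<dots> \<le> cmod (F (a + t *s z)) + cmod (F (a + t *s z) - F (t *s z))" by norm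
      also have "\<dots> \<le> cmod (F (a + t *s z)) + m/2" using near[of t] t by simp
      finally have "m/2 \<le> cmod (F (a + t *s z))" by simp
      then show "cmod (inverse (F (a + t *s z))) \<le> inverse (m/2)"
        using m unfolding norm_inverse by (intro le_imp_inverse_le) auto
    qed auto
    moreover have "cmod (F a) < m/2" using near[of 0] F0 by simp
    moreover have "F (a + 0 *s z) \<noteq> 0" using n by (metis centre_in_cball zero_le_one)
    ultimately show False using m by (simp add: norm_divide field_simps)
  qed
  define P where "P i a = F (a - (a $ i / complex_of_real c) *s z)" for i a
  have proj: "holo_map_on (ball 0 p) (\<lambda>a. a - (a $ i / complex_of_real c) *s z)" for i
  proof -
    have "holo_on (ball 0 p) (\<lambda>a. a $ j + (-1) * (a $ i * inverse (complex_of_real c) * z $ j))" for j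
      by (intro holo_on_add holo_on_mult holo_on_nth holo_on_const)
    then show ?thesis by (simp add: holo_map_on_def divide_inverse)
  qed
  have projin: "(\<lambda>a. a - (a $ i / complex_of_real c) *s z) ` ball 0 p \<subseteq> ball 0 r" for i
  proof clarify
    fix a :: "complex^'n" assume a: "a \<in> ball 0 p"
    have "cmod (a $ i) \<le> c" using Finite_Cartesian_Product.norm_nth_le[of a i] a p by simp
    then have "cmod (- (a $ i / complex_of_real c)) \<le> 1" using c by (simp add: norm_divide)
    from inb[OF _ this, of a] have "a + (- (a $ i / complex_of_real c)) *s z \<in> cball 0 (3*r/4)" using a p by simp
    also have "a + (- (a $ i / complex_of_real c)) *s z = a - (a $ i / complex_of_real c) *s z"
      by (simp add: vec_eq_iff)
    finally show "a - (a $ i / complex_of_real c) *s z \<in> ball 0 r" using cb by blast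
  qed
  have hP: "holo_on (ball 0 p) (P i)" for i
    using holo_on_compose[OF proj F projin, of i] by (simp add: P_def[abs_def])
  have "\<exists>i\<in>S. \<forall>a\<in>ball 0 p. P i a = 0"
  proof (rule holo_on_prod_eq_0)
    fix a :: "complex^'n" assume a: "a \<in> ball 0 p"
    obtain t where t: "cmod t \<le> 1" "F (a + t *s z) = 0" using ex0[of a] a by auto
    then obtain i where i: "i \<in> S" "(a + t *s z) $ i = 0" using zeros inb[of a t] a p cb by force
    then have "t = - (a $ i / complex_of_real c)" using c by (auto simp: zi field_simps eq_neg_iff_add_eq_0)
    then have "P i a = 0" using t(2) by (simp add: P_def)
    then show "(\<Prod>i\<in>S. P i a) = 0" using i by auto
  qed (use p hP in auto)
  then obtain i where i: "i \<in> S" "\<And>a. a \<in> ball 0 p \<Longrightarrow> P i a = 0" by auto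
  \<comment> \<open>A point of the hyperplane is its own projection; so \<open>P i = 0\<close> gives
    \<open>F = 0\<close> on its small multiples, and the identity theorem on the segment does the
    rest.\<close>
  have "F x = 0" if x: "x \<in> ball 0 r" "x $ i = 0" for x
  proof (rule holo_on_eq_0_if_eq_0_near[OF _ _ F, of "p / (norm x + 1)" 0])
    fix t :: real assume t: "0 < t" "t < p / (norm x + 1)"
    have "t * norm x \<le> t * (norm x + 1)" using t by simp
    also have "\<dots> < p" using t by (simp add: pos_less_divide_eq add_nonneg_pos)
    finally have "complex_of_real t *s x \<in> ball 0 p" using t by (simp add: norm_smult_vec)
    from i(2)[OF this] show "F (0 + complex_of_real t *s (x - 0)) = 0" using x by (simp add: P_def)
  next
    show "0 < p / (norm x + 1)" using p by (intro divide_pos_pos add_nonneg_pos) auto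
  qed (use x r in auto)
  then show ?thesis using i by blast
qed

lemma holo_on_nonzero_ball:
  assumes "r > 0" "holo_on (ball 0 r) F" "F 0 \<noteq> 0"
  shows "\<exists>s. 0 < s \<and> s \<le> r \<and> (\<forall>x\<in>ball 0 s. F x \<noteq> 0)"
proof -
  have "isCont F 0" using assms by (intro holo_on_isCont) auto
  then obtain d where d: "d > 0" "\<And>x. dist x 0 < d \<Longrightarrow> dist (F x) (F 0) < cmod (F 0)"
    unfolding continuous_at_eps_delta using assms(3) by (meson zero_less_norm_iff)
  have "F x \<noteq> 0" if "x \<in> ball 0 (min d r)" for x
    using d(2)[of x] that by (auto simp: dist_norm norm_minus_commute)
  then show ?thesis using d assms by (intro exI[of _ "min d r"]) auto
qed

text \<open>Induction on a bound \<open>N\<close> for the order of vanishing along the diagonal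
  \<open>t *s z\<close>: dividing by a coordinate, which equals \<open>t * c\<close> there, lowers
  it by one, and the quotient still vanishes only on the hyperplanes. For \<open>N = 0\<close> the
  lower bound is incompatible with \<open>F 0 = 0\<close>.\<close>

lemma holo_on_monomial_aux:
  fixes F :: "complex^'n::finite \<Rightarrow> complex" and z :: "complex^'n"
  assumes r: "r > 0" and c: "c > 0" and zi: "\<And>i. z $ i = complex_of_real c"
    and d: "d > 0" "d * norm z \<le> r"
  shows "holo_on (ball 0 r) F \<Longrightarrow> (\<And>x. x \<in> ball 0 r \<Longrightarrow> F x = 0 \<Longrightarrow> \<exists>i\<in>S. x $ i = 0) \<Longrightarrow>
    k > 0 \<Longrightarrow> (\<And>t::real. 0 < t \<Longrightarrow> t < d \<Longrightarrow> k * t ^ N \<le> cmod (F (complex_of_real t *s z))) \<Longrightarrow>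
    \<exists>a v s. 0 < s \<and> s \<le> r \<and> holo_on (ball 0 s) v \<and> (\<forall>x\<in>ball 0 s. v x \<noteq> 0 \<and> F x = v x * (\<Prod>i\<in>S. x $ i ^ a i))"
proof (induction N arbitrary: F k)
  case 0
  have "F 0 \<noteq> 0"
  proof
    assume F0: "F 0 = 0"
    have "isCont F 0" by (rule holo_on_isCont[OF 0(1)]) (use r in auto)
    then obtain e where e: "e > 0" "\<And>x. dist x 0 < e \<Longrightarrow> dist (F x) (F 0) < k"
      unfolding continuous_at_eps_delta using 0(3) by meson
    define t where "t = min d (e / (norm z + 1)) / 2"
    have t: "0 < t" "t < d" "t < e / (norm z + 1)"
    proof -
      have "e / (norm z + 1) > 0" using e by (intro divide_pos_pos add_nonneg_pos) auto
      moreover have "0 < min d b / 2 \<and> min d b / 2 < d \<and> min d b / 2 < b" if "b > 0" for b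
        using that d by (auto simp: min_def)
      ultimately show "0 < t" "t < d" "t < e / (norm z + 1)" unfolding t_def by blast+
    qed
    have "t * norm z \<le> t * (norm z + 1)" using t by simp
    also have "\<dots> < e" using t by (simp add: pos_less_divide_eq add_nonneg_pos)
    finally have "cmod (F (complex_of_real t *s z)) < k"
      using e(2)[of "complex_of_real t *s z"] F0 t by (simp add: norm_smult_vec)
    with 0(4)[OF t(1,2)] show False by simp
  qed
  from holo_on_nonzero_ball[OF r 0(1) this] obtain s where "0 < s" "s \<le> r" "\<forall>x\<in>ball 0 s. F x \<noteq> 0" by auto
  then show ?case using 0(1) by (intro exI[of _ "\<lambda>i. 0"] exI[of _ F] exI[of _ s]) (auto intro: holo_on_subset)
next
  case (Suc N)
  show ?case
  proof (cases "F 0 = 0")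
    case False
    from holo_on_nonzero_ball[OF r Suc.prems(1) this] obtain s where "0 < s" "s \<le> r" "\<forall>x\<in>ball 0 s. F x \<noteq> 0" by auto
    then show ?thesis using Suc.prems(1) by (intro exI[of _ "\<lambda>i. 0"] exI[of _ F] exI[of _ s]) (auto intro: holo_on_subset)
  next
    case True
    from holo_on_vanish_coord[OF r Suc.prems(1) True Suc.prems(2)]
    obtain i where i: "i \<in> S" "\<And>x. x \<in> ball 0 r \<Longrightarrow> x $ i = 0 \<Longrightarrow> F x = 0" by blast
    from holo_on_divide_coord[OF open_ball Suc.prems(1) i(2)]
    obtain G where G: "holo_on (ball 0 r) G" "\<And>x. x \<in> ball 0 r \<Longrightarrow> F x = x $ i * G x" by blast
    have "\<exists>a v s. 0 < s \<and> s \<le> r \<and> holo_on (ball 0 s) v \<and> (\<forall>x\<in>ball 0 s. v x \<noteq> 0 \<and> G x = v x * (\<Prod>i\<in>S. x $ i ^ a i))"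
    proof (rule Suc.IH[OF G(1)])
      show "\<exists>i\<in>S. x $ i = 0" if "x \<in> ball 0 r" "G x = 0" for x
        using Suc.prems(2)[of x] G(2)[of x] that by simp
      show "k / c > 0" using Suc.prems c by simp
      fix t :: real assume t: "0 < t" "t < d"
      have "t * norm z \<le> d * norm z" using t by (intro mult_right_mono) auto
      moreover have "norm z > 0" using zi[of undefined] c by auto
      ultimately have "t * norm z < r"
        using mult_strict_right_mono[OF t(2), of "norm z"] d by linarith
      then have "complex_of_real t *s z \<in> ball 0 r"
        using t by (simp add: norm_smult_vec)
      from G(2)[OF this] have "cmod (F (complex_of_real t *s z)) = t * c * cmod (G (complex_of_real t *s z))"
        using t c by (simp add: zi norm_mult)
      with Suc.prems(4)[OF t] have "t * (k * t ^ N) \<le> t * (c * cmod (G (complex_of_real t *s z)))"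
        by (simp add: mult_ac)
      then show "k / c * t ^ N \<le> cmod (G (complex_of_real t *s z))"
        using t c by (simp add: field_simps)
    qed
    then obtain a v s where s: "0 < s" "s \<le> r" "holo_on (ball 0 s) v"
      "\<And>x. x \<in> ball 0 s \<Longrightarrow> v x \<noteq> 0 \<and> G x = v x * (\<Prod>i\<in>S. x $ i ^ a i)" by blast
    have "F x = v x * (\<Prod>j\<in>S. x $ j ^ (if j = i then Suc (a j) else a j))" if "x \<in> ball 0 s" for x
    proof -
      have "(\<Prod>j\<in>S. x $ j ^ (if j = i then Suc (a j) else a j)) = (\<Prod>j\<in>S. (if j = i then x $ j else 1) * x $ j ^ a j)"
        by (rule prod.cong) auto
      also have "\<dots> = x $ i * (\<Prod>i\<in>S. x $ i ^ a i)" using i(1) by (simp add: prod.distrib)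
      finally show ?thesis using G(2)[of x] s(2) s(4)[OF that] that by simp
    qed
    then show ?thesis using s
      by (intro exI[of _ "\<lambda>j. if j = i then Suc (a j) else a j"] exI[of _ v] exI[of _ s]) auto
  qed
qed

text \<open>The diagonal meets the hyperplanes only at 0, so \<open>F\<close> is not constant on it
  if \<open>F 0 = 0\<close>, and the one-variable lower bound for non-constant holomorphic functions
  supplies the order that the induction needs.\<close>

lemma holo_on_monomial:
  fixes F :: "complex^'n::finite \<Rightarrow> complex"
  assumes r: "r > 0" and F: "holo_on (ball 0 r) F"
    and zeros: "\<And>x. x \<in> ball 0 r \<Longrightarrow> F x = 0 \<Longrightarrow> \<exists>i\<in>S. x $ i = 0"
  shows "\<exists>a v s. 0 < s \<and> s \<le> r \<and> holo_on (ball 0 s) v \<and> (\<forall>x\<in>ball 0 s. v x \<noteq> 0 \<and> F x = v x * (\<Prod>i\<in>S. x $ i ^ a i))"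
proof (cases "F 0 = 0")
  case False
  from holo_on_nonzero_ball[OF r F this] obtain s where "0 < s" "s \<le> r" "\<forall>x\<in>ball 0 s. F x \<noteq> 0" by auto
  then show ?thesis using F by (intro exI[of _ "\<lambda>i. 0"] exI[of _ F] exI[of _ s]) (auto intro: holo_on_subset)
next
  case True
  define z :: "complex^'n" where "z = (\<chi> i. complex_of_real 1)"
  have nz: "norm z > 0" by (simp add: z_def vec_eq_iff)
  define e where "e = r / norm z"
  have e: "e > 0" using r nz by (simp add: e_def)
  have inb: "0 + t *s z \<in> ball 0 r" if "t \<in> ball 0 e" for t
    using that nz by (simp add: norm_smult_vec e_def pos_less_divide_eq)
  have h: "(\<lambda>t. F (0 + t *s z)) holomorphic_on ball 0 e"
    by (rule holo_on_line[OF F]) (use inb in auto)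
  have ne: "F (0 + complex_of_real (e/2) *s z) \<noteq> F (0 + 0 *s z)"
  proof
    assume "F (0 + complex_of_real (e/2) *s z) = F (0 + 0 *s z)"
    then show False using zeros[OF inb[of "complex_of_real (e/2)"]] e True by (auto simp: z_def)
  qed
  have "\<exists>k N d. 0 < k \<and> 0 < d \<and> ball 0 d \<subseteq> ball (0::complex) e \<and>
    (\<forall>t\<in>ball 0 d. k * norm (t - 0) ^ N \<le> norm (F (0 + t *s z) - F (0 + 0 *s z)))"
  proof (rule holomorphic_lower_bound_difference[OF h open_ball connected_ball _ _ ne])
    fix k N d
    assume "0 < k" "0 < d" "ball 0 d \<subseteq> ball (0::complex) e"
      and "\<And>t. t \<in> ball 0 d \<Longrightarrow> k * norm (t - 0) ^ N \<le> norm (F (0 + t *s z) - F (0 + 0 *s z))"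
    then show ?thesis by (intro exI[of _ k] exI[of _ N] exI[of _ d]) auto
  qed (use e in auto)
  then obtain k :: real and N :: nat and d :: real where d: "0 < k" "0 < d" "ball 0 d \<subseteq> ball (0::complex) e"
    "\<forall>t\<in>ball 0 d. k * norm (t - 0) ^ N \<le> norm (F (0 + t *s z) - F (0 + 0 *s z))"
    by blast
  have "d \<le> e" using d(2,3) by (simp add: ball_subset_ball_iff)
  then have "d * norm z \<le> r" using nz by (simp add: e_def pos_le_divide_eq)
  then show ?thesis
  proof (rule holo_on_monomial_aux[OF r zero_less_one _ d(2) _ F zeros d(1), rotated])
    fix t :: real assume "0 < t" "t < d"
    then show "k * t ^ N \<le> cmod (F (complex_of_real t *s z))" using bspec[OF d(4), of "complex_of_real t"] True by simp
  qed (auto simp: z_def)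
qed

section \<open>Holomorphic inverse function theorem\<close>

lemma bounded_linear_matrix: "bounded_linear (\<lambda>v. (A::complex^'n::finite^'m::finite) *v v)"
  by (rule linear_conv_bounded_linear[THEN iffD1])
     (auto simp: linear_iff matrix_vector_right_distrib vec_eq_iff matrix_vector_mult_def sum_distrib_left
          sum.distrib scaleR_sum_right algebra_simps)

text \<open>The real inverse function theorem applies because holomorphic maps are continuously
  differentiable; the inverse is holomorphic because the inverse of a complex-linear bijection is
  complex linear.\<close>

lemma holo_inverse_function:
  fixes \<Phi> :: "complex^'n::finite \<Rightarrow> complex^'n"
  assumes U: "open U" "a \<in> U" and \<Phi>: "holo_map_on U \<Phi>" and det: "det (jac \<Phi> a) \<noteq> 0"
  shows "\<exists>U' W \<Psi>. open U' \<and> U' \<subseteq> U \<and> a \<in> U' \<and> open W \<and> \<Phi> a \<in> W \<and> homeomorphism U' W \<Phi> \<Psi> \<and> holo_map_on W \<Psi>"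
proof -
  define f' where "f' x = Blinfun (\<lambda>v. jac \<Phi> x *v v)" for x
  have f': "blinfun_apply (f' x) = (\<lambda>v. jac \<Phi> x *v v)" for x
    by (simp add: f'_def bounded_linear_Blinfun_apply[OF bounded_linear_matrix])
  have der: "(\<Phi> has_derivative blinfun_apply (f' x)) (at x)" if "x \<in> U" for x
    unfolding f' by (rule holo_map_on_jac[OF \<Phi> that])
  have "continuous_on U (\<lambda>x. blinfun_apply (f' x) b)" for b
  proof -
    have "continuous_on U (\<lambda>x. \<Sum>j\<in>UNIV. grad (\<lambda>y. \<Phi> y $ i) x $ j * b $ j)" for i
      by (intro continuous_intros continuous_on_grad U) (use \<Phi> in \<open>simp add: holo_map_on_def\<close>)
    then have "continuous_on U (\<lambda>x. (jac \<Phi> x *v b) $ i)" for i unfolding jac_mult clin_def .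
    from continuous_on_vec_lambda[of U "\<lambda>i x. (jac \<Phi> x *v b) $ i", OF this]
    show ?thesis by (simp add: f' vec_lambda_eta)
  qed
  then have cont: "continuous_on U f'" by (intro continuous_on_blinfun_componentwise)
  obtain A where A: "A ** jac \<Phi> a = mat 1" using det
    by (metis invertible_det_nz invertible_left_inverse)
  have inv: "Blinfun (\<lambda>v. A *v v) o\<^sub>L f' a = id_blinfun"
    by (rule blinfun_eqI) (simp add: f' bounded_linear_Blinfun_apply[OF bounded_linear_matrix] matrix_vector_mul_assoc A)
  obtain U' W \<Psi> g' where *: "open U'" "U' \<subseteq> U" "a \<in> U'" "open W" "\<Phi> a \<in> W" "homeomorphism U' W \<Phi> \<Psi>"
    "\<And>y. y \<in> W \<Longrightarrow> (\<Psi> has_derivative (g' y)) (at y)"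
    "\<And>y. y \<in> W \<Longrightarrow> g' y = inv (blinfun_apply (f'(\<Psi> y)))"
    "\<And>y. y \<in> W \<Longrightarrow> bij (blinfun_apply (f'(\<Psi> y)))"
    using inverse_function_theorem[OF U(1) der cont U(2) inv] by metis
  have "holo_on W (\<lambda>y. \<Psi> y $ i)" for i
    unfolding holo_on_def
  proof (intro ballI exI[of _ "\<lambda>v. g' _ v $ i"] conjI allI)
    fix y assume y: "y \<in> W"
    show "((\<lambda>y. \<Psi> y $ i) has_derivative (\<lambda>v. g' y v $ i)) (at y)"
      by (rule bounded_linear.has_derivative[OF bounded_linear_vec_nth *(7)[OF y]])
    fix c v
    let ?M = "jac \<Phi> (\<Psi> y)"
    have b: "bij (\<lambda>v. ?M *v v)" and g: "g' y = inv (\<lambda>v. ?M *v v)" using *(8,9)[OF y] by (auto simp: f')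
    have "g' y (c *s v) = c *s g' y v"
      unfolding g using b
      by (metis (no_types, lifting) bij_inv_eq_iff vector_scalar_commute)
    then show "g' y (c *s v) $ i = c * g' y v $ i" by simp
  qed
  then show ?thesis using *(1-6) by (intro exI[of _ U'] exI[of _ W] exI[of _ \<Psi>]) (simp add: holo_map_on_def)
qed

section \<open>Contracting germs\<close>

lemma tendsto_0_perturbed_recurrence:
  fixes x :: "nat \<Rightarrow> complex^'n::finite"
  assumes a: "cmod a < 1" and e: "(\<lambda>n. x (Suc n) - a *s x n) \<longlonglongrightarrow> 0"
  shows "x \<longlonglongrightarrow> 0"
proof (rule LIMSEQ_I)
  fix \<epsilon> :: real assume \<epsilon>: "\<epsilon> > 0"
  \<comment> \<open>Makes \<open>\<epsilon> / 2\<close> the fixed point of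
    \<open>s \<mapsto> d + cmod a * s\<close>, the recursion that bounds the norms from index
    \<open>N\<close> on.\<close>
  define d where "d = \<epsilon> / 2 * (1 - cmod a)"
  have "d > 0" using a \<epsilon> by (simp add: d_def)
  then obtain N where N: "\<And>n. n \<ge> N \<Longrightarrow> norm (x (Suc n) - a *s x n) < d"
    using e by (auto simp: LIMSEQ_iff)
  have bd: "norm (x (N + k)) \<le> cmod a ^ k * norm (x N) + \<epsilon> / 2" for k
  proof (induction k)
    case 0
    then show ?case using \<epsilon> by simp
  next
    case (Suc k)
    have "norm (x (Suc (N + k))) \<le> norm (x (Suc (N + k)) - a *s x (N + k)) + norm (a *s x (N + k))"
      by (metis diff_add_cancel norm_triangle_ineq)
    also have "\<dots> \<le> d + cmod a * (cmod a ^ k * norm (x N) + \<epsilon> / 2)"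
      using N[of "N + k"] Suc.IH by (intro add_mono) (auto simp: norm_smult_vec intro: mult_left_mono)
    also have "\<dots> = cmod a ^ Suc k * norm (x N) + \<epsilon> / 2"
      by (simp add: d_def field_simps)
    finally show ?case by simp
  qed
  have "(\<lambda>k. cmod a ^ k * norm (x N)) \<longlonglongrightarrow> 0 * norm (x N)"
    by (intro tendsto_mult LIMSEQ_power_zero tendsto_const) (use a in auto)
  then have "\<forall>\<^sub>F k in sequentially. cmod a ^ k * norm (x N) < \<epsilon> / 2"
    by (rule order_tendstoD) (use \<epsilon> in simp)
  then obtain M where M: "\<And>k. k \<ge> M \<Longrightarrow> cmod a ^ k * norm (x N) < \<epsilon> / 2"
    by (auto simp: eventually_sequentially)
  show "\<exists>no. \<forall>n\<ge>no. norm (x n - 0) < \<epsilon>"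
  proof (intro exI[of _ "N + M"] allI impI)
    fix n assume "n \<ge> N + M"
    then have "M \<le> n - N" "N + (n - N) = n" by auto
    then show "norm (x n - 0) < \<epsilon>" using bd[of "n - N"] M[of "n - N"] by simp
  qed
qed

section \<open>Orbits of a linear map with eigenvalues in the unit disc\<close>

definition poly_app :: "complex^'n^'n \<Rightarrow> complex poly \<Rightarrow> complex^'n::finite \<Rightarrow> complex^'n" where
  "poly_app J p v = (\<Sum>i\<le>degree p. coeff p i *s (((*v) J) ^^ i) v)"

lemma poly_app_bound:
  "degree p < N \<Longrightarrow> poly_app J p v = (\<Sum>i<N. coeff p i *s (((*v) J) ^^ i) v)"
  unfolding poly_app_def by (rule sum.mono_neutral_left) (auto simp: coeff_eq_0)

lemma poly_app_add: "poly_app J (p + q) v = poly_app J p v + poly_app J q v"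
proof -
  define N where "N = Suc (max (degree p) (degree q))"
  have "degree p < N" "degree q < N" "degree (p + q) < N"
    using degree_add_le_max[of p q] by (auto simp: N_def)
  then show ?thesis by (simp add: poly_app_bound sum.distrib vector_sadd_rdistrib)
qed

lemma poly_app_smult: "poly_app J (smult c p) v = c *s poly_app J p v"
proof -
  have "degree (smult c p) < Suc (degree p)" by (simp add: degree_smult_le less_Suc_eq_le)
  then show ?thesis by (simp add: poly_app_bound[of _ "Suc (degree p)"] sum_cmul vector_smult_assoc vec_eq_iff sum_distrib_left mult.assoc)
qed

lemma poly_app_pCons_0: "poly_app J (pCons 0 p) v = poly_app J p (J *v v)"
proof -
  have "degree (pCons 0 p) < Suc (Suc (degree p))" using degree_pCons_le[of 0 p] by simp
  then have "poly_app J (pCons 0 p) v = (\<Sum>i<Suc (Suc (degree p)). coeff (pCons 0 p) i *s (((*v) J) ^^ i) v)"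
    by (rule poly_app_bound)
  also have "\<dots> = (\<Sum>i<Suc (degree p). coeff p i *s (((*v) J) ^^ i) (J *v v))"
    by (subst sum.lessThan_Suc_shift) (simp add: funpow_swap1 del: sum.lessThan_Suc)
  also have "\<dots> = poly_app J p (J *v v)"
    by (rule poly_app_bound[symmetric]) simp
  finally show ?thesis .
qed

lemma matrix_pow_linear:
  "(((*v) (J::complex^'n::finite^'n)) ^^ i) (x + y) = (((*v) J) ^^ i) x + (((*v) J) ^^ i) y"
  "(((*v) J) ^^ i) (c *s x) = c *s (((*v) J) ^^ i) x"
  by (induction i) (auto simp: matrix_vector_right_distrib vector_scalar_commute)

lemma matrix_pow_diff:
  "(((*v) (J::complex^'n::finite^'n)) ^^ i) (x - y) = (((*v) J) ^^ i) x - (((*v) J) ^^ i) y"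
  by (induction i) (auto simp: matrix_vector_mult_diff_distrib)

lemma matrix_pow_0: "(((*v) (J::complex^'n::finite^'n)) ^^ i) 0 = 0"
  by (induction i) auto

lemma poly_app_linear:
  "poly_app J p (v - c *s w) = poly_app J p v - c *s poly_app J p w"
proof -
  have "(((*v) J) ^^ i) (v - c *s w) = (((*v) J) ^^ i) v - c *s (((*v) J) ^^ i) w" for i
    by (simp add: matrix_pow_linear(2) matrix_pow_diff)
  then show ?thesis
    by (simp add: poly_app_def) (simp add: vec_eq_iff right_diff_distrib sum_subtractf sum_distrib_left mult_ac)
qed

text \<open>Moves a linear factor of the polynomial onto the vector, so that a root can be split off
  while the matrix stays fixed and only \<open>v\<close> changes.\<close>

lemma poly_app_linear_factor:
  "poly_app J ([:-a, 1:] * q) v = poly_app J q (J *v v - a *s v)"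
proof -
  have "[:-a, 1:] * q = smult (-a) q + pCons 0 q" by simp
  then show ?thesis
    by (simp only: poly_app_add poly_app_smult poly_app_pCons_0 poly_app_linear) simp
qed

text \<open>Linear factors \<open>J - a\<close> of the annihilating polynomial are removed one at a time: for \<open>cmod a \<ge> 1\<close> they are
  invertible, and for \<open>cmod a < 1\<close> the orbit of \<open>v\<close> satisfies a contracting recurrence up to the orbit of \<open>(J - a) v\<close>.\<close>
lemma poly_app_eq_0_tendsto:
  fixes J :: "complex^'n::finite^'n"
  assumes ev: "\<And>c v. v \<noteq> 0 \<Longrightarrow> J *v v = c *s v \<Longrightarrow> cmod c < 1"
  shows "p \<noteq> 0 \<Longrightarrow> poly_app J p v = 0 \<Longrightarrow> (\<lambda>n. (((*v) J) ^^ n) v) \<longlonglongrightarrow> 0"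
proof (induction "degree p" arbitrary: p v)
  case 0
  then obtain c where "p = [:c:]" using degree_eq_zeroE by metis
  then have "v = 0" using 0 by (auto simp: poly_app_def)
  then show ?case by (simp add: matrix_pow_0)
next
  case (Suc d)
  have "\<not> constant (poly p)" using Suc.hyps(2) constant_degree[of p] by simp
  then obtain a where "poly p a = 0" using fundamental_theorem_of_algebra by blast
  then obtain q where q: "p = [:-a, 1:] * q" by (auto simp: poly_eq_0_iff_dvd)
  have q0: "q \<noteq> 0" using Suc.prems q by auto
  then have "degree p = Suc (degree q)" unfolding q by (subst degree_mult_eq) auto
  with Suc.hyps have dq: "d = degree q" by simp
  define x where "x n = (((*v) J) ^^ n) v" for n
  have eq: "(((*v) J) ^^ n) (J *v v - a *s v) = x (Suc n) - a *s x n" for n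
    by (simp add: matrix_pow_linear(2) matrix_pow_diff x_def funpow_swap1)
  have lim: "(\<lambda>n. x (Suc n) - a *s x n) \<longlonglongrightarrow> 0"
    using Suc.hyps(1)[OF dq q0, of "J *v v - a *s v"] Suc.prems(2) unfolding eq q poly_app_linear_factor by simp
  show ?case unfolding x_def[symmetric]
  proof (cases "cmod a < 1")
    case True
    then show "x \<longlonglongrightarrow> 0" using lim by (rule tendsto_0_perturbed_recurrence)
  next
    case False
    define M where "M = J - mat a"
    have M: "M *v w = J *v w - a *s w" for w
      by (simp add: M_def vec_eq_iff matrix_vector_mult_def mat_def left_diff_distrib sum_subtractf
          if_distrib[of "\<lambda>x. x * _"] cong: if_cong)
    have "\<forall>w. M *v w = 0 \<longrightarrow> w = 0" using ev[of _ a] False by (auto simp: M)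
    then obtain K where "K ** M = mat 1" using matrix_left_invertible_ker[of M] by blast
    then have K: "K *v (M *v w) = w" for w by (simp add: matrix_vector_mul_assoc)
    have "(\<lambda>n. K *v (x (Suc n) - a *s x n)) \<longlonglongrightarrow> K *v 0"
      using bounded_linear.tendsto[OF bounded_linear_matrix lim] by simp
    moreover have "K *v (x (Suc n) - a *s x n) = x n" for n
      using K[of "x n"] by (simp add: M x_def)
    ultimately show "x \<longlonglongrightarrow> 0" by simp
  qed
qed

text \<open>\<open>CARD('n) + 1\<close> vectors of the orbit of \<open>v\<close> cannot be
  independent, and the coefficients of a relation form the polynomial.\<close>

lemma ex_poly_app_eq_0:
  fixes J :: "complex^'n::finite^'n"
  shows "\<exists>p. p \<noteq> 0 \<and> poly_app J p v = 0"
proof -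
  define N where "N = CARD('n)"
  define x where "x n = (((*v) J) ^^ n) v" for n
  have ex: "\<exists>c. (\<exists>i\<le>N. c i \<noteq> 0) \<and> (\<Sum>i\<le>N. c i *s x i) = 0"
  proof (cases "inj_on x {..N}")
    case True
    have "vec.dependent (x ` {..N})"
    proof (rule vec.dependent_biggerset_general)
      have "vec.dim (x ` {..N}) \<le> CARD('n)" by (rule dim_subset_UNIV_cart_gen)
      then show "vec.dim (x ` {..N}) < card (x ` {..N})" using True by (simp add: card_image N_def)
    qed
    then obtain u where u: "\<exists>w\<in>x ` {..N}. u w \<noteq> 0" "(\<Sum>w\<in>x ` {..N}. u w *s w) = 0"
      by (subst (asm) vec.dependent_finite) auto
    have "(\<Sum>i\<le>N. u (x i) *s x i) = 0" using u(2) by (simp add: sum.reindex[OF True])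
    then show ?thesis using u(1) by (intro exI[of _ "\<lambda>i. u (x i)"]) auto
  next
    case False
    \<comment> \<open>Coinciding iterates make the set too small for the dimension count, but give a
      relation with coefficients 1 and -1.\<close>
    then obtain i j where ij: "i \<le> N" "j \<le> N" "i \<noteq> j" "x i = x j" by (auto simp: inj_on_def)
    define c :: "nat \<Rightarrow> complex" where "c k = (if k = i then 1 else if k = j then -1 else 0)" for k
    have "(\<Sum>k\<le>N. c k *s x k) = (\<Sum>k\<in>{i, j}. c k *s x k)"
      by (rule sum.mono_neutral_right) (use ij in \<open>auto simp: c_def\<close>)
    also have "\<dots> = 0" using ij by (simp add: c_def)
    finally show ?thesis using ij by (intro exI[of _ c]) (auto simp: c_def)
  qed
  then obtain c where c: "\<exists>i\<le>N. c i \<noteq> 0" "(\<Sum>i\<le>N. c i *s x i) = 0" by blast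
  define p where "p = (\<Sum>i\<le>N. monom (c i) i)"
  have cf: "coeff p i = (if i \<le> N then c i else 0)" for i
    by (simp add: p_def coeff_sum)
  have "p \<noteq> 0" using c(1) cf by (metis coeff_0)
  moreover have "degree p < Suc N" using degree_le[of N p] cf by (simp add: less_Suc_eq_le)
  then have "poly_app J p v = 0"
    using c(2) by (simp only: poly_app_bound) (simp add: cf x_def lessThan_Suc_atMost)
  ultimately show ?thesis by blast
qed

lemma matrix_pow_tendsto_0:
  fixes J :: "complex^'n::finite^'n"
  assumes ev: "\<And>c v. v \<noteq> 0 \<Longrightarrow> J *v v = c *s v \<Longrightarrow> cmod c < 1"
  shows "(\<lambda>n. (((*v) J) ^^ n) v) \<longlonglongrightarrow> 0"
proof -
  obtain p where "p \<noteq> 0" "poly_app J p v = 0" using ex_poly_app_eq_0 by blast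
  then show ?thesis by (rule poly_app_eq_0_tendsto[rotated]) (rule ev)
qed

text \<open>Eigenvalues of modulus below 1 make the powers of \<open>J\<close> tend to 0 but do not
  prevent \<open>J\<close> from increasing the Euclidean norm at first. Adding up the norms of the
  first \<open>N\<close> iterates gives a norm that shrinks at every step.\<close>

lemma ex_adapted_norm:
  fixes J :: "complex^'n::finite^'n"
  assumes ev: "\<And>c v. v \<noteq> 0 \<Longrightarrow> J *v v = c *s v \<Longrightarrow> cmod c < 1"
  shows "\<exists>(\<nu> :: complex^'n \<Rightarrow> real) K \<rho>. 1 \<le> K \<and> 0 < \<rho> \<and> \<rho> < 1 \<and> (\<forall>x. norm x \<le> \<nu> x \<and> \<nu> x \<le> K * norm x \<and> \<nu> (J *v x) \<le> \<rho> * \<nu> x)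
     \<and> (\<forall>x y. \<nu> (x + y) \<le> \<nu> x + \<nu> y)"
proof -
  define P where "P n v = (((*v) J) ^^ n) v" for n and v :: "complex^'n"
  have P_lin: "P n (x + y) = P n x + P n y" "P n (c *s x) = c *s P n x" for n x y c
    by (simp_all add: P_def matrix_pow_linear)
  have P_sum: "P n (\<Sum>i\<in>A. g i) = (\<Sum>i\<in>A. P n (g i))" for n and A :: "'n set" and g
    by (induction A rule: infinite_finite_induct) (auto simp: P_lin, auto simp: P_def matrix_pow_0)
  have P_bd: "norm (P n v) \<le> (\<Sum>i\<in>UNIV. norm (P n (axis i 1))) * norm v" for n v
  proof -
    have "P n v = (\<Sum>i\<in>UNIV. v $ i *s P n (axis i 1))"
      by (subst vec_axis_sum[of v]) (simp only: P_sum P_lin)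
    also have "norm \<dots> \<le> (\<Sum>i\<in>UNIV. norm v * norm (P n (axis i 1)))"
      by (rule sum_norm_le) (simp add: norm_smult_vec mult_right_mono Finite_Cartesian_Product.norm_nth_le)
    finally show ?thesis by (simp add: sum_distrib_left mult.commute)
  qed
  have "(\<lambda>n. \<Sum>i\<in>UNIV. norm (P n (axis i 1))) \<longlonglongrightarrow> (\<Sum>i\<in>(UNIV::'n set). norm (0::complex^'n))"
    unfolding P_def by (intro tendsto_sum tendsto_norm matrix_pow_tendsto_0 ev)
  then have "\<forall>\<^sub>F n in sequentially. (\<Sum>i\<in>UNIV. norm (P n (axis i 1))) < 1/2"
    by (intro order_tendstoD) auto
  then have "\<forall>\<^sub>F n in sequentially. (\<Sum>i\<in>UNIV. norm (P n (axis i 1))) < 1/2 \<and> 0 < n"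
    using eventually_gt_at_top eventually_conj by blast
  then obtain N where N: "(\<Sum>i\<in>UNIV. norm (P N (axis i 1))) < 1/2" "0 < N"
    unfolding eventually_sequentially by blast
  \<comment> \<open>Since \<open>norm (P N x) \<le> norm x / 2\<close>, applying \<open>J\<close> shifts the sum and loses at least \<open>norm x / 2\<close>.\<close>
  define \<nu> where "\<nu> x = (\<Sum>j<N. norm (P j x))" for x
  \<comment> \<open>The summand 1 gives \<open>K \<ge> 1\<close>, hence a positive ratio
    \<open>1 - 1 / (2 * K)\<close>; that ratio comes from
    \<open>norm x / 2 \<ge> \<nu> x / (2 * K)\<close>.\<close>
  define K where "K = 1 + (\<Sum>j<N. \<Sum>i\<in>UNIV. norm (P j (axis i 1)))"
  have K: "K \<ge> 1" unfolding K_def by (auto intro!: sum_nonneg)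
  have lower: "norm x \<le> \<nu> x" for x
    unfolding \<nu>_def using member_le_sum[of 0 "{..<N}" "\<lambda>j. norm (P j x)"] N by (simp add: P_def)
  have upper: "\<nu> x \<le> K * norm x" for x
  proof -
    have "\<nu> x \<le> (\<Sum>j<N. (\<Sum>i\<in>UNIV. norm (P j (axis i 1))) * norm x)"
      unfolding \<nu>_def by (rule sum_mono) (rule P_bd)
    also have "\<dots> = (\<Sum>j<N. \<Sum>i\<in>UNIV. norm (P j (axis i 1))) * norm x" by (simp only: sum_distrib_right)
    also have "\<dots> \<le> K * norm x" by (intro mult_right_mono) (auto simp: K_def)
    finally show ?thesis .
  qed
  have half: "norm (P N x) \<le> 1/2 * norm x" for x
    by (rule order_trans[OF P_bd]) (intro mult_right_mono, use N in auto)
  have contr: "\<nu> (J *v x) \<le> (1 - 1 / (2 * K)) * \<nu> x" for x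
  proof -
    have "\<nu> (J *v x) = (\<Sum>j<N. norm (P (Suc j) x))" by (simp add: \<nu>_def P_def funpow_swap1)
    also have "\<dots> = (\<Sum>j<Suc N. norm (P j x)) - norm x" by (simp only: sum.lessThan_Suc_shift) (simp add: P_def)
    also have "\<dots> = \<nu> x + norm (P N x) - norm x" by (simp add: \<nu>_def)
    also have "\<dots> \<le> \<nu> x - 1/2 * norm x" using half[of x] by simp
    also have "\<dots> \<le> \<nu> x - 1/2 * (\<nu> x / K)" using upper[of x] K by (simp add: field_simps)
    finally show ?thesis by (simp add: algebra_simps)
  qed
  have "\<nu> (x + y) \<le> \<nu> x + \<nu> y" for x y
    unfolding \<nu>_def by (simp add: P_lin sum.distrib[symmetric] sum_mono norm_triangle_ineq)
  moreover have "0 < 1 - 1 / (2 * K)" "1 - 1 / (2 * K) < 1" using K by (auto simp: field_simps)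
  ultimately show ?thesis using K lower upper contr by blast
qed

text \<open>The estimate is iterated in the adapted norm, so that the comparison constant with the
  Euclidean norm enters once and not at every step.\<close>

lemma contracting_iterates:
  fixes f :: "complex^'n::finite \<Rightarrow> complex^'n"
  assumes ev: "\<And>c v. v \<noteq> 0 \<Longrightarrow> J *v v = c *s v \<Longrightarrow> cmod c < 1"
    and f: "(f has_derivative (\<lambda>v. J *v v)) (at 0)" "f 0 = 0"
  shows "\<exists>K \<rho> r. 1 \<le> K \<and> 0 < \<rho> \<and> \<rho> < 1 \<and> 0 < r \<and> (\<forall>x n. norm x < r \<longrightarrow> norm ((f ^^ n) x) \<le> K * \<rho> ^ n * norm x)"
proof -
  obtain \<nu> K \<rho> where \<nu>: "1 \<le> K" "0 < \<rho>" "\<rho> < 1" "\<And>x. norm x \<le> \<nu> x" "\<And>x. \<nu> x \<le> K * norm x"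
    "\<And>x. \<nu> (J *v x) \<le> \<rho> * \<nu> x" "\<And>x y. \<nu> (x + y) \<le> \<nu> x + \<nu> y"
    using ex_adapted_norm[of J] ev by metis
  \<comment> \<open>The nonlinear remainder then costs at most
    \<open>(1 - \<rho>) / 2 * \<nu> x\<close>, half of the gap, which leaves the ratio
    \<open>\<rho>' = (1 + \<rho>) / 2\<close>.\<close>
  define e where "e = (1 - \<rho>) / (2 * K)"
  have e: "e > 0" using \<nu> by (simp add: e_def)
  then obtain d where d: "d > 0" "\<And>x. norm x < d \<Longrightarrow> norm (f x - J *v x) \<le> e * norm x"
    using f unfolding has_derivative_at_alt by fastforce
  define \<rho>' where "\<rho>' = (1 + \<rho>) / 2"
  have step: "\<nu> (f x) \<le> \<rho>' * \<nu> x" if "\<nu> x < d" for x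
  proof -
    have x: "norm x < d" using that \<nu>(4)[of x] by simp
    have "\<nu> (f x) \<le> \<nu> (J *v x) + \<nu> (f x - J *v x)" using \<nu>(7)[of "J *v x" "f x - J *v x"] by simp
    also have "\<dots> \<le> \<rho> * \<nu> x + K * (e * norm x)"
      using \<nu>(6)[of x] \<nu>(5)[of "f x - J *v x"] d(2)[OF x] \<nu>(1)
      by (intro add_mono) (auto intro: order_trans mult_left_mono)
    also have "K * (e * norm x) = (1 - \<rho>) / 2 * norm x" using \<nu>(1) by (simp add: e_def)
    also have "\<rho> * \<nu> x + (1 - \<rho>) / 2 * norm x \<le> \<rho> * \<nu> x + (1 - \<rho>) / 2 * \<nu> x"
      using \<nu>(3,4) by (intro add_left_mono mult_left_mono) auto
    also have "\<dots> = \<rho>' * \<nu> x" by (simp add: \<rho>'_def field_simps)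
    finally show ?thesis .
  qed
  have \<rho>': "0 < \<rho>'" "\<rho>' < 1" using \<nu> by (auto simp: \<rho>'_def)
  have \<nu>0: "0 \<le> \<nu> x" for x using \<nu>(4)[of x] norm_ge_zero order_trans by blast
  have it: "\<nu> ((f ^^ n) x) \<le> \<rho>' ^ n * \<nu> x \<and> \<nu> ((f ^^ n) x) < d" if "\<nu> x < d" for x n
  proof (induction n)
    case (Suc n)
    have "\<nu> ((f ^^ Suc n) x) \<le> \<rho>' * \<nu> ((f ^^ n) x)" using step Suc by simp
    also have "\<dots> \<le> \<rho>' * (\<rho>' ^ n * \<nu> x)" using Suc \<rho>' by (intro mult_left_mono) auto
    finally have 1: "\<nu> ((f ^^ Suc n) x) \<le> \<rho>' ^ Suc n * \<nu> x" by (simp add: mult.assoc)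
    also have "\<dots> \<le> 1 * \<nu> x" using \<rho>' \<nu>0 by (intro mult_right_mono power_le_one) auto
    finally show ?case using 1 that by simp
  qed (use that in auto)
  have "norm ((f ^^ n) x) \<le> K * \<rho>' ^ n * norm x" if "norm x < d / K" for x n
  proof -
    have "\<nu> x < d" using \<nu>(5)[of x] that \<nu>(1) by (simp add: field_simps)
    then have "norm ((f ^^ n) x) \<le> \<rho>' ^ n * \<nu> x" using it[of x n] \<nu>(4)[of "(f ^^ n) x"] by simp
    also have "\<dots> \<le> \<rho>' ^ n * (K * norm x)" using \<rho>' \<nu>(5) by (intro mult_left_mono) auto
    finally show ?thesis by (simp add: mult_ac)
  qed
  then show ?thesis using \<nu>(1) \<rho>' d(1) by (intro exI[of _ K] exI[of _ \<rho>'] exI[of _ "d / K"]) auto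
qed

section \<open>Exponent matrices and infinite products\<close>

text \<open>\<open>iter_exp q A n\<close> is the \<open>n\<close>-th power of the matrix \<open>A\<close> with rows and columns below \<open>q\<close>.\<close>
definition iter_exp :: "nat \<Rightarrow> (nat \<Rightarrow> nat \<Rightarrow> nat) \<Rightarrow> nat \<Rightarrow> nat \<Rightarrow> nat \<Rightarrow> nat" where
  "iter_exp q A n = ((\<lambda>E k l. \<Sum>m<q. E k m * A m l) ^^ n) (\<lambda>k l. if l = k then 1 else 0)"

lemma iter_exp_0: "iter_exp q A 0 k l = (if l = k then 1 else 0)"
  by (simp add: iter_exp_def)

lemma iter_exp_Suc: "iter_exp q A (Suc n) k l = (\<Sum>m<q. iter_exp q A n k m * A m l)"
  by (simp add: iter_exp_def)

lemma iter_exp_1: "k < q \<Longrightarrow> iter_exp q A 1 k l = A k l"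
proof -
  assume "k < q"
  have "iter_exp q A (Suc 0) k l = (\<Sum>m<q. if m = k then A m l else 0)"
    unfolding iter_exp_Suc iter_exp_0 by (rule sum.cong) auto
  then show ?thesis using \<open>k < q\<close> by simp
qed

lemma iter_exp_add:
  "l < q \<Longrightarrow> iter_exp q A (m + n) k l = (\<Sum>j<q. iter_exp q A m k j * iter_exp q A n j l)"
proof (induction n arbitrary: l)
  case 0
  have "(\<Sum>j<q. iter_exp q A m k j * iter_exp q A 0 j l) = (\<Sum>j<q. if j = l then iter_exp q A m k j else 0)"
    unfolding iter_exp_0 by (rule sum.cong) auto
  then show ?case using 0 by simp
next
  case (Suc n)
  have "iter_exp q A (m + Suc n) k l = (\<Sum>i<q. (\<Sum>j<q. iter_exp q A m k j * iter_exp q A n j i) * A i l)"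
    using Suc.IH by (simp add: iter_exp_Suc)
  also have "\<dots> = (\<Sum>i<q. \<Sum>j<q. iter_exp q A m k j * iter_exp q A n j i * A i l)"
    by (simp add: sum_distrib_right)
  also have "\<dots> = (\<Sum>j<q. \<Sum>i<q. iter_exp q A m k j * iter_exp q A n j i * A i l)"
    by (rule sum.swap)
  also have "\<dots> = (\<Sum>j<q. iter_exp q A m k j * iter_exp q A (Suc n) j l)"
    by (simp add: iter_exp_Suc sum_distrib_left mult.assoc)
  finally show ?case .
qed

text \<open>The counterpart of \<open>periodic_component\<close> on the level of exponents;
  \<open>periodic_component_iff\<close> proves the two equivalent for the pull-back matrix.\<close>

definition periodic_idx :: "nat \<Rightarrow> (nat \<Rightarrow> nat \<Rightarrow> nat) \<Rightarrow> nat set" where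
  "periodic_idx q A = {k. k < q \<and> (\<exists>\<eta>\<ge>1. \<forall>l<q. iter_exp q A \<eta> k l = (if l = k then 1 else 0))}"

text \<open>Row sums are the degrees of the monomials; without zero rows every factor is replaced by
  a monomial of degree at least 1.\<close>

lemma iter_exp_sum_mono:
  assumes "\<And>k. k < q \<Longrightarrow> \<exists>l<q. A k l > 0" "k < q"
  shows "(\<Sum>l<q. iter_exp q A n k l) \<le> (\<Sum>l<q. iter_exp q A (Suc n) k l)"
proof -
  have one: "1 \<le> (\<Sum>l<q. A m l)" if m: "m < q" for m
  proof -
    obtain l where l: "l < q" "A m l > 0" using assms(1)[OF m] by blast
    then have "A m l \<le> (\<Sum>l<q. A m l)" by (intro member_le_sum) auto
    then show ?thesis using l by simp
  qed
  have "(\<Sum>l<q. iter_exp q A n k l) \<le> (\<Sum>m<q. iter_exp q A n k m * (\<Sum>l<q. A m l))"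
  proof (rule sum_mono)
    fix m assume "m \<in> {..<q}"
    then show "iter_exp q A n k m \<le> iter_exp q A n k m * (\<Sum>l<q. A m l)"
      using mult_le_mono2[OF one[of m], of "iter_exp q A n k m"] by simp
  qed
  also have "\<dots> = (\<Sum>l<q. iter_exp q A (Suc n) k l)"
    unfolding iter_exp_Suc by (subst sum.swap) (simp add: sum_distrib_left)
  finally show ?thesis .
qed

text \<open>Row sums do not decrease and equal 1 at the period, so row \<open>k\<close> has sum at
  most 1 and is the unit vector at some \<open>m\<close>. This \<open>m\<close> inherits the period
  because \<open>A\<close> commutes with its powers.\<close>

lemma periodic_row:
  assumes ne: "\<And>k. k < q \<Longrightarrow> \<exists>l<q. A k l > 0" and k: "k \<in> periodic_idx q A"
  shows "\<exists>m\<in>periodic_idx q A. \<forall>l<q. A k l = (if l = m then 1 else 0)"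
proof -
  obtain \<eta> where \<eta>: "k < q" "\<eta> \<ge> 1" "\<And>l. l < q \<Longrightarrow> iter_exp q A \<eta> k l = (if l = k then 1 else 0)"
    using k by (auto simp: periodic_idx_def)
  have "(\<Sum>l<q. iter_exp q A 1 k l) \<le> (\<Sum>l<q. iter_exp q A \<eta> k l)"
    using \<eta>(2) lift_Suc_mono_le[of "\<lambda>n. \<Sum>l<q. iter_exp q A n k l", OF iter_exp_sum_mono[OF ne \<eta>(1)]] by blast
  also have "\<dots> = 1" using \<eta>(1,3) by simp
  finally have s: "(\<Sum>l<q. A k l) \<le> 1" using iter_exp_1[OF \<eta>(1)] by simp
  obtain m where m: "m < q" "A k m > 0" using ne \<eta>(1) by blast
  have "A k m + (\<Sum>l\<in>{..<q}-{m}. A k l) \<le> 1" using s m by (simp add: sum.remove)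
  then have "A k m = 1" and "(\<Sum>l\<in>{..<q}-{m}. A k l) = 0" using m(2) by linarith+
  then have row: "A k l = (if l = m then 1 else 0)" if "l < q" for l
    using that by (cases "l = m") auto
  \<comment> \<open>Row \<open>k\<close> of the power \<open>\<eta> + 1\<close> is computed twice,
    with the extra factor on the left and on the right.\<close>
  have "iter_exp q A \<eta> m l = (if l = m then 1 else 0)" if l: "l < q" for l
  proof -
    have "iter_exp q A (1 + \<eta>) k l = (\<Sum>j<q. A k j * iter_exp q A \<eta> j l)"
      unfolding iter_exp_add[OF l] iter_exp_1[OF \<eta>(1)] ..
    also have "\<dots> = (\<Sum>j<q. if j = m then iter_exp q A \<eta> j l else 0)"
      by (rule sum.cong) (auto simp: row)
    finally have 1: "iter_exp q A (1 + \<eta>) k l = iter_exp q A \<eta> m l" using m by simp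
    have "iter_exp q A (Suc \<eta>) k l = (\<Sum>j<q. if j = k then A j l else 0)"
      unfolding iter_exp_Suc by (rule sum.cong) (auto simp: \<eta>(3))
    then show ?thesis using 1 row[OF l] \<eta>(1) by simp
  qed
  then have "m \<in> periodic_idx q A" using m(1) \<eta>(2) by (auto simp: periodic_idx_def)
  then show ?thesis using row by blast
qed

lemma periodic_multiple:
  assumes "\<And>l. l < q \<Longrightarrow> iter_exp q A \<eta> k l = (if l = k then 1 else 0)" and "k < q"
  shows "l < q \<Longrightarrow> iter_exp q A (\<eta> * n) k l = (if l = k then 1 else 0)"
proof (induction n arbitrary: l)
  case 0
  then show ?case by (simp add: iter_exp_0)
next
  case (Suc n)
  have "iter_exp q A (\<eta> + \<eta> * n) k l = (\<Sum>j<q. if j = k then iter_exp q A (\<eta> * n) j l else 0)"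
    unfolding iter_exp_add[OF Suc.prems] by (rule sum.cong) (auto simp: assms(1))
  then show ?case using Suc assms(2) by simp
qed

text \<open>At the common period \<open>\<eta> * \<eta>'\<close> the two rows are the unit vectors
  at \<open>k\<close> and \<open>k'\<close>; but equal rows of \<open>A\<close> yield equal rows of
  every positive power.\<close>

lemma periodic_row_inj:
  assumes k: "k \<in> periodic_idx q A" "k' \<in> periodic_idx q A"
    and row: "\<And>l. l < q \<Longrightarrow> A k l = A k' l"
  shows "k = k'"
proof -
  obtain \<eta> where \<eta>: "k < q" "\<eta> \<ge> 1" "\<And>l. l < q \<Longrightarrow> iter_exp q A \<eta> k l = (if l = k then 1 else 0)"
    using k by (auto simp: periodic_idx_def)
  obtain \<eta>' where \<eta>': "k' < q" "\<eta>' \<ge> 1" "\<And>l. l < q \<Longrightarrow> iter_exp q A \<eta>' k' l = (if l = k' then 1 else 0)"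
    using k by (auto simp: periodic_idx_def)
  have "\<eta> * \<eta>' \<ge> 1" using \<eta>(2) \<eta>'(2) by (simp add: Suc_le_eq)
  then obtain N where N: "\<eta> * \<eta>' = 1 + N" using le_Suc_ex by blast
  have eq: "iter_exp q A (1 + N) k l = iter_exp q A (1 + N) k' l" if l: "l < q" for l
    unfolding iter_exp_add[OF l] iter_exp_1[OF \<eta>(1)] iter_exp_1[OF \<eta>'(1)]
    by (rule sum.cong) (auto simp: row)
  have "iter_exp q A (1 + N) k k = 1" using periodic_multiple[OF \<eta>(3,1), of k \<eta>'] \<eta>(1) N by simp
  moreover have "iter_exp q A (1 + N) k' k = (if k = k' then 1 else 0)"
    using periodic_multiple[OF \<eta>'(3,1), of k \<eta>] \<eta>(1) N by (simp add: mult.commute)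
  ultimately show ?thesis using eq[OF \<eta>(1)] by (metis zero_neq_one)
qed

lemma periodic_permutation:
  assumes ne: "\<And>k. k < q \<Longrightarrow> \<exists>l<q. A k l > 0"
  shows "\<exists>\<pi>. bij_betw \<pi> (periodic_idx q A) (periodic_idx q A) \<and>
    (\<forall>k\<in>periodic_idx q A. \<forall>l<q. A k l = (if l = \<pi> k then 1 else 0))"
proof -
  let ?R = "periodic_idx q A"
  have "\<forall>k\<in>?R. \<exists>m. m \<in> ?R \<and> (\<forall>l<q. A k l = (if l = m then 1 else 0))"
    using periodic_row[of q A, OF ne] by blast
  from bchoice[OF this] obtain \<pi>
    where \<pi>: "\<forall>k\<in>?R. \<pi> k \<in> ?R \<and> (\<forall>l<q. A k l = (if l = \<pi> k then 1 else 0))" by blast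
  have fin: "finite ?R" by (rule finite_subset[of _ "{..<q}"]) (auto simp: periodic_idx_def)
  have inj: "inj_on \<pi> ?R"
  proof (rule inj_onI)
    fix k k' assume k: "k \<in> ?R" "k' \<in> ?R" "\<pi> k = \<pi> k'"
    have "A k l = A k' l" if "l < q" for l
      using bspec[OF \<pi> k(1)] bspec[OF \<pi> k(2)] k(3) that by simp
    then show "k = k'" by (rule periodic_row_inj[OF k(1,2)])
  qed
  have "\<pi> ` ?R \<subseteq> ?R" using \<pi> by blast
  then have "bij_betw \<pi> ?R ?R" using endo_inj_surj[OF fin _ inj] inj by (simp add: bij_betw_def)
  then show ?thesis using \<pi> by blast
qed

section \<open>Infinite products along orbits\<close>

lemma holo_on_Lipschitz_at_0:
  assumes "holo_on (ball 0 s) v" "s > 0"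
  shows "\<exists>M. \<forall>\<^sub>F y in nhds 0. cmod (v y - v 0) \<le> M * norm y"
proof -
  have d: "(v has_derivative clin (grad v 0)) (at 0)" by (rule holo_on_grad[OF assms(1)]) (use assms in simp)
  then obtain d where d: "d > 0" "\<And>y. norm y < d \<Longrightarrow> norm (v y - v 0 - clin (grad v 0) y) \<le> norm y"
    unfolding has_derivative_at_alt by (metis diff_zero mult_1 zero_less_one)
  obtain B where B: "\<And>y. norm (clin (grad v 0) y) \<le> norm y * B"
    using bounded_linear.bounded[OF bounded_linear_clin] by blast
  have "cmod (v y - v 0) \<le> (1 + B) * norm y" if "dist y 0 < d" for y
  proof -
    have "cmod (v y - v 0) \<le> norm (v y - v 0 - clin (grad v 0) y) + norm (clin (grad v 0) y)"
      by (metis diff_add_cancel norm_triangle_ineq)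
    also have "\<dots> \<le> norm y + norm y * B" using d(2)[of y] B[of y] that by (intro add_mono) auto
    finally show ?thesis by (simp add: algebra_simps)
  qed
  then show ?thesis unfolding eventually_nhds_metric using d(1) by blast
qed

lemma holo_map_on_funpow:
  fixes f :: "complex^'n::finite \<Rightarrow> complex^'n"
  assumes f: "holo_map_on V f" and d: "\<And>n x. x \<in> D \<Longrightarrow> (f ^^ n) x \<in> V"
  shows "holo_map_on D (f ^^ n)"
proof (induction n)
  case 0
  then show ?case by (simp add: holo_map_on_def holo_on_nth)
next
  case (Suc n)
  have "holo_map_on D (\<lambda>x. f ((f ^^ n) x))"
    by (rule holo_map_on_compose[OF Suc f]) (use d in blast)
  then show ?case by (simp add: comp_def)
qed

text \<open>Iterating the equation backwards along \<pi> expresses \<xi> as the product of the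
  \<open>v\<close> at successive points of the orbit. The factors differ from 1 by at most a
  constant times the norm of the point, hence by a geometric sequence. The ball of radius
  \<open>d\<close> need not be invariant under \<open>f\<close>, whence the condition on
  \<open>f x\<close>.\<close>

lemma infinite_product_solution:
  fixes f :: "complex^'n::finite \<Rightarrow> complex^'n" and v :: "'i \<Rightarrow> complex^'n \<Rightarrow> complex"
  assumes R: "finite R" "bij_betw \<pi> R R"
    and f: "holo_map_on (ball 0 r) f" "f 0 = 0" "r > 0"
    and it: "1 \<le> K" "0 < \<rho>" "\<rho> < 1" "\<And>x n. norm x < r \<Longrightarrow> norm ((f ^^ n) x) \<le> K * \<rho> ^ n * norm x"
    and v: "\<And>k. k \<in> R \<Longrightarrow> holo_on (ball 0 r) (v k)" "\<And>k. k \<in> R \<Longrightarrow> v k 0 = 1"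
  shows "\<exists>\<xi> d. 0 < d \<and> d \<le> r \<and> (\<forall>k\<in>R. holo_on (ball 0 d) (\<xi> k) \<and> \<xi> k 0 = 1) \<and>
    (\<forall>k\<in>R. \<forall>x\<in>ball 0 d. f x \<in> ball 0 d \<longrightarrow> \<xi> (\<pi> k) x = v k x * \<xi> k (f x))"
proof -
  have "\<forall>k\<in>R. \<exists>M. \<forall>\<^sub>F y in nhds 0. cmod (v k y - 1) \<le> M * norm y"
    using holo_on_Lipschitz_at_0[OF v(1) f(3)] v(2) by force
  then obtain M where M: "\<And>k. k \<in> R \<Longrightarrow> \<forall>\<^sub>F y in nhds 0. cmod (v k y - 1) \<le> M k * norm y"
    by metis
  define M' where "M' = (\<Sum>k\<in>R. \<bar>M k\<bar>)"
  have M'0: "M' \<ge> 0" by (simp add: M'_def sum_nonneg)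
  have "\<forall>\<^sub>F y in nhds 0. \<forall>k\<in>R. cmod (v k y - 1) \<le> M' * norm y"
  proof (rule eventually_ball_finite[OF R(1)], rule ballI)
    fix k assume k: "k \<in> R"
    have "M k \<le> M'" unfolding M'_def using member_le_sum[OF k, of "\<lambda>k. \<bar>M k\<bar>"] R(1) by force
    then show "\<forall>\<^sub>F y in nhds 0. cmod (v k y - 1) \<le> M' * norm y"
      by (intro eventually_mono[OF M[OF k]]) (meson mult_right_mono norm_ge_zero order_trans)
  qed
  then obtain d0 where d0: "d0 > 0" "\<And>y k. norm y < d0 \<Longrightarrow> k \<in> R \<Longrightarrow> cmod (v k y - 1) \<le> M' * norm y"
    unfolding eventually_nhds_metric by (auto simp: dist_norm)
  \<comment> \<open>\<open>K\<close> accounts for a possible initial growth of orbits; the factor 2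
    keeps the orbits of the closed ball strictly inside the balls of radius \<open>d0\<close> and
    \<open>r\<close>.\<close>
  define d where "d = min d0 r / (2 * K)"
  have d: "d > 0" "d < r" "K * d < d0" "K * d < r"
  proof -
    have p: "min d0 r > 0" using d0 f by simp
    then show "d > 0" using it(1) by (simp add: d_def)
    have "K * d = min d0 r / 2" using it(1) by (simp add: d_def)
    then show k: "K * d < d0" "K * d < r" using p by linarith+
    have "1 * d \<le> K * d" using it(1) \<open>d > 0\<close> by (intro mult_right_mono) auto
    then show "d < r" using k by simp
  qed
  have small: "norm ((f ^^ n) x) \<le> K * d * \<rho> ^ n" "norm ((f ^^ n) x) < d0" "norm ((f ^^ n) x) < r"
    if "norm x \<le> d" for n x
  proof -
    have "norm ((f ^^ n) x) \<le> K * \<rho> ^ n * norm x" using it(4) that d(2) by simp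
    also have "\<dots> \<le> K * \<rho> ^ n * d" using that it by (intro mult_left_mono) auto
    finally show 1: "norm ((f ^^ n) x) \<le> K * d * \<rho> ^ n" by (simp add: mult_ac)
    also have "\<dots> \<le> K * d * 1" using it d(1) by (intro mult_left_mono power_le_one) auto
    finally show "norm ((f ^^ n) x) < d0" "norm ((f ^^ n) x) < r" using d by simp_all
  qed
  define \<sigma> where "\<sigma> = inv_into R \<pi>"
  have \<sigma>R: "\<sigma> k \<in> R" if "k \<in> R" for k
    using that R(2) unfolding \<sigma>_def by (metis bij_betw_imp_surj_on inv_into_into)
  have \<sigma>nR: "(\<sigma> ^^ n) k \<in> R" if "k \<in> R" for k n
    by (induction n) (use that \<sigma>R in auto)
  have \<sigma>\<pi>: "\<sigma> (\<pi> k) = k" if "k \<in> R" for k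
    using that R(2) unfolding \<sigma>_def by (simp add: bij_betw_inv_into_left)
  \<comment> \<open>Exponent \<open>Suc j\<close>: solved for \<xi> at \<open>k\<close>, the
    equation already has \<open>v\<close> at \<open>\<sigma> k\<close> as its first factor.\<close>
  define P where "P k n x = (\<Prod>j<n. v ((\<sigma> ^^ Suc j) k) ((f ^^ j) x))" for k n x
  have hj: "holo_on (ball 0 d) (\<lambda>x. v ((\<sigma> ^^ Suc j) k) ((f ^^ j) x))"
    and cj: "continuous_on (cball 0 d) (\<lambda>x. v ((\<sigma> ^^ Suc j) k) ((f ^^ j) x))" if k: "k \<in> R" for k j
  proof -
    \<comment> \<open>Points whose whole orbit stays in the domain. It contains the closed ball, on
      which the product test asks for continuous factors.\<close>
    define D where "D = {x. norm x < r \<and> (\<forall>n. norm ((f ^^ n) x) < r)}"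
    have "holo_map_on D (f ^^ j)" by (rule holo_map_on_funpow[OF f(1)]) (auto simp: D_def)
    then have h: "holo_on D (\<lambda>x. v ((\<sigma> ^^ Suc j) k) ((f ^^ j) x))"
      by (rule holo_on_compose[OF _ v(1)[OF \<sigma>nR[OF k]]]) (auto simp: D_def)
    have "cball 0 d \<subseteq> D" using small(3) d(2) by (auto simp: D_def)
    then show "continuous_on (cball 0 d) (\<lambda>x. v ((\<sigma> ^^ Suc j) k) ((f ^^ j) x))"
      and "holo_on (ball 0 d) (\<lambda>x. v ((\<sigma> ^^ Suc j) k) ((f ^^ j) x))"
      using continuous_on_subset[OF holo_on_continuous_on[OF h]]
        holo_on_subset[OF h order.trans[OF ball_subset_cball]] by auto
  qed
  define \<xi> where "\<xi> k x = lim (\<lambda>n. P k n x)" for k x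
  have ul: "uniform_limit (cball 0 d) (P k) (\<xi> k) sequentially" if k: "k \<in> R" for k
  proof -
    have "uniformly_convergent_on (cball 0 d) (\<lambda>N x. \<Sum>n<N. norm (v ((\<sigma> ^^ Suc n) k) ((f ^^ n) x) - 1))"
      unfolding uniformly_convergent_on_def
    proof (rule exI, rule Weierstrass_m_test)
      fix n x assume "x \<in> cball (0::complex^'n) d"
      then have x: "norm x \<le> d" by simp
      have "cmod (v ((\<sigma> ^^ Suc n) k) ((f ^^ n) x) - 1) \<le> M' * norm ((f ^^ n) x)"
        by (rule d0(2)[OF small(2)[OF x] \<sigma>nR[OF k]])
      also have "\<dots> \<le> M' * (K * d * \<rho> ^ n)" using small(1)[OF x] M'0 by (intro mult_left_mono)
      finally show "norm (norm (v ((\<sigma> ^^ Suc n) k) ((f ^^ n) x) - 1)) \<le> (M' * (K * d)) * \<rho> ^ n" by (simp add: mult_ac)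
    next
      show "summable (\<lambda>n. (M' * (K * d)) * \<rho> ^ n)" using it by (intro summable_mult summable_geometric) auto
    qed
    then have "uniformly_convergent_on (cball 0 d) (P k)"
      using uniformly_convergent_on_prod'[of "cball 0 d" "\<lambda>n x. v ((\<sigma> ^^ Suc n) k) ((f ^^ n) x)"] cj[OF k]
      unfolding P_def by simp
    then show ?thesis unfolding \<xi>_def uniformly_convergent_uniform_limit_iff .
  qed
  have pl: "(\<lambda>n. P k n x) \<longlonglongrightarrow> \<xi> k x" if "k \<in> R" "x \<in> ball 0 d" for k x
    using tendsto_uniform_limitI[OF ul[OF that(1)], of x] that(2) by simp
  have hol: "holo_on (ball 0 d) (\<xi> k)" if k: "k \<in> R" for k
  proof (rule holo_on_uniform_limit[OF open_ball])
    show "uniform_limit (ball 0 d) (P k) (\<xi> k) sequentially"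
      by (rule uniform_limit_on_subset[OF ul[OF k]]) auto
    show "holo_on (ball 0 d) (P k n)" for n
      unfolding P_def[abs_def] by (rule holo_on_prod) (rule hj[OF k])
  qed
  have f0: "(f ^^ n) 0 = 0" for n by (induction n) (auto simp: f(2))
  have one: "\<xi> k 0 = 1" if k: "k \<in> R" for k
  proof -
    have "v ((\<sigma> ^^ Suc j) k) 0 = 1" for j by (rule v(2)[OF \<sigma>nR[OF k]])
    then have "P k n 0 = 1" for n unfolding P_def f0 by simp
    then show ?thesis using pl[OF k, of 0] d(1) LIMSEQ_unique by (simp add: LIMSEQ_const_iff)
  qed
  have eq: "\<xi> (\<pi> k) x = v k x * \<xi> k (f x)" if k: "k \<in> R" and x: "x \<in> ball 0 d" "f x \<in> ball 0 d" for k x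
  proof -
    have \<pi>k: "\<pi> k \<in> R" using k R(2) bij_betwE by blast
    \<comment> \<open>Splitting off the factor \<open>j = 0\<close> turns the product at
      \<open>x\<close> into the one at \<open>f x\<close>, with the index moved from
      \<open>\<pi> k\<close> back to \<open>k\<close>.\<close>
    have "P (\<pi> k) (Suc n) x = v k x * P k n (f x)" for n
      unfolding P_def by (subst prod.lessThan_Suc_shift) (simp add: funpow_swap1 \<sigma>\<pi>[OF k])
    then have "(\<lambda>n. v k x * P k n (f x)) \<longlonglongrightarrow> \<xi> (\<pi> k) x" using LIMSEQ_Suc[OF pl[OF \<pi>k x(1)]] by simp
    moreover have "(\<lambda>n. v k x * P k n (f x)) \<longlonglongrightarrow> v k x * \<xi> k (f x)" by (intro tendsto_mult tendsto_const pl k x)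
    ultimately show ?thesis by (rule LIMSEQ_unique)
  qed
  show ?thesis using d hol one eq by (intro exI[of _ \<xi>] exI[of _ d]) auto
qed

text \<open>The differentials of the components are extended to a basis, whose vectors are the rows
  of \<open>M\<close>; the additional rows supply the linear coordinates, and \<iota> records the
  position of each component.\<close>

lemma complete_to_invertible:
  fixes a :: "nat \<Rightarrow> complex^'n::finite"
  assumes indep: "\<And>c. (\<And>v. (\<Sum>k<q. c k * clin (a k) v) = 0) \<Longrightarrow> \<forall>k<q. c k = 0"
  shows "\<exists>\<iota> (M::complex^'n^'n). inj_on \<iota> {..<q} \<and> (\<forall>k<q. M $ \<iota> k = a k) \<and> det M \<noteq> 0"
proof -
  have indep': "\<forall>k<q. c k = 0" if "(\<Sum>k<q. c k *s a k) = 0" for c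
  proof (rule indep)
    fix v
    have "(\<Sum>k<q. c k * clin (a k) v) = clin (\<Sum>k<q. c k *s a k) v"
      by (simp add: clin_def sum_distrib_left sum_distrib_right) (subst sum.swap, simp add: mult.assoc)
    then show "(\<Sum>k<q. c k * clin (a k) v) = 0" using that by simp
  qed
  \<comment> \<open>Independence is given for the family, while bases are sets; a repetition would
    be a relation with coefficients 1 and -1.\<close>
  have inj: "inj_on a {..<q}"
  proof (rule inj_onI, rule ccontr)
    fix i j assume ij: "i \<in> {..<q}" "j \<in> {..<q}" "a i = a j" "i \<noteq> j"
    define c :: "nat \<Rightarrow> complex" where "c k = (if k = i then 1 else if k = j then -1 else 0)" for k
    have "(\<Sum>k<q. c k *s a k) = (\<Sum>k\<in>{i, j}. c k *s a k)"
      by (rule sum.mono_neutral_right) (use ij in \<open>auto simp: c_def\<close>)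
    also have "\<dots> = 0" using ij by (simp add: c_def)
    finally show False using indep'[of c] ij by (auto simp: c_def)
  qed
  have ind: "vec.independent (a ` {..<q})"
    unfolding vec.dependent_finite[OF finite_imageI[OF finite_lessThan]]
  proof (rule notI, elim exE conjE bexE imageE)
    fix u v k assume "(\<Sum>v\<in>a ` {..<q}. u v *s v) = 0" and k: "u v \<noteq> 0" "v = a k" "k \<in> {..<q}"
    then have "(\<Sum>k<q. u (a k) *s a k) = 0" by (simp add: sum.reindex[OF inj])
    then show False using indep'[of "\<lambda>k. u (a k)"] k by auto
  qed
  define B where "B = vec.extend_basis (a ` {..<q})"
  have B: "a ` {..<q} \<subseteq> B" "vec.independent B" "vec.span B = UNIV"
    using vec.extend_basis_superset[OF ind] vec.independent_extend_basis[OF ind] vec.span_extend_basis[OF ind]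
    by (auto simp: B_def)
  have finB: "finite B" using B(2) vec.finiteI_independent by blast
  have "card B = CARD('n)"
    using vec.dim_eq_card[OF _ B(2), of UNIV] B(3) vec_dim_card[where 'n='n and 'a=complex] by simp
  then obtain \<beta> where \<beta>: "bij_betw \<beta> (UNIV::'n set) B" using finite_same_card_bij[of "UNIV::'n set" B] finB by auto
  define M :: "complex^'n^'n" where "M = (\<chi> i. \<beta> i)"
  define \<iota> where "\<iota> k = inv_into UNIV \<beta> (a k)" for k
  have \<beta>\<iota>: "\<beta> (\<iota> k) = a k" if "k < q" for k
    using that B(1) \<beta> unfolding \<iota>_def by (auto simp: bij_betw_def f_inv_into_f)
  have "inj_on \<iota> {..<q}"
  proof (rule inj_onI)
    fix k k' assume k: "k \<in> {..<q}" "k' \<in> {..<q}" "\<iota> k = \<iota> k'"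
    have "a k = \<beta> (\<iota> k)" by (rule \<beta>\<iota>[symmetric]) (use k in simp)
    also have "\<dots> = a k'" unfolding k(3) by (rule \<beta>\<iota>) (use k in simp)
    finally have "a k = a k'" .
    then show "k = k'" using inj k by (simp add: inj_on_def)
  qed
  moreover have "\<forall>k<q. M $ \<iota> k = a k" using \<beta>\<iota> by (simp add: M_def)
  moreover have "\<exists>N. M ** N = mat 1"
    unfolding matrix_right_invertible_independent_rows
  proof (intro allI impI)
    fix c :: "'n \<Rightarrow> complex" and i :: 'n assume c: "(\<Sum>i\<in>UNIV. c i *s row i M) = 0"
    have row: "row i M = \<beta> i" for i by (simp add: row_def M_def vec_eq_iff)
    have \<beta>inj: "inj \<beta>" using \<beta> by (simp add: bij_betw_def)
    have "(\<Sum>v\<in>B. c (inv_into UNIV \<beta> v) *s v) = (\<Sum>i\<in>UNIV. c i *s \<beta> i)"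
      using sum.reindex_bij_betw[OF \<beta>, of "\<lambda>v. c (inv_into UNIV \<beta> v) *s v", symmetric] \<beta>inj by simp
    also have "\<dots> = 0" using c by (simp add: row)
    finally have "(\<Sum>v\<in>B. c (inv_into UNIV \<beta> v) *s v) = 0" .
    then have "\<forall>v\<in>B. c (inv_into UNIV \<beta> v) = 0"
      using B(2) unfolding vec.dependent_finite[OF finB]
      by (auto dest!: spec[of _ "\<lambda>v. c (inv_into UNIV \<beta> v)"])
    moreover have "\<beta> i \<in> B" using \<beta> by (auto simp: bij_betw_def)
    ultimately show "c i = 0" using \<beta>inj by force
  qed
  then have "det M \<noteq> 0" using invertible_det_nz[of M] invertible_right_inverse[of M] by simp
  ultimately show ?thesis by blast
qed

section \<open>Pull-back of the components\<close>

lemma finite_common_radius: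
  assumes "finite S" "\<And>k. k \<in> S \<Longrightarrow> \<exists>s>0::real. P k s" "\<And>k s t. P k s \<Longrightarrow> 0 < t \<Longrightarrow> t \<le> s \<Longrightarrow> P k t"
  shows "\<exists>s>0. \<forall>k\<in>S. P k s"
  using assms(1,2)
proof (induction S rule: finite_induct)
  case empty
  then show ?case by (auto intro!: exI[of _ 1])
next
  case (insert i S)
  obtain s where s: "s > 0" "\<forall>k\<in>S. P k s" using insert by auto
  obtain t where t: "t > 0" "P i t" using insert by auto
  have "P k (min s t)" if "k \<in> insert i S" for k
    using that s t assms(3)[of k s "min s t"] assms(3)[of k t "min s t"] by auto
  then show ?case using s t by (intro exI[of _ "min s t"]) auto
qed

lemma continuous_ball_image:
  fixes F :: "'a::metric_space \<Rightarrow> 'b::metric_space"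
  assumes "continuous_on V F" "open V" "a \<in> V" "open W" "F a \<in> W"
  shows "\<exists>d>0. ball a d \<subseteq> V \<and> F ` ball a d \<subseteq> W"
proof -
  have "open (V \<inter> F -` W)" using continuous_open_preimage[OF assms(1,2,4)] .
  then obtain d where "d > 0" "ball a d \<subseteq> V \<inter> F -` W" using assms(3,5) open_contains_ball by blast
  then show ?thesis by (intro exI[of _ d]) auto
qed

text \<open>After cancelling the lower power of \<open>t\<close>, a larger exponent on the right
  would force \<open>F1\<close> to tend to 0. Orders of vanishing are thus compared by limits
  alone.\<close>

lemma power_order_aux:
  fixes F1 F2 :: "real \<Rightarrow> complex"
  assumes "(F1 \<longlongrightarrow> l) (at_right 0)" "(F2 \<longlongrightarrow> m) (at_right 0)" "l \<noteq> 0"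
    and eq: "\<forall>\<^sub>F t in at_right 0. F1 t * complex_of_real t ^ M = F2 t * complex_of_real t ^ N"
  shows "N \<le> M"
proof (rule ccontr)
  assume "\<not> N \<le> M"
  then obtain j where j: "N = M + Suc j" by (metis add_Suc_right less_imp_Suc_add not_le)
  have "\<forall>\<^sub>F t in at_right 0. F2 t * complex_of_real t ^ Suc j = F1 t"
    using eq eventually_at_right_less[of 0]
  proof eventually_elim
    case (elim t)
    then have "complex_of_real t ^ M * F1 t = complex_of_real t ^ M * (F2 t * complex_of_real t ^ Suc j)"
      unfolding j by (simp add: power_add mult_ac)
    then show ?case using elim(2) by simp
  qed
  moreover have lim: "((\<lambda>t. F2 t * complex_of_real t ^ Suc j) \<longlongrightarrow> m * complex_of_real 0 ^ Suc j) (at_right 0)"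
    by (intro tendsto_mult tendsto_power tendsto_of_real tendsto_ident_at assms(2))
  ultimately have "(F1 \<longlongrightarrow> m * complex_of_real 0 ^ Suc j) (at_right 0)"
    by (intro Lim_transform_eventually[OF lim])
  then have "m * complex_of_real 0 ^ Suc j = l" by (rule tendsto_unique[OF _ _ assms(1), rotated]) simp
  then show False using assms(3) by simp
qed

text \<open>A chart in which \<open>h k\<close> is the coordinate with index
  \<open>\<iota> k\<close>, the others being arbitrary. It serves twice: for the existence of the
  exponents and for their uniqueness.\<close>

locale holo_coords =
  fixes h :: "nat \<Rightarrow> complex^'n::finite \<Rightarrow> complex" and q :: nat and \<iota> :: "nat \<Rightarrow> 'n"
    and \<Phi> \<Psi> :: "complex^'n \<Rightarrow> complex^'n" and V W :: "(complex^'n) set"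
  assumes inj: "inj_on \<iota> {..<q}" and V: "open V" "0 \<in> V" and W: "open W"
    and \<Phi>0: "\<Phi> 0 = 0" and hom: "homeomorphism V W \<Phi> \<Psi>"
    and hol\<Phi>: "holo_map_on V \<Phi>" and hol\<Psi>: "holo_map_on W \<Psi>"
    and coord: "\<And>x k. x \<in> V \<Longrightarrow> k < q \<Longrightarrow> \<Phi> x $ \<iota> k = h k x"
begin

lemma \<Psi>_in: "y \<in> W \<Longrightarrow> \<Psi> y \<in> V" and \<Phi>_in: "x \<in> V \<Longrightarrow> \<Phi> x \<in> W"
  and \<Phi>\<Psi>: "y \<in> W \<Longrightarrow> \<Phi> (\<Psi> y) = y" and \<Psi>\<Phi>: "x \<in> V \<Longrightarrow> \<Psi> (\<Phi> x) = x"
  using hom by (auto simp: homeomorphism_def)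

lemma W0: "0 \<in> W" using \<Phi>_in[OF V(2)] \<Phi>0 by simp

lemma \<Psi>0: "\<Psi> 0 = 0" using \<Psi>\<Phi>[OF V(2)] \<Phi>0 by simp

lemma h_\<Psi>: "y \<in> W \<Longrightarrow> k < q \<Longrightarrow> h k (\<Psi> y) = y $ \<iota> k"
  using coord[OF \<Psi>_in] \<Phi>\<Psi> by simp

text \<open>In the chart the components are coordinate hyperplanes, so
  \<open>holo_on_monomial\<close> applies; the result is carried back by
  \<open>\<Phi>\<close>.\<close>

lemma factor_divisor:
  assumes r: "r > 0" and F: "holo_on (ball 0 r) F"
    and zeros: "\<And>x. x \<in> ball 0 r \<Longrightarrow> F x = 0 \<Longrightarrow> \<exists>k<q. h k x = 0"
  shows "\<exists>a v s. 0 < s \<and> s \<le> r \<and> holo_on (ball 0 s) v \<and>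
    (\<forall>x\<in>ball 0 s. v x \<noteq> 0 \<and> F x = v x * (\<Prod>k<q. h k x ^ a k))"
proof -
  obtain r1 where r1: "r1 > 0" "ball 0 r1 \<subseteq> W" "\<Psi> ` ball 0 r1 \<subseteq> ball 0 r"
    using continuous_ball_image[OF holo_map_on_continuous_on[OF hol\<Psi>] W W0 open_ball, of 0 r] \<Psi>0 r by auto
  have "holo_on (ball 0 r1) (\<lambda>y. F (\<Psi> y))"
    by (rule holo_on_compose[OF holo_map_on_subset[OF hol\<Psi> r1(2)] F r1(3)])
  moreover have "\<exists>i\<in>\<iota> ` {..<q}. y $ i = 0" if y: "y \<in> ball 0 r1" "F (\<Psi> y) = 0" for y
  proof -
    obtain k where "k < q" "h k (\<Psi> y) = 0" using zeros[of "\<Psi> y"] y r1(3) by blast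
    moreover have "y \<in> W" using y r1(2) by blast
    ultimately show ?thesis using h_\<Psi>[of y k] by auto
  qed
  ultimately obtain a v s where s: "0 < s" "holo_on (ball 0 s) v" "s \<le> r1"
    "\<And>y. y \<in> ball 0 s \<Longrightarrow> v y \<noteq> 0 \<and> F (\<Psi> y) = v y * (\<Prod>i\<in>\<iota> ` {..<q}. y $ i ^ a i)"
    using holo_on_monomial[OF r1(1), of "\<lambda>y. F (\<Psi> y)" "\<iota> ` {..<q}"] by blast
  obtain s' where s': "s' > 0" "ball 0 s' \<subseteq> V" "\<Phi> ` ball 0 s' \<subseteq> ball 0 s"
    using continuous_ball_image[OF holo_map_on_continuous_on[OF hol\<Phi>] V open_ball, of 0 s] \<Phi>0 s(1) by auto
  have "holo_on (ball 0 s') (\<lambda>x. v (\<Phi> x))"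
    by (rule holo_on_compose[OF holo_map_on_subset[OF hol\<Phi> s'(2)] s(2) s'(3)])
  moreover have "v (\<Phi> x) \<noteq> 0 \<and> F x = v (\<Phi> x) * (\<Prod>k<q. h k x ^ a (\<iota> k))" if x: "x \<in> ball 0 s'" for x
  proof -
    have xV: "x \<in> V" and \<Phi>x: "\<Phi> x \<in> ball 0 s" using s' x by blast+
    have "(\<Prod>i\<in>\<iota> ` {..<q}. \<Phi> x $ i ^ a i) = (\<Prod>k<q. \<Phi> x $ \<iota> k ^ a (\<iota> k))"
      by (simp add: prod.reindex[OF inj])
    also have "\<dots> = (\<Prod>k<q. h k x ^ a (\<iota> k))" by (rule prod.cong) (auto simp: coord[OF xV])
    finally show ?thesis using s(4)[OF \<Phi>x] \<Psi>\<Phi>[OF xV] by simp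
  qed
  ultimately show ?thesis using s'(1) r
    by (intro exI[of _ "\<lambda>k. a (\<iota> k)"] exI[of _ "\<lambda>x. v (\<Phi> x)"] exI[of _ "min s' r"]) (auto intro: holo_on_subset)
qed

text \<open>The weights \<open>c\<close> give curves on which \<open>h k\<close> restricts to \<open>t ^ c (\<iota> k)\<close>, so that comparing the
  orders in \<open>t\<close> yields one linear equation between the exponents for every \<open>c\<close>.\<close>
lemma exponent_weighted_sum:
  assumes s: "s > 0" and v: "isCont v 0" "v 0 \<noteq> 0" and w: "isCont w 0" "w 0 \<noteq> 0"
    and eq: "\<And>x. x \<in> ball 0 s \<Longrightarrow> v x * (\<Prod>k<q. h k x ^ a k) = w x * (\<Prod>k<q. h k x ^ b k)"
    and c: "\<And>i. c i > (0::nat)"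
  shows "(\<Sum>k<q. c (\<iota> k) * a k) = (\<Sum>k<q. c (\<iota> k) * b k)"
proof -
  define y :: "real \<Rightarrow> complex^'n" where "y t = (\<chi> i. complex_of_real t ^ c i)" for t
  have "(y \<longlongrightarrow> (\<chi> i. complex_of_real 0 ^ c i)) (at_right 0)"
    unfolding y_def[abs_def]
    by (intro tendsto_vec_lambda tendsto_power tendsto_of_real tendsto_ident_at)
  \<comment> \<open>Positive weights: the curve ends at 0, where the units \<open>v\<close> and
    \<open>w\<close> are known not to vanish.\<close>
  moreover have "(\<chi> i. complex_of_real 0 ^ c i) = (0::complex^'n)" using c by (simp add: vec_eq_iff power_0_left)
  ultimately have y0: "(y \<longlongrightarrow> 0) (at_right 0)" by simp
  have "isCont \<Psi> 0" using holo_map_on_continuous_on[OF hol\<Psi>] W W0 continuous_on_eq_continuous_at by blast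
  then have g0: "((\<lambda>t. \<Psi> (y t)) \<longlongrightarrow> 0) (at_right 0)" using isCont_tendsto_compose[OF _ y0] \<Psi>0 by metis
  have v0: "((\<lambda>t. v (\<Psi> (y t))) \<longlongrightarrow> v 0) (at_right 0)" by (rule isCont_tendsto_compose[OF v(1) g0])
  have w0: "((\<lambda>t. w (\<Psi> (y t))) \<longlongrightarrow> w 0) (at_right 0)" by (rule isCont_tendsto_compose[OF w(1) g0])
  have yW: "\<forall>\<^sub>F t in at_right 0. y t \<in> W" by (rule topological_tendstoD[OF y0 W W0])
  have gs: "\<forall>\<^sub>F t in at_right 0. \<Psi> (y t) \<in> ball 0 s" by (rule topological_tendstoD[OF g0]) (use s in auto)
  have pow: "(\<Prod>k<q. h k (\<Psi> (y t)) ^ e k) = complex_of_real t ^ (\<Sum>k<q. c (\<iota> k) * e k)" if "y t \<in> W" for t e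
  proof -
    have "(\<Prod>k<q. h k (\<Psi> (y t)) ^ e k) = (\<Prod>k<q. complex_of_real t ^ (c (\<iota> k) * e k))"
      by (rule prod.cong) (simp_all add: h_\<Psi>[OF that], simp add: y_def power_mult)
    then show ?thesis by (simp add: power_sum)
  qed
  have ev: "\<forall>\<^sub>F t in at_right 0. v (\<Psi> (y t)) * complex_of_real t ^ (\<Sum>k<q. c (\<iota> k) * a k)
      = w (\<Psi> (y t)) * complex_of_real t ^ (\<Sum>k<q. c (\<iota> k) * b k)"
    using yW gs by eventually_elim (use eq pow in metis)
  show ?thesis
  proof (rule antisym)
    show "(\<Sum>k<q. c (\<iota> k) * b k) \<le> (\<Sum>k<q. c (\<iota> k) * a k)"
      by (rule power_order_aux[OF v0 w0 v(2) ev])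
    show "(\<Sum>k<q. c (\<iota> k) * a k) \<le> (\<Sum>k<q. c (\<iota> k) * b k)"
      by (rule power_order_aux[OF w0 v0 w(2)]) (use ev in \<open>auto elim: eventually_mono\<close>)
  qed
qed

text \<open>Two weights suffice: all equal to 1, and the same with 2 at coordinate
  \<open>\<iota> l\<close>. The difference of the two equations isolates the exponent at
  \<open>l\<close>.\<close>

lemma exponent_unique:
  assumes "s > 0" "isCont v 0" "v 0 \<noteq> 0" "isCont w 0" "w 0 \<noteq> 0"
    and "\<And>x. x \<in> ball 0 s \<Longrightarrow> v x * (\<Prod>k<q. h k x ^ a k) = w x * (\<Prod>k<q. h k x ^ b k)"
    and l: "l < q"
  shows "a l = b l"
proof -
  have 1: "(\<Sum>k<q. a k) = (\<Sum>k<q. b k)"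
    using exponent_weighted_sum[OF assms(1-6), of "\<lambda>_. 1"] by simp
  have delta: "(\<Sum>k<q. (if \<iota> k = \<iota> l then 2 else 1) * e k) = (\<Sum>k<q. e k) + e l" for e :: "nat \<Rightarrow> nat"
  proof -
    have "(\<Sum>k<q. (if \<iota> k = \<iota> l then 2 else 1) * e k) = (\<Sum>k<q. e k + (if k = l then e k else 0))"
      by (rule sum.cong) (use inj l in \<open>auto simp: inj_on_def\<close>)
    then show ?thesis using l by (simp add: sum.distrib)
  qed
  show ?thesis
    using exponent_weighted_sum[OF assms(1-6), of "\<lambda>i. if i = \<iota> l then 2 else 1"] 1 unfolding delta by simp
qed

text \<open>Composition with \<open>f\<close> replaces each factor \<open>h m\<close> by its own
  monomial, so exponents multiply as matrices; the new factor \<open>A\<close> stands on the right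
  because \<open>f\<close> is applied before \<open>f ^^ n\<close>.\<close>

lemma pullback_iterate:
  assumes s: "s > 0" and f: "holo_map_on (ball 0 s) f" "f 0 = 0"
    and u: "\<And>k. k < q \<Longrightarrow> holo_on (ball 0 s) (u k)"
    and u': "\<And>k x. k < q \<Longrightarrow> x \<in> ball 0 s \<Longrightarrow> u k x \<noteq> 0 \<and> h k (f x) = u k x * (\<Prod>l<q. h l x ^ A k l)"
    and k: "k < q"
  shows "\<exists>w e. 0 < e \<and> holo_on (ball 0 e) w \<and> w 0 \<noteq> 0 \<and>
    (\<forall>x\<in>ball 0 e. h k ((f ^^ n) x) = w x * (\<Prod>l<q. h l x ^ iter_exp q A n k l))"
proof (induction n)
  case 0
  have "(\<Prod>l<q. h l x ^ iter_exp q A 0 k l) = (\<Prod>l<q. if l = k then h l x else 1)" for x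
    by (rule prod.cong) (auto simp: iter_exp_0)
  then show ?case using k by (intro exI[of _ "\<lambda>x. 1"] exI[of _ 1]) (auto intro: holo_on_const)
next
  case (Suc n)
  then obtain w e where e: "0 < e" "holo_on (ball 0 e) w" "w 0 \<noteq> 0"
    "\<And>x. x \<in> ball 0 e \<Longrightarrow> h k ((f ^^ n) x) = w x * (\<Prod>l<q. h l x ^ iter_exp q A n k l)" by blast
  obtain e' where e': "e' > 0" "ball 0 e' \<subseteq> ball (0 :: complex^'n) s" "f ` ball 0 e' \<subseteq> ball 0 e"
    using continuous_ball_image[OF holo_map_on_continuous_on[OF f(1)] open_ball _ open_ball, of 0 0 e] f(2) s e(1)
    by (auto intro: that)
  \<comment> \<open>The units of the single pull-backs, raised to the old exponents, join the old
    unit composed with \<open>f\<close>.\<close>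
  define w' where "w' x = w (f x) * (\<Prod>l<q. u l x ^ iter_exp q A n k l)" for x
  have "holo_on (ball 0 e') w'" unfolding w'_def[abs_def]
    by (intro holo_on_mult holo_on_prod holo_on_power holo_on_subset[OF u e'(2)]
          holo_on_compose[OF holo_map_on_subset[OF f(1) e'(2)] e(2) e'(3)]) auto
  moreover have "w' 0 \<noteq> 0" using e(3) f(2) u'[of _ 0] s by (simp add: w'_def)
  moreover have "h k ((f ^^ Suc n) x) = w' x * (\<Prod>l<q. h l x ^ iter_exp q A (Suc n) k l)" if x: "x \<in> ball 0 e'" for x
  proof -
    have xs: "x \<in> ball 0 s" and fx: "f x \<in> ball 0 e" using e' x by blast+
    let ?E = "iter_exp q A n k"
    have "(\<Prod>m<q. h m (f x) ^ ?E m) = (\<Prod>m<q. (u m x * (\<Prod>l<q. h l x ^ A m l)) ^ ?E m)"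
      by (rule prod.cong) (use u' xs in auto)
    also have "\<dots> = (\<Prod>m<q. u m x ^ ?E m) * (\<Prod>m<q. \<Prod>l<q. h l x ^ (?E m * A m l))"
      by (simp add: power_mult_distrib prod.distrib prod_power_distrib power_mult[symmetric] mult.commute)
    also have "(\<Prod>m<q. \<Prod>l<q. h l x ^ (?E m * A m l)) = (\<Prod>l<q. \<Prod>m<q. h l x ^ (?E m * A m l))"
      by (rule prod.swap)
    also have "\<dots> = (\<Prod>l<q. h l x ^ iter_exp q A (Suc n) k l)"
      by (simp add: iter_exp_Suc power_sum)
    finally show ?thesis using e(4)[OF fx] by (simp add: funpow_swap1 w'_def mult.assoc)
  qed
  ultimately show ?case using e'(1) by blast
qed

text \<open>By uniqueness of exponents, \<open>h k o (f ^^ \<eta>)\<close> is a unit times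
  \<open>h k\<close> exactly if row \<open>k\<close> of the power of \<open>A\<close> is the unit
  vector at \<open>k\<close>.\<close>

lemma periodic_component_iff:
  assumes s: "s > 0" and f: "holo_map_on (ball 0 s) f" "f 0 = 0"
    and u: "\<And>k. k < q \<Longrightarrow> holo_on (ball 0 s) (u k)"
    and u': "\<And>k x. k < q \<Longrightarrow> x \<in> ball 0 s \<Longrightarrow> u k x \<noteq> 0 \<and> h k (f x) = u k x * (\<Prod>l<q. h l x ^ A k l)"
    and k: "k < q"
  shows "periodic_component f (h k) \<longleftrightarrow> k \<in> periodic_idx q A"
proof -
  note it = pullback_iterate[OF s f u u' k]
  have delta: "(\<Prod>l<q. h l x ^ (if l = k then 1 else 0)) = h k x" for x
  proof -
    have "(\<Prod>l<q. h l x ^ (if l = k then 1 else 0)) = (\<Prod>l<q. if l = k then h l x else 1)"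
      by (rule prod.cong) auto
    then show ?thesis using k by simp
  qed
  show ?thesis
  proof
    assume "periodic_component f (h k)"
    then obtain \<eta> v e where e: "\<eta> \<ge> 1" "e > 0" "holo_on (ball 0 e) v" "v 0 \<noteq> 0"
      "\<And>x. x \<in> ball 0 e \<Longrightarrow> h k ((f ^^ \<eta>) x) = v x * h k x"
      unfolding periodic_component_def by blast
    obtain w e' where w: "e' > 0" "holo_on (ball 0 e') w" "w 0 \<noteq> 0"
      "\<And>x. x \<in> ball 0 e' \<Longrightarrow> h k ((f ^^ \<eta>) x) = w x * (\<Prod>l<q. h l x ^ iter_exp q A \<eta> k l)"
      using it[of \<eta>] by blast
    have "iter_exp q A \<eta> k l = (if l = k then 1 else 0)" if "l < q" for l
    proof (rule exponent_unique[where a="iter_exp q A \<eta> k" and b="\<lambda>l. if l = k then 1 else 0" and s="min e e'" and v=w and w=v])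
      show "isCont w 0" by (rule holo_on_isCont[OF w(2)]) (use w(1) in simp)
      show "isCont v 0" by (rule holo_on_isCont[OF e(3)]) (use e(2) in simp)
      show "w x * (\<Prod>l<q. h l x ^ iter_exp q A \<eta> k l) = v x * (\<Prod>l<q. h l x ^ (if l = k then 1 else 0))"
        if "x \<in> ball 0 (min e e')" for x using e(5)[of x] w(4)[of x] that unfolding delta by simp
    qed (use e w that in auto)
    then show "k \<in> periodic_idx q A" using e(1) k by (auto simp: periodic_idx_def)
  next
    assume "k \<in> periodic_idx q A"
    then obtain \<eta> where \<eta>: "\<eta> \<ge> 1" "\<And>l. l < q \<Longrightarrow> iter_exp q A \<eta> k l = (if l = k then 1 else 0)"
      by (auto simp: periodic_idx_def)
    obtain w e' where w: "e' > 0" "holo_on (ball 0 e') w" "w 0 \<noteq> 0"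
      "\<And>x. x \<in> ball 0 e' \<Longrightarrow> h k ((f ^^ \<eta>) x) = w x * (\<Prod>l<q. h l x ^ iter_exp q A \<eta> k l)"
      using it[of \<eta>] by blast
    have "(\<Prod>l<q. h l x ^ iter_exp q A \<eta> k l) = h k x" for x
      unfolding delta[symmetric] by (rule prod.cong) (auto simp: \<eta>(2))
    then show "periodic_component f (h k)" unfolding periodic_component_def using \<eta>(1) w
      by (intro exI[of _ \<eta>] conjI exI[of _ w] exI[of _ e']) auto
  qed
qed

lemma ex_pullback_exponents:
  assumes r: "r > 0" and hf: "\<And>k. k < q \<Longrightarrow> holo_on (ball 0 r) (\<lambda>x. h k (f x))"
    and zeros: "\<And>k x. k < q \<Longrightarrow> x \<in> ball 0 r \<Longrightarrow> h k (f x) = 0 \<Longrightarrow> \<exists>l<q. h l x = 0"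
  shows "\<exists>A u s. 0 < s \<and> s \<le> r \<and> (\<forall>k<q. holo_on (ball 0 s) (u k) \<and>
    (\<forall>x\<in>ball 0 s. u k x \<noteq> 0 \<and> h k (f x) = u k x * (\<Prod>l<q. h l x ^ A k l)))"
proof -
  have "\<forall>k\<in>{..<q}. \<exists>av. \<exists>s>0. holo_on (ball 0 s) (snd av) \<and>
    (\<forall>x\<in>ball 0 s. snd av x \<noteq> 0 \<and> h k (f x) = snd av x * (\<Prod>l<q. h l x ^ fst av l))"
  proof
    fix k assume "k \<in> {..<q}"
    then have k: "k < q" by simp
    obtain a v s where "0 < s" "holo_on (ball 0 s) v" "\<forall>x\<in>ball 0 s. v x \<noteq> 0 \<and> h k (f x) = v x * (\<Prod>l<q. h l x ^ a l)"
      using factor_divisor[OF r hf[OF k] zeros[OF k]] by blast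
    then show "\<exists>av. \<exists>s>0. holo_on (ball 0 s) (snd av) \<and>
        (\<forall>x\<in>ball 0 s. snd av x \<noteq> 0 \<and> h k (f x) = snd av x * (\<Prod>l<q. h l x ^ fst av l))"
      by (intro exI[of _ "(a, v)"] exI[of _ s]) simp
  qed
  from bchoice[OF this] obtain av where av: "\<And>k. k \<in> {..<q} \<Longrightarrow> \<exists>s>0. holo_on (ball 0 s) (snd (av k)) \<and>
    (\<forall>x\<in>ball 0 s. snd (av k) x \<noteq> 0 \<and> h k (f x) = snd (av k) x * (\<Prod>l<q. h l x ^ fst (av k) l))" by blast
  have "\<exists>s>0. \<forall>k\<in>{..<q}. holo_on (ball 0 s) (snd (av k)) \<and>
    (\<forall>x\<in>ball 0 s. snd (av k) x \<noteq> 0 \<and> h k (f x) = snd (av k) x * (\<Prod>l<q. h l x ^ fst (av k) l))"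
    by (rule finite_common_radius[OF finite_lessThan av]) (auto intro: holo_on_subset)
  then obtain s where s: "s > 0" "\<And>k. k < q \<Longrightarrow> holo_on (ball 0 s) (snd (av k)) \<and>
    (\<forall>x\<in>ball 0 s. snd (av k) x \<noteq> 0 \<and> h k (f x) = snd (av k) x * (\<Prod>l<q. h l x ^ fst (av k) l))" by auto
  then show ?thesis using r
    by (intro exI[of _ "\<lambda>k. fst (av k)"] exI[of _ "\<lambda>k. snd (av k)"] exI[of _ "min s r"])
       (auto intro: holo_on_subset[of "ball 0 s"])
qed

end

section \<open>From the rigid germ to exponents and correction factors\<close>

lemma holo_on_clin: "holo_on U (clin a)"
  by (rule holo_onI) (use bounded_linear_imp_has_derivative[OF bounded_linear_clin] in blast)

lemma jac_eqI:
  assumes "\<And>i. ((\<lambda>x. F x $ i) has_derivative clin (M $ i)) (at a)"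
  shows "jac F a = M"
proof -
  have "jac F a $ i = M $ i" for i
    using grad_eq[OF assms[of i]] by (simp add: jac_def grad_def vec_eq_iff)
  then show ?thesis by (simp add: vec_eq_iff)
qed

lemma ex_holo_coords:
  fixes h :: "nat \<Rightarrow> complex^'n::finite \<Rightarrow> complex"
  assumes r: "r > 0" and h: "\<And>k. k < q \<Longrightarrow> holo_on (ball 0 r) (h k) \<and> h k 0 = 0"
    and \<iota>: "inj_on \<iota> {..<q}" "\<And>k. k < q \<Longrightarrow> M $ \<iota> k = grad (h k) 0" "det M \<noteq> 0"
    and \<Phi>: "\<And>x i. \<Phi> x $ i = (if i \<in> \<iota> ` {..<q} then h (inv_into {..<q} \<iota> i) x else clin (M $ i) x)"
  shows "\<exists>\<Psi> V W. holo_coords h q \<iota> \<Phi> \<Psi> V W"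
proof -
  have comp: "(\<lambda>x. \<Phi> x $ i) = (if i \<in> \<iota> ` {..<q} then h (inv_into {..<q} \<iota> i) else clin (M $ i))" for i
    by (auto simp: \<Phi>)
  have "holo_map_on (ball 0 r) \<Phi>"
    unfolding holo_map_on_def comp using h by (auto intro: holo_on_clin simp: inv_into_f_f[OF \<iota>(1)])
  moreover have "jac \<Phi> 0 = M"
  proof (rule jac_eqI)
    fix i show "((\<lambda>x. \<Phi> x $ i) has_derivative clin (M $ i)) (at 0)"
    proof (cases "i \<in> \<iota> ` {..<q}")
      case True
      then obtain k where k: "k < q" "i = \<iota> k" by auto
      then have "(\<lambda>x. \<Phi> x $ i) = h k" unfolding comp by (simp add: inv_into_f_f[OF \<iota>(1)])
      then show ?thesis using holo_on_grad[of "ball 0 r" "h k" 0] h[of k] k \<iota>(2)[of k] r by auto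
    next
      case False
      then show ?thesis unfolding comp by (simp add: bounded_linear_imp_has_derivative bounded_linear_clin)
    qed
  qed
  moreover have \<Phi>0: "\<Phi> 0 = 0" using h by (auto simp: vec_eq_iff \<Phi> inv_into_f_f[OF \<iota>(1)] clin_def)
  ultimately obtain V W \<Psi> where VW: "open V" "V \<subseteq> ball 0 r" "0 \<in> V" "open W" "homeomorphism V W \<Phi> \<Psi>" "holo_map_on W \<Psi>"
    using holo_inverse_function[of "ball 0 r" 0 \<Phi>] r \<iota>(3) by auto
  have "holo_coords h q \<iota> \<Phi> \<Psi> V W"
    by unfold_locales
       (use VW \<iota>(1) \<Phi>0 \<open>holo_map_on (ball 0 r) \<Phi>\<close> in \<open>auto intro: holo_map_on_subset simp: \<Phi> inv_into_f_f[OF \<iota>(1)]\<close>)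
  then show ?thesis by blast
qed

text \<open>An orbit of \<open>f x\<close> that meets \<open>crit U f\<close> is lengthened by
  \<open>x\<close> at its start. Since the components describe \<open>crit_inf\<close> only inside
  the ball of radius \<open>e\<close>, both \<open>x\<close> and \<open>f x\<close> have to lie
  there.\<close>

lemma rigid_zeros_pullback:
  fixes f :: "complex^'n::finite \<Rightarrow> complex^'n"
  assumes g: "crit_inf U f \<inter> ball 0 e = (\<Union>k<q. {x. h k x = 0}) \<inter> ball 0 e"
    and x: "x \<in> U" "x \<in> ball 0 e" "f x \<in> ball 0 e" and k: "k < q" "h k (f x) = 0"
  shows "\<exists>l<q. h l x = 0"
proof -
  have "f x \<in> crit_inf U f" using g k x(3) by blast
  then obtain n where n: "\<forall>m\<le>n. (f ^^ m) (f x) \<in> U" "(f ^^ n) (f x) \<in> crit U f"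
    by (auto simp: crit_inf_def)
  have "(f ^^ m) x \<in> U" if "m \<le> Suc n" for m
    using that n(1) x(1) by (cases m) (auto simp: funpow_swap1)
  moreover have "(f ^^ Suc n) x \<in> crit U f" using n(2) by (simp add: funpow_swap1)
  ultimately have "x \<in> crit_inf U f" unfolding crit_inf_def by blast
  then show ?thesis using g x(2) by blast
qed

text \<open>Collects on one ball all that the normal form needs. The chart inside the proof serves
  only to find the exponents; what survives of it are \<iota> and \<open>M\<close>, from which the
  final chart is rebuilt with the factors \<xi>.\<close>

lemma ex_exponents_and_solution:
  fixes f :: "complex^'n::finite \<Rightarrow> complex^'n"
  assumes U: "open U" "0 \<in> U" and f: "holo_map_on U f" "f 0 = 0" and "contracting f"
    and rc: "rigid_components U f q h"
  shows "\<exists>\<iota> (M::complex^'n^'n) A u \<pi> \<xi> d.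
    inj_on \<iota> {..<q} \<and> det M \<noteq> 0 \<and> 0 < d \<and> ball 0 d \<subseteq> U \<and>
    (\<forall>k<q. M $ \<iota> k = grad (h k) 0 \<and> h k 0 = 0 \<and> holo_on (ball 0 d) (h k) \<and> holo_on (ball 0 d) (u k) \<and>
       (\<forall>x\<in>ball 0 d. u k x \<noteq> 0 \<and> h k (f x) = u k x * (\<Prod>l<q. h l x ^ A k l)) \<and>
       (periodic_component f (h k) \<longleftrightarrow> k \<in> periodic_idx q A)) \<and>
    bij_betw \<pi> (periodic_idx q A) (periodic_idx q A) \<and>
    (\<forall>k\<in>periodic_idx q A. (\<forall>l<q. A k l = (if l = \<pi> k then 1 else 0)) \<and>
       holo_on (ball 0 d) (\<xi> k) \<and> \<xi> k 0 = 1 \<and>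
       (\<forall>x\<in>ball 0 d. \<xi> k x \<noteq> 0 \<and> (f x \<in> ball 0 d \<longrightarrow> u k 0 * \<xi> (\<pi> k) x = u k x * \<xi> k (f x))))"
proof -
  have hk: "\<And>k. k < q \<Longrightarrow> holo_germ (h k) \<and> h k 0 = 0"
    and ind: "\<And>c. (\<And>v. (\<Sum>k<q. c k * frechet_derivative (h k) (at 0) v) = 0) \<Longrightarrow> \<forall>k<q. c k = 0"
    and ge: "germ_eq (crit_inf U f) (\<Union>k<q. {x. h k x = 0})"
    using rc unfolding rigid_components_def by blast+
  obtain e where e: "e > 0" "crit_inf U f \<inter> ball 0 e = (\<Union>k<q. {x. h k x = 0}) \<inter> ball 0 e"
    using ge unfolding germ_eq_def by blast
  have "\<exists>s>0. \<forall>k\<in>{..<q}. holo_on (ball 0 s) (h k)"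
  proof (rule finite_common_radius[OF finite_lessThan])
    fix k assume "k \<in> {..<q}"
    then obtain V where "open V" "0 \<in> V" "holo_on V (h k)" using hk unfolding holo_germ_def by blast
    then show "\<exists>s>0. holo_on (ball 0 s) (h k)" using holo_on_subset open_contains_ball by metis
  qed (auto intro: holo_on_subset)
  then obtain s0 where s0: "s0 > 0" "\<And>k. k < q \<Longrightarrow> holo_on (ball 0 s0) (h k)" by auto
  obtain K \<rho> r1 where K: "1 \<le> K" "0 < \<rho>" "\<rho> < 1" "0 < r1"
    "\<And>x n. norm x < r1 \<Longrightarrow> norm ((f ^^ n) x) \<le> K * \<rho> ^ n * norm x"
    using contracting_iterates[of "jac f 0" f] holo_map_on_jac[OF f(1) U(2)] f(2) \<open>contracting f\<close>
    unfolding contracting_def by blast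
  \<comment> \<open>Inside \<open>e\<close> the components describe \<open>crit_inf\<close>, inside
    \<open>s0\<close> all \<open>h k\<close> are holomorphic, inside \<open>r1\<close> the iterates
    are controlled.\<close>
  define r2 where "r2 = min e (min s0 r1)"
  have r2: "r2 > 0" using e s0 K by (simp add: r2_def)
  have "continuous_on (U \<inter> ball 0 r2) f" using holo_map_on_continuous_on[OF f(1)] continuous_on_subset by blast
  then obtain r where r: "r > 0" "ball 0 r \<subseteq> U \<inter> ball 0 r2" "f ` ball 0 r \<subseteq> ball 0 r2"
    using continuous_ball_image[of "U \<inter> ball 0 r2" f 0 "ball 0 r2", OF _ open_Int[OF U(1) open_ball]] U f(2) r2 by auto
  have fr: "holo_map_on (ball 0 r) f" using r(2) by (intro holo_map_on_subset[OF f(1)]) auto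
  have br2: "ball (0::complex^'n) r2 \<subseteq> ball 0 e" "ball (0::complex^'n) r2 \<subseteq> ball 0 s0" "ball (0::complex^'n) r2 \<subseteq> ball 0 r1"
    by (auto simp: r2_def)
  have hr: "holo_on (ball 0 r) (h k)" if "k < q" for k
    using r(2) br2 by (intro holo_on_subset[OF s0(2)[OF that]]) auto
  have clin_grad: "frechet_derivative (h k) (at 0) = clin (grad (h k) 0)" if "k < q" for k
    by (rule frechet_derivative_at[OF holo_on_grad[OF s0(2)[OF that]], symmetric]) (use s0(1) in simp)
  have ind': "\<forall>k<q. c k = 0" if "\<And>v. (\<Sum>k<q. c k * clin (grad (h k) 0) v) = 0" for c
    by (rule ind) (use that in \<open>simp add: clin_grad\<close>)
  obtain \<iota> and M :: "complex^'n^'n" where \<iota>: "inj_on \<iota> {..<q}" "\<And>k. k < q \<Longrightarrow> M $ \<iota> k = grad (h k) 0" "det M \<noteq> 0"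
    using complete_to_invertible[of "\<lambda>k. grad (h k) 0" q, OF ind'] by blast
  define \<Phi> where "\<Phi> x = (\<chi> i. if i \<in> \<iota> ` {..<q} then h (inv_into {..<q} \<iota> i) x else clin (M $ i) x)" for x
  obtain \<Psi> V W where "holo_coords h q \<iota> \<Phi> \<Psi> V W"
    using ex_holo_coords[OF r(1) _ \<iota>, where \<Phi>=\<Phi>] hr hk unfolding \<Phi>_def by auto
  then interpret holo_coords h q \<iota> \<Phi> \<Psi> V W .
  have hf: "holo_on (ball 0 r) (\<lambda>x. h k (f x))" if "k < q" for k
    by (rule holo_on_compose[OF fr s0(2)[OF that]]) (use r(3) br2 in blast)
  have zeros: "\<exists>l<q. h l x = 0" if "k < q" "x \<in> ball 0 r" "h k (f x) = 0" for k x
    by (rule rigid_zeros_pullback[OF e(2) _ _ _ that(1,3)]) (use that r br2 in blast)+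
  obtain A u s where s: "0 < s" "s \<le> r" and
    us: "\<And>k. k < q \<Longrightarrow> holo_on (ball 0 s) (u k)"
    "\<And>k x. k < q \<Longrightarrow> x \<in> ball 0 s \<Longrightarrow> u k x \<noteq> 0 \<and> h k (f x) = u k x * (\<Prod>l<q. h l x ^ A k l)"
  proof -
    have "\<exists>A u s. 0 < s \<and> s \<le> r \<and> (\<forall>k<q. holo_on (ball 0 s) (u k) \<and>
      (\<forall>x\<in>ball 0 s. u k x \<noteq> 0 \<and> h k (f x) = u k x * (\<Prod>l<q. h l x ^ A k l)))"
      by (rule ex_pullback_exponents[OF r(1) hf]) (assumption, rule zeros)
    then show ?thesis using that by blast
  qed
  have fs: "holo_map_on (ball 0 s) f" using s(2) by (intro holo_map_on_subset[OF fr]) auto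
  \<comment> \<open>\<open>h k\<close> vanishes at \<open>f 0 = 0\<close> while its unit does not
    vanish at 0, so the monomial does and cannot be constant.\<close>
  have rows: "\<exists>l<q. A k l > 0" if k: "k < q" for k
  proof -
    have "(\<Prod>l<q. h l 0 ^ A k l) = 0" using us(2)[OF k, of 0] s(1) hk[OF k] f(2) by auto
    then show ?thesis by (auto simp: prod_zero_iff intro: gr0I)
  qed
  obtain \<pi> where \<pi>: "bij_betw \<pi> (periodic_idx q A) (periodic_idx q A)"
    "\<forall>k\<in>periodic_idx q A. \<forall>l<q. A k l = (if l = \<pi> k then 1 else 0)"
    using periodic_permutation[of q A, OF rows] by blast
  let ?R = "periodic_idx q A"
  have Rq: "k < q" if "k \<in> ?R" for k using that by (simp add: periodic_idx_def)
  have finR: "finite ?R" by (rule finite_subset[of _ "{..<q}"]) (auto dest: Rq)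
  \<comment> \<open>Dividing by the value at 0 gives the factors the value 1 there, as the infinite
    product requires; the constants remain as \<alpha>.\<close>
  define v where "v k x = u k x * inverse (u k 0)" for k x
  have r1: "s \<le> r1" using s r(2) br2(3) r(1) ball_subset_ball_iff[of "0::complex^'n" r 0 r1] by auto
  have u0: "u k 0 \<noteq> 0" if "k < q" for k using us(2)[OF that, of 0] s(1) by simp
  obtain \<xi> d where d: "0 < d" "d \<le> s" "\<And>k. k \<in> ?R \<Longrightarrow> holo_on (ball 0 d) (\<xi> k) \<and> \<xi> k 0 = 1"
    "\<And>k x. k \<in> ?R \<Longrightarrow> x \<in> ball 0 d \<Longrightarrow> f x \<in> ball 0 d \<Longrightarrow> \<xi> (\<pi> k) x = v k x * \<xi> k (f x)"
  proof -
    have "\<exists>\<xi> d. 0 < d \<and> d \<le> s \<and> (\<forall>k\<in>?R. holo_on (ball 0 d) (\<xi> k) \<and> \<xi> k 0 = 1) \<and>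
      (\<forall>k\<in>?R. \<forall>x\<in>ball 0 d. f x \<in> ball 0 d \<longrightarrow> \<xi> (\<pi> k) x = v k x * \<xi> k (f x))"
    proof (rule infinite_product_solution[OF finR \<pi>(1) fs f(2) s(1) K(1,2,3)])
      show "norm ((f ^^ n) x) \<le> K * \<rho> ^ n * norm x" if "norm x < s" for x n using K(5) that r1 by simp
      fix k assume "k \<in> ?R"
      then have k: "k < q" by (rule Rq)
      show "holo_on (ball 0 s) (v k)" unfolding v_def[abs_def] by (intro holo_on_mult us(1)[OF k] holo_on_const)
      show "v k 0 = 1" using u0[OF k] by (simp add: v_def)
    qed
    then show ?thesis using that by blast
  qed
  \<comment> \<open>Where \<xi> has no zeros, \<open>h k\<close> and
    \<open>h k x * \<xi> k x\<close> define the same hypersurface.\<close>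
  have "\<exists>t>0. \<forall>k\<in>?R. \<forall>x\<in>ball 0 t. \<xi> k x \<noteq> 0"
  proof (rule finite_common_radius[OF finR])
    fix k assume "k \<in> ?R"
    then show "\<exists>t>0. \<forall>x\<in>ball 0 t. \<xi> k x \<noteq> 0" using holo_on_nonzero_ball[OF d(1), of "\<xi> k"] d(3)[of k] by auto
  qed auto
  then obtain t where t: "t > 0" "\<And>k x. k \<in> ?R \<Longrightarrow> x \<in> ball 0 t \<Longrightarrow> \<xi> k x \<noteq> 0" by blast
  define d' where "d' = min d t"
  have bd: "ball (0::complex^'n) d' \<subseteq> ball 0 d" "ball (0::complex^'n) d' \<subseteq> ball 0 t" "ball (0::complex^'n) d' \<subseteq> ball 0 s"
    "ball (0::complex^'n) d' \<subseteq> ball 0 r" "ball (0::complex^'n) d' \<subseteq> U"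
  proof -
    show 1: "ball (0::complex^'n) d' \<subseteq> ball 0 d" "ball (0::complex^'n) d' \<subseteq> ball 0 t" by (auto simp: d'_def)
    then show "ball (0::complex^'n) d' \<subseteq> ball 0 s" using d(2) by auto
    then show "ball (0::complex^'n) d' \<subseteq> ball 0 r" using s(2) by auto
    then show "ball (0::complex^'n) d' \<subseteq> U" using r(2) by auto
  qed
  have eq: "u k 0 * \<xi> (\<pi> k) x = u k x * \<xi> k (f x)" if k: "k \<in> ?R" "x \<in> ball 0 d'" "f x \<in> ball 0 d'" for k x
    using d(4)[OF k(1) subsetD[OF bd(1) k(2)] subsetD[OF bd(1) k(3)]] u0[OF Rq[OF k(1)]] by (simp add: v_def)
  have per: "periodic_component f (h k) \<longleftrightarrow> k \<in> ?R" if "k < q" for k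
    by (rule periodic_component_iff[OF s(1) fs f(2) us that])
  have d'0: "d' > 0" using d t by (simp add: d'_def)
  have hd': "holo_on (ball 0 d') (h k)" "holo_on (ball 0 d') (u k)" if "k < q" for k
    using holo_on_subset[OF hr[OF that] bd(4)] holo_on_subset[OF us(1)[OF that] bd(3)] by blast+
  have ud': "u k x \<noteq> 0" "h k (f x) = u k x * (\<Prod>l<q. h l x ^ A k l)" if "k < q" "x \<in> ball 0 d'" for k x
    using us(2)[OF that(1) subsetD[OF bd(3) that(2)]] by blast+
  have \<xi>d': "holo_on (ball 0 d') (\<xi> k)" "\<xi> k 0 = 1" if "k \<in> ?R" for k
    using holo_on_subset[of "ball 0 d" "\<xi> k", OF _ bd(1)] d(3)[OF that] by blast+
  have \<xi>n: "\<xi> k x \<noteq> 0" if "k \<in> ?R" "x \<in> ball 0 d'" for k x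
    by (rule t(2)[OF that(1) subsetD[OF bd(2) that(2)]])
  have row: "A k l = (if l = \<pi> k then 1 else 0)" if "k \<in> ?R" "l < q" for k l
    using \<pi>(2) that by blast
  have h0: "h k 0 = 0" if "k < q" for k using hk[OF that] by blast
  show ?thesis
    by (intro exI[of _ \<iota>] exI[of _ M] exI[of _ A] exI[of _ u] exI[of _ \<pi>] exI[of _ \<xi>] exI[of _ d']
        conjI allI ballI impI \<iota> d'0 bd(5) h0 hd' ud' per \<pi>(1) row \<xi>d' \<xi>n eq)
qed

section \<open>The normal form\<close>

theorem mainTheorem3:
  fixes U :: "(complex^'n::finite) set"
    and f :: "complex^'n \<Rightarrow> complex^'n"
    and q :: nat
    and h :: "nat \<Rightarrow> complex^'n \<Rightarrow> complex"
  assumes "open U" and "0 \<in> U"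
    and "holo_map_on U f" and "f 0 = 0"
    and "contracting f"
    and "rigid_components U f q h"
  shows "\<exists>(\<phi>::complex^'n \<Rightarrow> complex^'n) e R P T (\<alpha>::'n \<Rightarrow> complex) (\<beta>::'n \<Rightarrow> complex)
            (B::'n \<Rightarrow> 'n \<Rightarrow> nat) (C::'n \<Rightarrow> 'n \<Rightarrow> nat) (D::'n \<Rightarrow> 'n \<Rightarrow> nat)
            (g::complex^'n \<Rightarrow> complex^'n) (k::complex^'n \<Rightarrow> complex^'n) (\<sigma>::'n \<Rightarrow> nat).
     e > 0 \<and> ball 0 e \<subseteq> U \<and> holo_map_on (ball 0 e) \<phi> \<and> \<phi> 0 = 0 \<and> det (jac \<phi> 0) \<noteq> 0 \<and>
     R \<inter> P = {} \<and> R \<inter> T = {} \<and> P \<inter> T = {} \<and> R \<union> P \<union> T = UNIV \<and>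
     (\<forall>i\<in>R. \<alpha> i \<noteq> 0) \<and> (\<forall>j\<in>P. \<beta> j \<noteq> 0) \<and> perm_matrix_on R B \<and>
     holo_map_germ g \<and> (\<forall>j\<in>P. g 0 $ j = 0) \<and> holo_map_germ k \<and> (\<forall>j\<in>T. k 0 $ j = 0) \<and>
     (\<forall>x\<in>ball 0 e. \<forall>i. \<phi> (f x) $ i =
        (if i \<in> R then \<alpha> i * (\<Prod>l\<in>R. (\<phi> x $ l) ^ B l i)
         else if i \<in> P then \<beta> i * (\<Prod>l\<in>R. (\<phi> x $ l) ^ C l i) * (\<Prod>l\<in>P. (\<phi> x $ l) ^ D l i)
                              * (1 + g (\<phi> x) $ i)
         else k (\<phi> x) $ i)) \<and>
     germ_eq (crit_inf U f) {x. (\<Prod>i\<in>R \<union> P. \<phi> x $ i) = 0} \<and>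
     bij_betw \<sigma> (R \<union> P) {..<q} \<and>
     (\<forall>i\<in>R \<union> P. germ_eq {x. \<phi> x $ i = 0} {x. h (\<sigma> i) x = 0}) \<and>
     (\<forall>i\<in>R \<union> P. (periodic_component f (h (\<sigma> i)) \<longleftrightarrow> i \<in> R))"
proof -
  from ex_exponents_and_solution[OF assms]
  obtain \<iota> and M :: "complex^'n^'n" and A u \<pi> \<xi> d where norm_form:
    "inj_on \<iota> {..<q} \<and> det M \<noteq> 0 \<and> 0 < d \<and> ball 0 d \<subseteq> U \<and>
    (\<forall>k<q. M $ \<iota> k = grad (h k) 0 \<and> h k 0 = 0 \<and> holo_on (ball 0 d) (h k) \<and> holo_on (ball 0 d) (u k) \<and>
       (\<forall>x\<in>ball 0 d. u k x \<noteq> 0 \<and> h k (f x) = u k x * (\<Prod>l<q. h l x ^ A k l)) \<and>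
       (periodic_component f (h k) \<longleftrightarrow> k \<in> periodic_idx q A)) \<and>
    bij_betw \<pi> (periodic_idx q A) (periodic_idx q A) \<and>
    (\<forall>k\<in>periodic_idx q A. (\<forall>l<q. A k l = (if l = \<pi> k then 1 else 0)) \<and>
       holo_on (ball 0 d) (\<xi> k) \<and> \<xi> k 0 = 1 \<and>
       (\<forall>x\<in>ball 0 d. \<xi> k x \<noteq> 0 \<and> (f x \<in> ball 0 d \<longrightarrow> u k 0 * \<xi> (\<pi> k) x = u k x * \<xi> k (f x))))"
    by (elim exE) (rule that)
  have \<iota>: "inj_on \<iota> {..<q}" and M: "det M \<noteq> 0" and d: "0 < d" "ball 0 d \<subseteq> U"
    and \<pi>: "bij_betw \<pi> (periodic_idx q A) (periodic_idx q A)"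
    using norm_form by blast+
  have h: "M $ \<iota> k = grad (h k) 0 \<and> h k 0 = 0 \<and> holo_on (ball 0 d) (h k)" and u: "holo_on (ball 0 d) (u k)"
    and per: "periodic_component f (h k) \<longleftrightarrow> k \<in> periodic_idx q A" if "k < q" for k
    using norm_form that by blast+
  have hf: "u k x \<noteq> 0 \<and> h k (f x) = u k x * (\<Prod>l<q. h l x ^ A k l)" if "k < q" "x \<in> ball 0 d" for k x
    using norm_form that by blast
  have row: "A k l = (if l = \<pi> k then 1 else 0)" if "k \<in> periodic_idx q A" "l < q" for k l
    using norm_form that by blast
  have \<xi>: "holo_on (ball 0 d) (\<xi> k) \<and> \<xi> k 0 = 1" if "k \<in> periodic_idx q A" for k
    using norm_form that by blast
  have \<xi>n: "\<xi> k x \<noteq> 0" if "k \<in> periodic_idx q A" "x \<in> ball 0 d" for k x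
    using norm_form that by blast
  have \<xi>f: "u k 0 * \<xi> (\<pi> k) x = u k x * \<xi> k (f x)" if "k \<in> periodic_idx q A" "x \<in> ball 0 d" "f x \<in> ball 0 d" for k x
    using norm_form that by blast
  \<comment> \<open>Primed sets contain indices of components, unprimed ones indices of coordinates;
    \<iota> and its inverse \<sigma> translate between them.\<close>
  define R' where "R' = periodic_idx q A"
  define P' where "P' = {..<q} - R'"
  define R where "R = \<iota> ` R'"
  define P where "P = \<iota> ` P'"
  define T where "T = - (R \<union> P)"
  define \<sigma> where "\<sigma> = inv_into {..<q} \<iota>"
  have R'q: "R' \<subseteq> {..<q}" by (auto simp: R'_def periodic_idx_def)
  have \<sigma>\<iota>: "\<sigma> (\<iota> k) = k" if "k < q" for k unfolding \<sigma>_def using that by (simp add: inv_into_f_f[OF \<iota>])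
  have RP: "R \<union> P = \<iota> ` {..<q}" using R'q by (auto simp: R_def P_def P'_def)
  have disj: "R \<inter> P = {}" using R'q inj_on_image_Int[OF \<iota>, of R' P'] by (auto simp: R_def P_def P'_def)
  have \<iota>R: "bij_betw \<iota> R' R" and \<iota>P: "bij_betw \<iota> P' P"
    unfolding bij_betw_def R_def P_def P'_def using R'q \<iota> by (auto intro: inj_on_subset)
  have bij\<sigma>: "bij_betw \<sigma> (R \<union> P) {..<q}"
    unfolding RP \<sigma>_def by (rule bij_betw_inv_into) (use \<iota> in \<open>simp add: bij_betw_def\<close>)
  have bij\<sigma>R: "bij_betw \<sigma> R R'"
    by (rule bij_betw_subset[OF bij\<sigma>]) (use R'q \<sigma>\<iota> in \<open>auto simp: R_def image_image subset_eq\<close>)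
  have \<pi>R: "\<pi> k \<in> R'" if "k \<in> R'" for k using that \<pi> by (auto simp: R'_def bij_betw_def)
  define \<phi> :: "complex^'n \<Rightarrow> complex^'n" where
    "\<phi> x = (\<chi> i. if i \<in> R then h (\<sigma> i) x * \<xi> (\<sigma> i) x else if i \<in> P then h (\<sigma> i) x else clin (M $ i) x)" for x
  have \<phi>R: "\<phi> x $ \<iota> k = h k x * \<xi> k x" if "k \<in> R'" for k x
    using that R'q \<sigma>\<iota>[of k] by (auto simp: \<phi>_def R_def)
  have \<phi>P: "\<phi> x $ \<iota> k = h k x" if "k \<in> P'" for k x
    using that \<sigma>\<iota>[of k] disj by (auto simp: \<phi>_def R_def P_def P'_def)
  have \<phi>T: "\<phi> x $ i = clin (M $ i) x" if "i \<in> T" for i x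
    using that by (auto simp: \<phi>_def T_def)
  have cases: "(\<exists>k\<in>R'. i = \<iota> k) \<or> (\<exists>k\<in>P'. i = \<iota> k) \<or> i \<in> T" for i
    by (auto simp: T_def R_def P_def)
  have hol\<phi>: "holo_map_on (ball 0 d) \<phi>"
    unfolding holo_map_on_def
  proof
    fix i
    consider k where "k \<in> R'" "i = \<iota> k" | k where "k \<in> P'" "i = \<iota> k" | "i \<in> T" using cases by blast
    then show "holo_on (ball 0 d) (\<lambda>x. \<phi> x $ i)"
    proof cases
      case 1
      then have "holo_on (ball 0 d) (\<lambda>x. h k x * \<xi> k x)" using h \<xi> R'q by (intro holo_on_mult) (auto simp: R'_def)
      then show ?thesis using 1 \<phi>R by simp
    next
      case 2
      then have "holo_on (ball 0 d) (h k)" using h by (simp add: P'_def)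
      then show ?thesis using 2 \<phi>P by simp
    next
      case 3
      then show ?thesis using holo_on_clin by (simp add: \<phi>T)
    qed
  qed
  have \<phi>0: "\<phi> 0 = 0"
    unfolding vec_eq_iff
  proof
    fix i
    consider k where "k \<in> R'" "i = \<iota> k" | k where "k \<in> P'" "i = \<iota> k" | "i \<in> T" using cases by blast
    then show "\<phi> 0 $ i = (0 :: complex^'n) $ i"
      by cases (use h R'q \<phi>R \<phi>P \<phi>T in \<open>auto simp: P'_def clin_def\<close>)
  qed
  have jac: "jac \<phi> 0 = M"
  proof (rule jac_eqI)
    fix i
    consider k where "k \<in> R'" "i = \<iota> k" | k where "k \<in> P'" "i = \<iota> k" | "i \<in> T" using cases by blast
    then show "((\<lambda>x. \<phi> x $ i) has_derivative clin (M $ i)) (at 0)"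
    proof cases
      case 1
      then have k: "k < q" "k \<in> periodic_idx q A" using R'q by (auto simp: R'_def)
      have "((\<lambda>x. h k x * \<xi> k x) has_derivative clin (\<xi> k 0 *s grad (h k) 0 + h k 0 *s grad (\<xi> k) 0)) (at 0)"
        by (intro has_derivative_clin_mult holo_on_grad[of "ball 0 d"]) (use h \<xi> k d in auto)
      then show ?thesis using 1 \<phi>R h[OF k(1)] \<xi>[OF k(2)] by simp
    next
      case 2
      then have k: "k < q" by (simp add: P'_def)
      show ?thesis using 2 holo_on_grad[of "ball 0 d" "h k" 0] h[OF k] d \<phi>P by simp
    next
      case 3
      then show ?thesis by (simp add: \<phi>T bounded_linear_imp_has_derivative bounded_linear_clin)
    qed
  qed
  then obtain V W \<Psi> where VW: "open V" "V \<subseteq> ball 0 d" "0 \<in> V" "open W" "0 \<in> W" "homeomorphism V W \<phi> \<Psi>" "holo_map_on W \<Psi>"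
    using holo_inverse_function[of "ball 0 d" 0 \<phi>] hol\<phi> d M \<phi>0 by auto
  have \<Psi>\<phi>: "\<Psi> (\<phi> x) = x" if "x \<in> V" for x using VW(6) that by (simp add: homeomorphism_def)
  have \<Psi>0: "\<Psi> 0 = 0" using \<Psi>\<phi>[OF VW(3)] \<phi>0 by simp
  have "continuous_on V f"
    by (rule holo_map_on_continuous_on[OF holo_map_on_subset[OF assms(3)]]) (use VW(2) d(2) in blast)
  then obtain e where e: "e > 0" "ball 0 e \<subseteq> V" "f ` ball 0 e \<subseteq> ball 0 d"
  proof -
    have "\<exists>e>0. ball 0 e \<subseteq> V \<and> f ` ball 0 e \<subseteq> ball 0 d"
      by (rule continuous_ball_image[OF \<open>continuous_on V f\<close> VW(1,3) open_ball]) (use assms(4) d in simp)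
    then show ?thesis using that by blast
  qed
  have ed: "ball (0 :: complex^'n) e \<subseteq> ball 0 d" using e VW(2) by blast
  \<comment> \<open>Here \<Psi> takes values in the ball on which \<open>G\<close> and
    \<open>\<phi> o f\<close> are holomorphic; \<open>g\<close> and \<open>kk\<close> are functions
    of the new coordinates, hence composed with \<Psi>.\<close>
  define W' where "W' = W \<inter> \<Psi> -` ball 0 e"
  have W': "open W'" "0 \<in> W'"
    unfolding W'_def using continuous_open_preimage[OF holo_map_on_continuous_on[OF VW(7)] VW(4) open_ball] VW(5) \<Psi>0 e(1) by auto
  have hol\<Psi>: "holo_map_on W' \<Psi>" "\<Psi> ` W' \<subseteq> ball 0 e" using holo_map_on_subset[OF VW(7)] by (auto simp: W'_def)
  \<comment> \<open>The normalized unit \<open>u k\<close> times the powers of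
    \<open>inverse (\<xi> l x)\<close> that arise when a periodic \<open>h l\<close> is written as
    the new coordinate divided by \<xi>; subtracting 1 makes it vanish at 0.\<close>
  define G where "G k x = u k x * inverse (u k 0) * (\<Prod>l\<in>R'. inverse (\<xi> l x) ^ A k l) + (- 1)" for k x
  have u0: "u k 0 \<noteq> 0" if "k < q" for k using hf[OF that, of 0] d by simp
  have holG: "holo_on (ball 0 e) (G k)" if "k < q" for k
    unfolding G_def[abs_def]
    by (intro holo_on_add holo_on_mult holo_on_const holo_on_prod holo_on_power holo_on_inverse holo_on_subset[OF _ ed])
       (use u[OF that] \<xi> \<xi>n ed in \<open>auto simp: R'_def\<close>)
  have G0: "G k 0 = 0" if "k < q" for k
    using u0[OF that] \<xi> by (simp add: G_def R'_def)
  define g :: "complex^'n \<Rightarrow> complex^'n" where "g y = (\<chi> i. if i \<in> P then G (\<sigma> i) (\<Psi> y) else 0)" for y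
  \<comment> \<open>All components of \<open>\<phi> o f\<close> in the new coordinates; the formula
    reads only those in \<open>T\<close>.\<close>
  define kk where "kk y = \<phi> (f (\<Psi> y))" for y
  \<comment> \<open>The value at 0 of the unit, which serves both as \<alpha> on \<open>R\<close>
    and as \<beta> on \<open>P\<close>.\<close>
  define \<alpha> where "\<alpha> i = u (\<sigma> i) 0" for i
  define B :: "'n \<Rightarrow> 'n \<Rightarrow> nat" where "B l i = (if l = \<iota> (\<pi> (\<sigma> i)) then 1 else 0)" for l i
  \<comment> \<open>Transposed, as columns belong to the component that is pulled back. It is the
    witness for both \<open>C\<close> and \<open>D\<close>, since the products run over
    \<open>R\<close> and \<open>P\<close> separately.\<close>
  define C where "C l i = A (\<sigma> i) (\<sigma> l)" for l i
  have main: "\<phi> (f x) $ i =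
        (if i \<in> R then \<alpha> i * (\<Prod>l\<in>R. (\<phi> x $ l) ^ B l i)
         else if i \<in> P then \<alpha> i * (\<Prod>l\<in>R. (\<phi> x $ l) ^ C l i) * (\<Prod>l\<in>P. (\<phi> x $ l) ^ C l i)
                              * (1 + g (\<phi> x) $ i)
         else kk (\<phi> x) $ i)" if x: "x \<in> ball 0 e" for x i
  proof -
    have xd: "x \<in> ball 0 d" "f x \<in> ball 0 d" "\<Psi> (\<phi> x) = x" using x ed e \<Psi>\<phi> by blast+
    consider k where "k \<in> R'" "i = \<iota> k" | k where "k \<in> P'" "i = \<iota> k" | "i \<in> T" using cases by blast
    then show ?thesis
    proof cases
      case 1
      then have k: "k < q" "k \<in> periodic_idx q A" and iR: "i \<in> R" using R'q by (auto simp: R'_def R_def)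
      \<comment> \<open>Only the factor \<open>h (\<pi> k)\<close> remains, and
        \<open>\<xi>f\<close> exchanges the unit of \<open>h k\<close> for the factors \<xi> of the
        coordinates, which leaves the constant \<open>u k 0\<close>.\<close>
      have "(\<Prod>l<q. h l x ^ A k l) = (\<Prod>l<q. if l = \<pi> k then h l x else 1)"
        by (rule prod.cong) (auto simp: row[OF k(2)])
      then have p: "(\<Prod>l<q. h l x ^ A k l) = h (\<pi> k) x" using \<pi>R[OF 1(1)] R'q by (simp add: subset_eq)
      have "(\<Prod>l\<in>R. (\<phi> x $ l) ^ B l i) = (\<Prod>l\<in>R. if l = \<iota> (\<pi> k) then \<phi> x $ l else 1)"
        by (rule prod.cong) (auto simp: B_def 1(2) \<sigma>\<iota>[OF k(1)])
      also have "\<dots> = \<phi> x $ \<iota> (\<pi> k)" using \<pi>R[OF 1(1)] by (simp add: R_def)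
      also have "\<dots> = h (\<pi> k) x * \<xi> (\<pi> k) x" by (rule \<phi>R[OF \<pi>R[OF 1(1)]])
      finally have "\<alpha> i * (\<Prod>l\<in>R. (\<phi> x $ l) ^ B l i) = h (\<pi> k) x * (u k 0 * \<xi> (\<pi> k) x)"
        by (simp add: \<alpha>_def 1(2) \<sigma>\<iota>[OF k(1)])
      also have "\<dots> = \<phi> (f x) $ i"
        unfolding \<xi>f[OF k(2) xd(1,2)] 1(2) \<phi>R[OF 1(1)] using hf[OF k(1) xd(1)] p by simp
      finally show ?thesis using iR by simp
    next
      case 2
      then have k: "k < q" and iP: "i \<in> P" "i \<notin> R" using disj by (auto simp: P_def P'_def)
      have \<sigma>i: "\<sigma> i = k" using 2(2) \<sigma>\<iota>[OF k] by simp
      have pR: "(\<Prod>l\<in>R. (\<phi> x $ l) ^ C l i) = (\<Prod>l\<in>R'. (h l x * \<xi> l x) ^ A k l)"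
        unfolding prod.reindex_bij_betw[OF \<iota>R, symmetric]
        by (rule prod.cong) (use R'q in \<open>auto simp: C_def \<sigma>i \<phi>R \<sigma>\<iota> subset_eq\<close>)
      have pP: "(\<Prod>l\<in>P. (\<phi> x $ l) ^ C l i) = (\<Prod>l\<in>P'. h l x ^ A k l)"
        unfolding prod.reindex_bij_betw[OF \<iota>P, symmetric]
        by (rule prod.cong) (auto simp: C_def \<sigma>i \<phi>P \<sigma>\<iota> P'_def)
      \<comment> \<open>The powers of \<xi> contained in the periodic coordinates cancel against
        those built into \<open>G\<close>.\<close>
      have canc: "(\<Prod>l\<in>R'. (h l x * \<xi> l x) ^ A k l) * (\<Prod>l\<in>R'. inverse (\<xi> l x) ^ A k l) = (\<Prod>l\<in>R'. h l x ^ A k l)"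
        unfolding prod.distrib[symmetric]
        by (rule prod.cong) (use \<xi>n xd(1) in \<open>auto simp: R'_def power_mult_distrib[symmetric] mult.assoc\<close>)
      have split: "(\<Prod>l<q. h l x ^ A k l) = (\<Prod>l\<in>R'. h l x ^ A k l) * (\<Prod>l\<in>P'. h l x ^ A k l)"
        unfolding P'_def by (subst prod.subset_diff[OF R'q]) (simp_all add: mult.commute)
      have g1: "1 + g (\<phi> x) $ i = u k x * inverse (u k 0) * (\<Prod>l\<in>R'. inverse (\<xi> l x) ^ A k l)"
        using iP by (simp add: g_def \<sigma>i xd(3) G_def)
      have "\<alpha> i * (\<Prod>l\<in>R. (\<phi> x $ l) ^ C l i) * (\<Prod>l\<in>P. (\<phi> x $ l) ^ C l i) * (1 + g (\<phi> x) $ i)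
        = (u k 0 * inverse (u k 0)) * u k x * ((\<Prod>l\<in>R'. (h l x * \<xi> l x) ^ A k l) * (\<Prod>l\<in>R'. inverse (\<xi> l x) ^ A k l))
          * (\<Prod>l\<in>P'. h l x ^ A k l)"
        unfolding pR pP g1 \<alpha>_def \<sigma>i by (simp only: mult_ac)
      also have "\<dots> = h k (f x)"
        unfolding canc using hf[OF k xd(1)] split u0[OF k] by (simp add: mult.assoc)
      also have "\<dots> = \<phi> (f x) $ i" using \<phi>P[OF 2(1)] 2(2) by simp
      finally show ?thesis using iP by simp
    next
      case 3
      then show ?thesis by (simp add: T_def kk_def xd(3))
    qed
  qed
  have holg: "holo_map_germ g"
    unfolding holo_map_germ_def
  proof (intro exI[of _ W'] conjI W')
    show "holo_map_on W' g"
      unfolding holo_map_on_def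
    proof
      fix i show "holo_on W' (\<lambda>y. g y $ i)"
      proof (cases "i \<in> P")
        case True
        then have "\<sigma> i < q" using bij\<sigma> by (auto simp: bij_betw_def)
        from holo_on_compose[OF hol\<Psi>(1) holG[OF this] hol\<Psi>(2)] show ?thesis using True by (simp add: g_def)
      qed (simp add: g_def holo_on_const)
    qed
  qed
  have holk: "holo_map_germ kk"
    unfolding holo_map_germ_def
  proof (intro exI[of _ W'] conjI W')
    have "holo_map_on (ball 0 e) f" using holo_map_on_subset[OF assms(3)] ed d(2) by blast
    then have "holo_map_on (ball 0 e) (\<lambda>x. \<phi> (f x))" by (rule holo_map_on_compose[OF _ hol\<phi> e(3)])
    then show "holo_map_on W' kk"
      unfolding kk_def[abs_def] by (rule holo_map_on_compose[OF hol\<Psi>(1) _ hol\<Psi>(2)])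
  qed
  have perm: "perm_matrix_on R B"
  proof -
    \<comment> \<open>\<open>permutes\<close> asks for a map on the whole type, hence the identity
      outside \<open>R\<close>.\<close>
    define p where "p i = (if i \<in> R then \<iota> (\<pi> (\<sigma> i)) else i)" for i
    have "bij_betw (\<iota> \<circ> (\<pi> \<circ> \<sigma>)) R R"
      using bij\<sigma>R \<pi> \<iota>R unfolding R'_def by (blast intro: bij_betw_trans)
    then have "bij_betw p R R" by (rule bij_betw_cong[THEN iffD1, rotated]) (simp add: p_def)
    then have "p permutes R" by (rule bij_imp_permutes) (simp add: p_def)
    then show ?thesis unfolding perm_matrix_on_def by (intro exI[of _ p]) (auto simp: B_def p_def)
  qed
  have zero: "\<phi> x $ \<iota> k = 0 \<longleftrightarrow> h k x = 0" if "k < q" "x \<in> ball 0 d" for k x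
  proof (cases "k \<in> R'")
    case True
    then show ?thesis using \<phi>R[OF True] \<xi>n[of k x] that by (simp add: R'_def)
  next
    case False
    then show ?thesis using \<phi>P[of k x] that by (simp add: P'_def)
  qed
  have germ: "germ_eq {x. \<phi> x $ i = 0} {x. h (\<sigma> i) x = 0}" if i: "i \<in> R \<union> P" for i
  proof -
    obtain k where k: "k < q" "i = \<iota> k" using i RP by auto
    then show ?thesis unfolding germ_eq_def using zero[OF k(1)] d(1) \<sigma>\<iota>[OF k(1)]
      by (intro exI[of _ d]) auto
  qed
  obtain e0 where e0: "e0 > 0" "crit_inf U f \<inter> ball 0 e0 = (\<Union>k<q. {x. h k x = 0}) \<inter> ball 0 e0"
    using assms(6) unfolding rigid_components_def germ_eq_def by blast
  have crit: "germ_eq (crit_inf U f) {x. (\<Prod>i\<in>R \<union> P. \<phi> x $ i) = 0}"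
    unfolding germ_eq_def
  proof (intro exI[of _ "min e0 d"] conjI)
    have eq: "(\<Prod>i\<in>R \<union> P. \<phi> x $ i) = 0 \<longleftrightarrow> (\<exists>k<q. h k x = 0)" if "x \<in> ball 0 d" for x
      unfolding RP using zero[OF _ that] by auto
    have "x \<in> crit_inf U f \<longleftrightarrow> (\<Prod>i\<in>R \<union> P. \<phi> x $ i) = 0" if "x \<in> ball 0 (min e0 d)" for x
    proof -
      have "x \<in> ball 0 e0" "x \<in> ball 0 d" using that by auto
      then show ?thesis using e0(2) eq[of x] by blast
    qed
    then show "crit_inf U f \<inter> ball 0 (min e0 d) = {x. (\<Prod>i\<in>R \<union> P. \<phi> x $ i) = 0} \<inter> ball 0 (min e0 d)"
      by blast
  qed (use e0 d in simp)
  have per': "periodic_component f (h (\<sigma> i)) \<longleftrightarrow> i \<in> R" if i: "i \<in> R \<union> P" for i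
  proof -
    obtain k where k: "k < q" "i = \<iota> k" using i RP by auto
    have "\<iota> k \<in> R \<longleftrightarrow> k \<in> R'" unfolding R_def using inj_on_image_mem_iff[OF \<iota>, of k R'] k R'q by simp
    then show ?thesis using per[OF k(1)] \<sigma>\<iota>[OF k(1)] k by (simp add: R'_def)
  qed
  have nz: "\<alpha> i \<noteq> 0" if "i \<in> R \<union> P" for i
    using that bij\<sigma> u0 by (auto simp: \<alpha>_def bij_betw_def)
  have g0: "g 0 $ j = 0" if "j \<in> P" for j
    using that bij\<sigma> G0 \<Psi>0 by (auto simp: g_def bij_betw_def)
  have k0: "kk 0 $ j = 0" for j using \<Psi>0 \<phi>0 assms(4) by (simp add: kk_def)
  have sub: "ball 0 e \<subseteq> U" using ed d(2) by blast
  have RT: "R \<inter> T = {}" "P \<inter> T = {}" "R \<union> P \<union> T = UNIV" by (auto simp: T_def)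
  have nzR: "\<alpha> i \<noteq> 0" if "i \<in> R" for i using nz that by blast
  have nzP: "\<alpha> i \<noteq> 0" if "i \<in> P" for i using nz that by blast
  have det: "det (jac \<phi> 0) \<noteq> 0" using M jac by simp
  show ?thesis
    by (rule exI[of _ \<phi>], rule exI[of _ e], rule exI[of _ R], rule exI[of _ P], rule exI[of _ T],
        rule exI[of _ \<alpha>], rule exI[of _ \<alpha>], rule exI[of _ B], rule exI[of _ C], rule exI[of _ C],
        rule exI[of _ g], rule exI[of _ kk], rule exI[of _ \<sigma>])
       (intro conjI ballI allI e(1) sub holo_map_on_subset[OF hol\<phi> ed] \<phi>0 det disj RT nzR nzP perm
          holg g0 holk k0 main crit bij\<sigma> germ per')
qed

end
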